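(* Let $X$, $Y$ be Banach spaces. If either $X^*$ or $Y$ has the approximation property, then the following hold: (a) $n(\mathcal{N}(X,Y))\leq\min\{n(X^* ),n(Y)\}$. (b) $n(\mathcal{N}(X,Y)^* )\leq\min\{n(X^{**}),n(Y^* )\}$.
   Context: Banach spaces are (nonzero) real or complex; $X$ and $Y$ are over the same field. $S_X$ denotes the unit sphere of $X$, $X^*$ its topological dual, and $\mathcal{L}(X)$ the Banach space of bounded linear operators on $X$ with the operator norm. For $T\in\mathcal{L}(X)$ the numerical radius is $v(T)=\sup\{|x^*(Tx)| : x\in S_X,\ x^*\in S_{X^*},\ x^*(x)=1\}$. The numerical index of $X$ is $n(X)=\inf\{v(T): T\in\mathcal{L}(X),\ \|T\|=1\}$. An operator $T\colon X\to Y$ is nuclear if there exist $x_n^*\in X^*$ and $y_n\in Y$ ($n\in\mathbb{N}$) such that $\sum_{n=1}^\infty\|x_n^*\|\,\|y_n\|<\infty$ and $Tx=\sum_{n=1}^\infty x_n^*(x)y_n$ for all $x\in X$. $\mathcal{N}(X,Y)$ is the Banach space of all nuclear operators from $X$ to $Y$ endowed with the nuclear norm $N(T)=\inf\sum_{n=1}^\infty\|x_n^*\|\,\|y_n\|$, the infimum being taken over all such representations of $T$. *)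

theory Defs
  imports "HOL-Analysis.Analysis" "HOL-Library.Function_Algebras"
begin

text \<open>The scalar field is real or complex. The class has exactly these two models up to
  isometric isomorphism, so that a statement over an arbitrary scalar field of this class covers
  the real and the complex case at once.\<close>

class real_or_complex = real_normed_field +
  assumes real_or_complex:
    "(\<forall>z. \<exists>a. z = a *\<^sub>R 1) \<or>
     (\<exists>i. i * i = - 1 \<and>
        (\<forall>z. \<exists>a b. z = a *\<^sub>R 1 + b *\<^sub>R i) \<and>
        (\<forall>a b. norm (a *\<^sub>R 1 + b *\<^sub>R i) = sqrt (a\<^sup>2 + b\<^sup>2)))"

instance real :: real_or_complex
  by standard simp

instance complex :: real_or_complex
proof
  have "\<i> * \<i> = - 1 \<and>
      (\<forall>z. \<exists>a b. z = a *\<^sub>R 1 + b *\<^sub>R \<i>) \<and>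
      (\<forall>a b. norm (a *\<^sub>R 1 + b *\<^sub>R \<i>) = sqrt (a\<^sup>2 + b\<^sup>2))"
  proof (intro conjI allI)
    fix z
    show "\<exists>a b. z = a *\<^sub>R 1 + b *\<^sub>R \<i>"
      by (rule exI[of _ "Re z"], rule exI[of _ "Im z"]) (simp add: complex_eq_iff)
  qed (auto simp: cmod_def)
  then show "(\<forall>z::complex. \<exists>a. z = a *\<^sub>R 1) \<or>
     (\<exists>i::complex. i * i = - 1 \<and>
        (\<forall>z. \<exists>a b. z = a *\<^sub>R 1 + b *\<^sub>R i) \<and>
        (\<forall>a b. norm (a *\<^sub>R 1 + b *\<^sub>R i) = sqrt (a\<^sup>2 + b\<^sup>2)))"
    by blast
qed

text \<open>A normed space is a linear subspace \<open>vecs\<close> of an ambient vector space, whose addition is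
  that of the ambient type, together with a norm of which only the values on \<open>vecs\<close> matter.
  Types of class \<open>banach\<close> do not suffice: the scalars may be complex, and duals, biduals and
  spaces of nuclear operators have to be normed spaces again.\<close>

record ('k, 'a) nspace =
  vecs :: "'a set"
  scl :: "'k \<Rightarrow> 'a \<Rightarrow> 'a"
  nrm :: "'a \<Rightarrow> real"

definition normed_space :: "('k::real_or_complex, 'a::ab_group_add) nspace \<Rightarrow> bool" where
  "normed_space X \<longleftrightarrow>
     vector_space (scl X) \<and> module.subspace (scl X) (vecs X) \<and>
     (\<forall>x\<in>vecs X. 0 \<le> nrm X x \<and> (nrm X x = 0 \<longleftrightarrow> x = 0)) \<and>
     (\<forall>x\<in>vecs X. \<forall>y\<in>vecs X. nrm X (x + y) \<le> nrm X x + nrm X y) \<and>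
     (\<forall>c. \<forall>x\<in>vecs X. nrm X (scl X c x) = norm c * nrm X x)"

text \<open>\<open>Metric_space\<close> asks for nonnegativity and symmetry on the whole type, hence the value 0
  outside \<open>vecs\<close>.\<close>

definition ndist :: "('k, 'a::ab_group_add) nspace \<Rightarrow> 'a \<Rightarrow> 'a \<Rightarrow> real" where
  "ndist X x y = (if x \<in> vecs X \<and> y \<in> vecs X then nrm X (x - y) else 0)"

definition banach_space :: "('k::real_or_complex, 'a::ab_group_add) nspace \<Rightarrow> bool" where
  "banach_space X \<longleftrightarrow> normed_space X \<and> Metric_space.mcomplete (vecs X) (ndist X)"

definition scalars :: "('k::real_or_complex, 'k) nspace" where
  "scalars = \<lparr>vecs = UNIV, scl = (*), nrm = norm\<rparr>"

text \<open>Operators on \<open>X\<close> are represented by functions that vanish outside \<open>vecs X\<close>, so that two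
  operators are equal as soon as they agree on \<open>vecs X\<close>, and the pointwise operations on
  functions are the operations of the space of operators.\<close>

definition bounded_op ::
    "('k, 'a::ab_group_add) nspace \<Rightarrow> ('k, 'b::ab_group_add) nspace \<Rightarrow> ('a \<Rightarrow> 'b) \<Rightarrow> bool" where
  "bounded_op X Y T \<longleftrightarrow>
     (\<forall>x\<in>vecs X. T x \<in> vecs Y) \<and> (\<forall>x. x \<notin> vecs X \<longrightarrow> T x = 0) \<and>
     (\<forall>x\<in>vecs X. \<forall>y\<in>vecs X. T (x + y) = T x + T y) \<and>
     (\<forall>c. \<forall>x\<in>vecs X. T (scl X c x) = scl Y c (T x)) \<and>
     (\<exists>C. \<forall>x\<in>vecs X. nrm Y (T x) \<le> C * nrm X x)"

definition bounded_ops ::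
    "('k, 'a::ab_group_add) nspace \<Rightarrow> ('k, 'b::ab_group_add) nspace \<Rightarrow> ('k, 'a \<Rightarrow> 'b) nspace" where
  "bounded_ops X Y =
     \<lparr>vecs = {T. bounded_op X Y T},
      scl = (\<lambda>c T x. scl Y c (T x)),
      nrm = (\<lambda>T. SUP x\<in>{x \<in> vecs X. nrm X x \<le> 1}. nrm Y (T x))\<rparr>"

definition dual :: "('k::real_or_complex, 'a::ab_group_add) nspace \<Rightarrow> ('k, 'a \<Rightarrow> 'k) nspace" where
  "dual X = bounded_ops X scalars"

definition numerical_radius ::
    "('k::real_or_complex, 'a::ab_group_add) nspace \<Rightarrow> ('a \<Rightarrow> 'a) \<Rightarrow> real" where
  "numerical_radius X T =
     Sup {norm (f (T x)) | f x. x \<in> vecs X \<and> nrm X x = 1 \<and>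
            f \<in> vecs (dual X) \<and> nrm (dual X) f = 1 \<and> f x = 1}"

definition numerical_index :: "('k::real_or_complex, 'a::ab_group_add) nspace \<Rightarrow> real" where
  "numerical_index X =
     Inf {numerical_radius X T | T. T \<in> vecs (bounded_ops X X) \<and> nrm (bounded_ops X X) T = 1}"

definition nuclear_rep ::
    "('k::real_or_complex, 'a::ab_group_add) nspace \<Rightarrow> ('k, 'b::ab_group_add) nspace \<Rightarrow>
     ('a \<Rightarrow> 'b) \<Rightarrow> (nat \<Rightarrow> 'a \<Rightarrow> 'k) \<Rightarrow> (nat \<Rightarrow> 'b) \<Rightarrow> bool" where
  "nuclear_rep X Y T f y \<longleftrightarrow>
     (\<forall>n. f n \<in> vecs (dual X)) \<and> (\<forall>n. y n \<in> vecs Y) \<and>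
     summable (\<lambda>n. nrm (dual X) (f n) * nrm Y (y n)) \<and>
     (\<forall>x\<in>vecs X. (\<lambda>n. nrm Y (T x - (\<Sum>i<n. scl Y (f i x) (y i)))) \<longlonglongrightarrow> 0)"

definition nuclear_ops ::
    "('k::real_or_complex, 'a::ab_group_add) nspace \<Rightarrow> ('k, 'b::ab_group_add) nspace \<Rightarrow>
     ('k, 'a \<Rightarrow> 'b) nspace" where
  "nuclear_ops X Y =
     \<lparr>vecs = {T \<in> vecs (bounded_ops X Y). \<exists>f y. nuclear_rep X Y T f y},
      scl = (\<lambda>c T x. scl Y c (T x)),
      nrm = (\<lambda>T. Inf {(\<Sum>n. nrm (dual X) (f n) * nrm Y (y n)) | f y. nuclear_rep X Y T f y})\<rparr>"

definition finite_rank ::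
    "('k::real_or_complex, 'a) nspace \<Rightarrow> ('k, 'b::ab_group_add) nspace \<Rightarrow> ('a \<Rightarrow> 'b) \<Rightarrow> bool" where
  "finite_rank X Y T \<longleftrightarrow>
     (\<exists>B. finite B \<and> B \<subseteq> vecs Y \<and> T ` vecs X \<subseteq> module.span (scl Y) B)"

definition approximation_property :: "('k::real_or_complex, 'a::ab_group_add) nspace \<Rightarrow> bool" where
  "approximation_property X \<longleftrightarrow>
     (\<forall>K e. compactin (Metric_space.mtopology (vecs X) (ndist X)) K \<and> 0 < e \<longrightarrow>
        (\<exists>T \<in> vecs (bounded_ops X X). finite_rank X X T \<and> (\<forall>x\<in>K. nrm X (T x - x) < e)))"

end

theory Submission
  imports Defs
begin

text \<open>
  Two facts are combined: numerical radii can be read off from norms, and operators on the factors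
  act isometrically on the tensor product.

  Lumer's formula expresses \<open>v(S)\<close> by the growth of \<open>\<parallel>I + c S\<parallel>\<close> for small scalars \<open>c\<close>. So a
  map \<open>J: L(W) \<rightarrow> L(Z)\<close> with \<open>\<parallel>J S\<parallel> = \<parallel>S\<parallel>\<close> and \<open>J (I + c S) = I + c J S\<close> satisfies
  \<open>v(J S) \<le> v(S)\<close>, and the operators \<open>J S\<close> witness \<open>n(Z) \<le> n(W)\<close>
  (\<open>numerical_index_transfer\<close>). Each of the four inequalities is an instance, and in each case a
  lower bound for \<open>\<parallel>J S\<parallel>\<close> comes from elementary tensors.

  For \<open>n(N(X,Y))\<close> an operator \<open>S\<close> on \<open>Y\<close> acts on \<open>T = \<Sum> x\<^sub>n\<^sup>* \<otimes> y\<^sub>n\<close> by \<open>T \<mapsto> S T\<close>, and an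
  operator \<open>S\<close> on \<open>X\<^sup>*\<close> by \<open>T \<mapsto> \<Sum> S x\<^sub>n\<^sup>* \<otimes> y\<^sub>n\<close>, the operator with adjoint \<open>S T\<^sup>*\<close>. For the
  dual of \<open>N(X,Y)\<close> the functionals are identified with the bounded bilinear forms on the pair
  \<open>X\<^sup>*\<close>, \<open>Y\<close>, that is, with the operators from \<open>X\<^sup>*\<close> to \<open>Y\<^sup>*\<close> or from \<open>Y\<close> to \<open>X\<^sup>*\<^sup>*\<close>, on
  which \<open>L(Y\<^sup>*)\<close> and \<open>L(X\<^sup>*\<^sup>*)\<close> act by composition.

  For this identification \<open>\<Sum> B(x\<^sub>n\<^sup>*, y\<^sub>n)\<close> has to depend on \<open>T\<close> alone, and here the approximation
  property enters (\<open>approximation_property_separates\<close>): a finite rank operator close to the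
  identity on a compact set that contains all \<open>y\<^sub>n\<close> (or all \<open>x\<^sub>n\<^sup>*\<close>), after rescaling, replaces
  \<open>B\<close> by finitely many products \<open>G(x\<^sub>n\<^sup>*) g(y\<^sub>n)\<close>, whose sum is \<open>G(T\<^sup>* g)\<close>
  (\<open>elementary_functional\<close>). Coordinates on the finite-dimensional range and support functionals
  are provided by the Hahn-Banach theorem (\<open>ex_support_functional\<close>).
\<close>

section \<open>The scalar field\<close>

text \<open>Absolutely convergent scalar series have to converge. In both models of the class,
  convergence is convergence of the real coordinates.\<close>

instance real_or_complex \<subseteq> banach
proof
  fix s :: "nat \<Rightarrow> 'a" assume s: "Cauchy s"
  consider (real) "\<forall>z::'a. \<exists>a. z = a *\<^sub>R 1"
    | (complex) i :: 'a where "\<forall>z. \<exists>a b. z = a *\<^sub>R 1 + b *\<^sub>R i"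
        "\<forall>a b. norm (a *\<^sub>R 1 + b *\<^sub>R i) = sqrt (a\<^sup>2 + b\<^sup>2)"
    using real_or_complex[where 'a = 'a] by blast
  then show "convergent s"
  proof cases
    case real
    then have "\<forall>n. \<exists>a. s n = a *\<^sub>R 1" by blast
    then obtain a where a: "\<And>n. s n = a n *\<^sub>R 1" by metis
    have "norm (s m - s n) = \<bar>a m - a n\<bar>" for m n
      by (simp add: a flip: scaleR_left_diff_distrib)
    then have "Cauchy a" using s by (simp add: Cauchy_iff)
    then obtain l where "a \<longlonglongrightarrow> l" using Cauchy_convergent convergent_def by blast
    then have "s \<longlonglongrightarrow> l *\<^sub>R 1" by (auto simp: a[abs_def] intro: tendsto_intros)
    then show ?thesis by (auto simp: convergent_def)
  next
    case complex
    then have "\<forall>n. \<exists>a b. s n = a *\<^sub>R 1 + b *\<^sub>R i" by blast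
    then obtain a b where ab: "\<And>n. s n = a n *\<^sub>R 1 + b n *\<^sub>R i" by metis
    have "s m - s n = (a m - a n) *\<^sub>R 1 + (b m - b n) *\<^sub>R i" for m n
      by (simp add: ab algebra_simps)
    then have n: "norm (s m - s n) = sqrt ((a m - a n)\<^sup>2 + (b m - b n)\<^sup>2)" for m n
      using complex(2) by metis
    have "\<bar>a m - a n\<bar> \<le> norm (s m - s n)" "\<bar>b m - b n\<bar> \<le> norm (s m - s n)" for m n
      by (auto simp: n intro!: real_le_rsqrt)
    then have "Cauchy a" "Cauchy b" using s unfolding Cauchy_iff real_norm_def
      by (meson le_less_trans)+
    then obtain l l' where "a \<longlonglongrightarrow> l" "b \<longlonglongrightarrow> l'" using Cauchy_convergent convergent_def by metis
    then have "s \<longlonglongrightarrow> l *\<^sub>R 1 + l' *\<^sub>R i" by (auto simp: ab[abs_def] intro!: tendsto_intros)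
    then show ?thesis by (auto simp: convergent_def)
  qed
qed

text \<open>Rotating a scalar onto the nonnegative half-line replaces an argument by real parts.\<close>

lemma ex_unit_rotation:
  fixes w :: "'k::real_normed_field"
  obtains \<theta> where "norm \<theta> = 1" "\<theta> * w = of_real (norm w)"
proof (cases "w = 0")
  case True then show ?thesis using that[of 1] by simp
next
  case False then show ?thesis using that[of "of_real (norm w) / w"] by (simp add: norm_divide)
qed


section \<open>Normed spaces and bounded operators\<close>

context
  fixes X :: "('k::real_or_complex, 'a::ab_group_add) nspace"
  assumes X: "normed_space X"
begin

interpretation vector_space "scl X" using X by (simp add: normed_space_def)

lemma zero_mem: "0 \<in> vecs X"
  and add_mem: "\<lbrakk>x \<in> vecs X; y \<in> vecs X\<rbrakk> \<Longrightarrow> x + y \<in> vecs X"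
  and diff_mem: "\<lbrakk>x \<in> vecs X; y \<in> vecs X\<rbrakk> \<Longrightarrow> x - y \<in> vecs X"
  and minus_mem: "x \<in> vecs X \<Longrightarrow> - x \<in> vecs X"
  and scl_mem: "x \<in> vecs X \<Longrightarrow> scl X c x \<in> vecs X"
  and sum_mem: "(\<And>i. i \<in> I \<Longrightarrow> g i \<in> vecs X) \<Longrightarrow> sum g I \<in> vecs X"
  using X by (auto simp: normed_space_def subspace_0 subspace_add subspace_diff subspace_neg
      subspace_scale subspace_sum)

lemma scl_simps: "scl X c (x + y) = scl X c x + scl X c y" "scl X (b + c) x = scl X b x + scl X c x"
    "scl X b (scl X c x) = scl X (b * c) x" "scl X 1 x = x" "scl X 0 x = 0" "scl X c 0 = 0"
    "scl X (- c) x = - scl X c x" "scl X c (- x) = - scl X c x"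
    "scl X c (x - y) = scl X c x - scl X c y" "scl X (b - c) x = scl X b x - scl X c x"
  by (simp_all add: scale_right_distrib scale_left_distrib scale_right_diff_distrib
      scale_left_diff_distrib)

lemma scl_sum: "scl X c (sum g I) = (\<Sum>i\<in>I. scl X c (g i))"
  by (rule scale_sum_right)

lemma nrm_nonneg: "x \<in> vecs X \<Longrightarrow> 0 \<le> nrm X x"
  and nrm_eq_0: "x \<in> vecs X \<Longrightarrow> nrm X x = 0 \<longleftrightarrow> x = 0"
  and nrm_triangle: "\<lbrakk>x \<in> vecs X; y \<in> vecs X\<rbrakk> \<Longrightarrow> nrm X (x + y) \<le> nrm X x + nrm X y"
  and nrm_scl: "x \<in> vecs X \<Longrightarrow> nrm X (scl X c x) = norm c * nrm X x"
  using X by (auto simp: normed_space_def)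

lemma nrm_0: "nrm X 0 = 0"
  using nrm_eq_0 zero_mem by blast

lemma nrm_minus: "x \<in> vecs X \<Longrightarrow> nrm X (- x) = nrm X x"
  using nrm_scl[of x "- 1"] by simp

lemma nrm_minus_commute: "\<lbrakk>x \<in> vecs X; y \<in> vecs X\<rbrakk> \<Longrightarrow> nrm X (x - y) = nrm X (y - x)"
  using nrm_minus[of "x - y"] diff_mem by simp

lemma nrm_triangle_diff: "\<lbrakk>x \<in> vecs X; y \<in> vecs X\<rbrakk> \<Longrightarrow> nrm X (x - y) \<le> nrm X x + nrm X y"
  using nrm_triangle[of x "- y"] minus_mem nrm_minus by simp

lemma nrm_sum_le: "(\<And>i. i \<in> I \<Longrightarrow> g i \<in> vecs X) \<Longrightarrow> nrm X (sum g I) \<le> (\<Sum>i\<in>I. nrm X (g i))"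
proof (induction I rule: infinite_finite_induct)
  case (insert i I)
  then show ?case using nrm_triangle[of "g i" "sum g I"] sum_mem[of I g] by fastforce
qed (simp_all add: nrm_0)

lemma ex_unit_vector:
  assumes "vecs X \<noteq> {0}"
  obtains x where "x \<in> vecs X" "nrm X x = 1"
proof -
  obtain x where x: "x \<in> vecs X" "x \<noteq> 0" using assms zero_mem by blast
  then have "nrm X x > 0" using nrm_nonneg nrm_eq_0 by (metis less_le)
  then show ?thesis using x that[of "scl X (of_real (inverse (nrm X x))) x"]
    by (simp add: scl_mem nrm_scl norm_inverse)
qed

lemma Metric_space_ndist: "Metric_space (vecs X) (ndist X)"
proof
  show "ndist X x z \<le> ndist X x y + ndist X y z"
    if "x \<in> vecs X" "y \<in> vecs X" "z \<in> vecs X" for x y z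
    using that nrm_triangle[of "x - y" "y - z"] diff_mem by (simp add: ndist_def)
qed (auto simp: ndist_def diff_mem nrm_nonneg nrm_eq_0 intro: nrm_minus_commute)

end

lemma banach_imp_normed: "banach_space X \<Longrightarrow> normed_space X"
  by (simp add: banach_space_def)

lemmas mem_rules = zero_mem add_mem diff_mem minus_mem scl_mem sum_mem

lemma scalars_simps [simp]: "vecs scalars = UNIV" "scl scalars = (*)" "nrm scalars = norm"
  by (simp_all add: scalars_def)

lemma normed_scalars: "normed_space (scalars :: ('k::real_or_complex, 'k) nspace)"
proof -
  have v: "vector_space ((*) :: 'k \<Rightarrow> 'k \<Rightarrow> 'k)"
    by standard (simp_all add: algebra_simps)
  interpret vector_space "(*) :: 'k \<Rightarrow> 'k \<Rightarrow> 'k" by (rule v)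
  show ?thesis
    using v by (simp add: normed_space_def subspace_UNIV norm_triangle_ineq norm_mult)
qed

lemma bounded_ops_simps [simp]:
  "T \<in> vecs (bounded_ops X Y) \<longleftrightarrow> bounded_op X Y T"
  "scl (bounded_ops X Y) = (\<lambda>c T x. scl Y c (T x))"
  by (simp_all add: bounded_ops_def)

lemma bounded_opD:
  assumes "bounded_op X Y T"
  shows "x \<in> vecs X \<Longrightarrow> T x \<in> vecs Y" "x \<notin> vecs X \<Longrightarrow> T x = 0"
    "\<lbrakk>x \<in> vecs X; y \<in> vecs X\<rbrakk> \<Longrightarrow> T (x + y) = T x + T y"
    "x \<in> vecs X \<Longrightarrow> T (scl X c x) = scl Y c (T x)"
  using assms by (simp_all add: bounded_op_def)

lemma bounded_opI:
  assumes "\<And>x. x \<in> vecs X \<Longrightarrow> T x \<in> vecs Y" "\<And>x. x \<notin> vecs X \<Longrightarrow> T x = 0"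
    and "\<And>x y. \<lbrakk>x \<in> vecs X; y \<in> vecs X\<rbrakk> \<Longrightarrow> T (x + y) = T x + T y"
    and "\<And>c x. x \<in> vecs X \<Longrightarrow> T (scl X c x) = scl Y c (T x)"
    and "\<And>x. x \<in> vecs X \<Longrightarrow> nrm Y (T x) \<le> C * nrm X x"
  shows "bounded_op X Y T"
  using assms unfolding bounded_op_def by blast

context
  fixes X :: "('k::real_or_complex, 'a::ab_group_add) nspace"
    and Y :: "('k, 'b::ab_group_add) nspace"
  assumes X: "normed_space X" and Y: "normed_space Y"
begin

lemma op_range: "bounded_op X Y T \<Longrightarrow> T x \<in> vecs Y"
  using zero_mem[OF Y] by (cases "x \<in> vecs X") (auto simp: bounded_op_def)

lemma op_0: "bounded_op X Y T \<Longrightarrow> T 0 = 0"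
  using bounded_opD(4)[of X Y T 0 0] zero_mem[OF X] by (simp add: scl_simps X Y)

lemma op_minus: "\<lbrakk>bounded_op X Y T; x \<in> vecs X\<rbrakk> \<Longrightarrow> T (- x) = - T x"
  using bounded_opD(4)[of X Y T x "- 1"] by (simp add: scl_simps X Y)

lemma op_diff: "\<lbrakk>bounded_op X Y T; x \<in> vecs X; y \<in> vecs X\<rbrakk> \<Longrightarrow> T (x - y) = T x - T y"
  using bounded_opD(3)[of X Y T x "- y"] op_minus[of T y] minus_mem[OF X] by simp

lemma op_sum:
  assumes T: "bounded_op X Y T" and "\<And>i. i \<in> I \<Longrightarrow> g i \<in> vecs X"
  shows "T (sum g I) = (\<Sum>i\<in>I. T (g i))"
  using assms(2)
proof (induction I rule: infinite_finite_induct)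
  case (insert i I)
  then show ?case using bounded_opD(3)[OF T, of "g i" "sum g I"] sum_mem[OF X, of I g] by simp
qed (simp_all add: op_0[OF T])

lemma bdd_above_unit_ball:
  assumes T: "bounded_op X Y T"
  shows "bdd_above ((\<lambda>x. nrm Y (T x)) ` {x \<in> vecs X. nrm X x \<le> 1})"
proof -
  obtain C where C: "\<And>x. x \<in> vecs X \<Longrightarrow> nrm Y (T x) \<le> C * nrm X x"
    using T unfolding bounded_op_def by blast
  have "nrm Y (T x) \<le> \<bar>C\<bar>" if "x \<in> vecs X" "nrm X x \<le> 1" for x
  proof -
    have "nrm Y (T x) \<le> \<bar>C\<bar> * nrm X x"
      using C[OF that(1)] mult_right_mono[OF abs_ge_self[of C] nrm_nonneg[OF X that(1)]] by linarith
    also have "\<dots> \<le> \<bar>C\<bar>" using that(2) by (simp add: mult_left_le)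
    finally show ?thesis .
  qed
  then show ?thesis by (intro bdd_aboveI2) auto
qed

lemma op_bound:
  assumes T: "bounded_op X Y T" and x: "x \<in> vecs X"
  shows "nrm Y (T x) \<le> nrm (bounded_ops X Y) T * nrm X x"
proof (cases "x = 0")
  case True
  then show ?thesis by (simp add: op_0[OF T] nrm_0 X Y)
next
  case False
  then have pos: "nrm X x > 0" using x nrm_nonneg[OF X] nrm_eq_0[OF X] by (metis less_le)
  define u where "u = scl X (of_real (inverse (nrm X x))) x"
  have u: "u \<in> vecs X" "nrm X u \<le> 1" using x pos by (auto simp: u_def scl_mem nrm_scl X norm_inverse)
  have "inverse (nrm X x) * nrm Y (T x) = nrm Y (T u)"
    using x pos bounded_opD[OF T] by (simp add: u_def nrm_scl X Y norm_inverse)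
  also have "\<dots> \<le> nrm (bounded_ops X Y) T"
    using cSUP_upper[OF _ bdd_above_unit_ball[OF T], of u] u by (simp add: bounded_ops_def)
  finally show ?thesis using pos by (simp add: field_simps)
qed

lemma opnorm_le:
  assumes T: "\<And>x. x \<in> vecs X \<Longrightarrow> nrm Y (T x) \<le> C * nrm X x" and C: "0 \<le> C"
  shows "nrm (bounded_ops X Y) T \<le> C"
proof -
  have "nrm Y (T x) \<le> C" if "x \<in> vecs X" "nrm X x \<le> 1" for x
    using T[OF that(1)] mult_left_mono[OF that(2) C] by simp
  moreover have "0 \<in> {x \<in> vecs X. nrm X x \<le> 1}" using zero_mem[OF X] nrm_0[OF X] by simp
  ultimately show ?thesis unfolding bounded_ops_def nspace.simps by (intro cSUP_least) auto
qed

lemma opnorm_nonneg: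
  assumes T: "bounded_op X Y T"
  shows "0 \<le> nrm (bounded_ops X Y) T"
proof -
  have "nrm Y (T 0) \<le> nrm (bounded_ops X Y) T"
    using cSUP_upper[OF _ bdd_above_unit_ball[OF T], of 0]
    by (simp add: bounded_ops_def zero_mem nrm_0 X)
  then show ?thesis by (simp add: op_0[OF T] nrm_0 Y)
qed

lemma op_bound_unit: "\<lbrakk>bounded_op X Y T; x \<in> vecs X; nrm X x \<le> 1\<rbrakk>
    \<Longrightarrow> nrm Y (T x) \<le> nrm (bounded_ops X Y) T"
  using op_bound[of T x] mult_left_mono[of "nrm X x" 1 "nrm (bounded_ops X Y) T"] opnorm_nonneg[of T]
  by linarith

lemma normed_bounded_ops: "normed_space (bounded_ops X Y)"
proof -
  let ?L = "bounded_ops X Y"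
  have v: "vector_space (scl ?L)"
    by standard (auto simp: fun_eq_iff scl_simps Y)
  have add: "bounded_op X Y (S + T) \<and> nrm ?L (S + T) \<le> nrm ?L S + nrm ?L T"
    if S: "bounded_op X Y S" and T: "bounded_op X Y T" for S T
  proof -
    have b: "nrm Y ((S + T) x) \<le> (nrm ?L S + nrm ?L T) * nrm X x" if "x \<in> vecs X" for x
      using op_bound[OF S that] op_bound[OF T that] nrm_triangle[OF Y, of "S x" "T x"]
        op_range[OF S, of x] op_range[OF T, of x] by (simp add: distrib_right)
    have "bounded_op X Y (S + T)"
      by (rule bounded_opI[where C = "nrm ?L S + nrm ?L T"])
        (use S T b in \<open>simp_all add: op_range bounded_opD mem_rules X Y scl_simps algebra_simps\<close>)
    then show ?thesis using opnorm_le[OF b] opnorm_nonneg S T by fastforce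
  qed
  have le: "bounded_op X Y (scl ?L c T) \<and> nrm ?L (scl ?L c T) \<le> norm c * nrm ?L T"
    if T: "bounded_op X Y T" for T c
  proof -
    have b: "nrm Y (scl ?L c T x) \<le> (norm c * nrm ?L T) * nrm X x" if "x \<in> vecs X" for x
      using mult_left_mono[OF op_bound[OF T that], of "norm c"] op_range[OF T, of x]
      by (simp add: nrm_scl Y mult.assoc)
    have "bounded_op X Y (scl ?L c T)"
      by (rule bounded_opI[where C = "norm c * nrm ?L T"])
        (use T b in \<open>simp_all add: op_range bounded_opD mem_rules X Y scl_simps mult.commute\<close>)
    then show ?thesis using opnorm_le[OF b] opnorm_nonneg T by fastforce
  qed
  have scl: "nrm ?L (scl ?L c T) = norm c * nrm ?L T" if T: "bounded_op X Y T" for c T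
  proof (cases "c = 0")
    case True
    then show ?thesis using le[OF T, of 0] opnorm_nonneg[of "scl ?L 0 T"] by simp
  next
    case False
    have "nrm ?L T = nrm ?L (scl ?L (inverse c) (scl ?L c T))"
      using False by (simp add: scl_simps Y)
    also have "\<dots> \<le> inverse (norm c) * nrm ?L (scl ?L c T)"
      using le[of "scl ?L c T" "inverse c"] le[OF T, of c] by (simp add: norm_inverse)
    finally show ?thesis using le[OF T, of c] False by (simp add: field_simps)
  qed
  have zero: "bounded_op X Y 0"
    by (rule bounded_opI[where C = 0]) (simp_all add: zero_mem nrm_0 scl_simps Y)
  have eq0: "nrm ?L T = 0 \<longleftrightarrow> T = 0" if T: "bounded_op X Y T" for T
  proof
    assume 0: "nrm ?L T = 0"
    have "T x = 0" for x
    proof (cases "x \<in> vecs X")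
      case True
      then show ?thesis using op_bound[OF T True] 0 nrm_nonneg[OF Y op_range[OF T, of x]]
          nrm_eq_0[OF Y op_range[OF T, of x]] by simp
    qed (use T bounded_opD in blast)
    then show "T = 0" by (simp add: fun_eq_iff)
  next
    assume "T = 0"
    moreover have "nrm ?L 0 \<le> 0" by (rule opnorm_le) (simp_all add: nrm_0 Y)
    ultimately show "nrm ?L T = 0" using opnorm_nonneg[OF zero] by simp
  qed
  interpret vector_space "scl ?L" by (rule v)
  have sub: "subspace (vecs ?L)"
    unfolding subspace_def using add le zero by auto
  show ?thesis unfolding normed_space_def
    using v sub opnorm_nonneg add le eq0 scl by simp
qed

end

lemma bounded_op_comp:
  fixes X :: "('k::real_or_complex, 'a::ab_group_add) nspace"
    and Y :: "('k, 'b::ab_group_add) nspace"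
  assumes X: "normed_space X" and Y: "normed_space Y" and Z: "normed_space Z"
    and T: "bounded_op X Y T" and S: "bounded_op Y Z S"
  shows "bounded_op X Z (\<lambda>x. S (T x))"
    "nrm (bounded_ops X Z) (\<lambda>x. S (T x)) \<le> nrm (bounded_ops Y Z) S * nrm (bounded_ops X Y) T"
proof -
  let ?C = "nrm (bounded_ops Y Z) S * nrm (bounded_ops X Y) T"
  have b: "nrm Z (S (T x)) \<le> ?C * nrm X x" if "x \<in> vecs X" for x
    using op_bound[OF Y Z S op_range[OF X Y T, of x]]
      mult_left_mono[OF op_bound[OF X Y T that] opnorm_nonneg[OF Y Z S]]
    by (simp add: mult.assoc)
  show "bounded_op X Z (\<lambda>x. S (T x))"
    by (rule bounded_opI[where C = ?C])
      (use b T S in \<open>simp_all add: op_range[OF X Y] op_range[OF Y Z] bounded_opD op_0[OF Y Z]\<close>)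
  show "nrm (bounded_ops X Z) (\<lambda>x. S (T x)) \<le> ?C"
    using opnorm_nonneg[OF X Y T] opnorm_nonneg[OF Y Z S] by (intro opnorm_le[OF X Z b]) auto
qed

lemma normed_dual: "normed_space X \<Longrightarrow> normed_space (dual X)"
  by (simp add: dual_def normed_bounded_ops normed_scalars)

lemma dual_simps [simp]:
  "f \<in> vecs (dual X) \<longleftrightarrow> bounded_op X scalars f" "scl (dual X) = (\<lambda>c f x. c * f x)"
  by (simp_all add: dual_def)

lemma functional_bound:
  "\<lbrakk>normed_space X; bounded_op X scalars f; x \<in> vecs X\<rbrakk> \<Longrightarrow> norm (f x) \<le> nrm (dual X) f * nrm X x"
  using op_bound[OF _ normed_scalars] by (simp add: dual_def)

lemma functional_norm_le:
  "\<lbrakk>normed_space X; \<And>x. x \<in> vecs X \<Longrightarrow> norm (f x) \<le> C * nrm X x; 0 \<le> C\<rbrakk> \<Longrightarrow> nrm (dual X) f \<le> C"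
  using opnorm_le[OF _ normed_scalars, of X f C] by (simp add: dual_def)


section \<open>Support functionals\<close>

context
  fixes X :: "('k::real_or_complex, 'a::ab_group_add) nspace"
  assumes X: "normed_space X"
begin

definition sublinear :: "('a \<Rightarrow> real) \<Rightarrow> bool" where
  "sublinear p \<longleftrightarrow> (\<forall>x\<in>vecs X. \<forall>y\<in>vecs X. p (x + y) \<le> p x + p y) \<and>
     (\<forall>x\<in>vecs X. \<forall>t>0. p (scl X (of_real t) x) \<le> t * p x)"

lemma sublinear_add: "\<lbrakk>sublinear p; x \<in> vecs X; y \<in> vecs X\<rbrakk> \<Longrightarrow> p (x + y) \<le> p x + p y"
  by (simp add: sublinear_def)

lemma sublinear_scl:
  assumes p: "sublinear p" and x: "x \<in> vecs X" and t: "0 < t"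
  shows "p (scl X (of_real t) x) = t * p x"
proof -
  have "p x = p (scl X (of_real (inverse t)) (scl X (of_real t) x))"
    using t by (simp add: scl_simps[OF X])
  also have "\<dots> \<le> inverse t * p (scl X (of_real t) x)"
    using p t scl_mem[OF X x] unfolding sublinear_def by (meson positive_imp_inverse_positive)
  finally have "t * p x \<le> p (scl X (of_real t) x)" using t by (simp add: field_simps)
  then show ?thesis using p x t unfolding sublinear_def by (meson order_antisym)
qed

lemma sublinear_0:
  assumes "sublinear p"
  shows "p 0 = 0"
  using sublinear_scl[OF assms zero_mem[OF X], of 2] by (simp add: scl_simps[OF X])

lemma sublinear_minus:
  assumes "sublinear p" "x \<in> vecs X"
  shows "- p (- x) \<le> p x"
proof -
  have "p (x + - x) \<le> p x + p (- x)"
    using assms by (intro sublinear_add minus_mem[OF X])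
  then show ?thesis using sublinear_0[OF assms(1)] by simp
qed

text \<open>Unless \<open>p\<close> is already odd at \<open>y\<close>, the sublinear functional below lies strictly under it:
  it flattens \<open>p\<close> in the direction of \<open>y\<close>.\<close>

lemma sublinear_shrink:
  assumes p: "sublinear p" and y: "y \<in> vecs X"
  obtains p' where "sublinear p'" "\<And>x. x \<in> vecs X \<Longrightarrow> p' x \<le> p x" "p' (- y) \<le> - p y"
proof -
  define g where "g x t = p (x + scl X (of_real t) y) - t * p y" for x t
  define p' where "p' x = (INF t\<in>{0..}. g x t)" for x
  note mem = mem_rules[OF X]
  have bdd: "bdd_below (g x ` {0..})" if x: "x \<in> vecs X" for x
  proof (rule bdd_belowI2)
    fix t :: real assume t: "t \<in> {0..}"
    have "t * p y = p (scl X (of_real t) y)"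
      using sublinear_scl[OF p y, of t] t sublinear_0[OF p] by (cases "t = 0") (simp_all add: scl_simps[OF X])
    also have "\<dots> = p ((x + scl X (of_real t) y) + - x)" by simp
    also have "\<dots> \<le> p (x + scl X (of_real t) y) + p (- x)"
      using x y by (intro sublinear_add[OF p] mem)
    finally show "- p (- x) \<le> g x t" by (simp add: g_def)
  qed
  have le: "p' x \<le> g x t" if "x \<in> vecs X" "0 \<le> t" for x t
    unfolding p'_def using that by (intro cINF_lower bdd) auto
  have "sublinear p'"
    unfolding sublinear_def
  proof (intro conjI ballI allI impI)
    fix x z assume x: "x \<in> vecs X" and z: "z \<in> vecs X"
    have "p' (x + z) \<le> g x t + g z s" if "0 \<le> t" "0 \<le> s" for t s
    proof -
      have "p' (x + z) \<le> g (x + z) (t + s)" using le x z that mem by simp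
      also have "\<dots> = p ((x + scl X (of_real t) y) + (z + scl X (of_real s) y)) - (t + s) * p y"
        by (simp add: g_def scl_simps[OF X] algebra_simps)
      also have "\<dots> \<le> (p (x + scl X (of_real t) y) + p (z + scl X (of_real s) y)) - (t + s) * p y"
        using x z y by (intro diff_right_mono sublinear_add[OF p] mem)
      also have "\<dots> = g x t + g z s" by (simp add: g_def algebra_simps)
      finally show ?thesis .
    qed
    then have "p' (x + z) - g x t \<le> p' z" if "0 \<le> t" for t
      unfolding p'_def[of z] using that by (intro cINF_greatest) (auto simp: algebra_simps)
    then have "p' (x + z) - p' z \<le> p' x"
      unfolding p'_def[of x] by (intro cINF_greatest) (auto simp: algebra_simps)
    then show "p' (x + z) \<le> p' x + p' z" by simp
  next
    fix x and c :: real assume x: "x \<in> vecs X" and c: "0 < c"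
    have "inverse c * p' (scl X (of_real c) x) \<le> g x t" if "0 \<le> t" for t
    proof -
      have "p' (scl X (of_real c) x) \<le> g (scl X (of_real c) x) (c * t)"
        using le x that c mem by simp
      also have "\<dots> = p (scl X (of_real c) (x + scl X (of_real t) y)) - c * t * p y"
        by (simp add: g_def scl_simps[OF X])
      also have "\<dots> = c * g x t"
        using sublinear_scl[OF p _ c, of "x + scl X (of_real t) y"] x y mem
        by (simp add: g_def algebra_simps)
      finally show ?thesis using c by (simp add: field_simps)
    qed
    then have "inverse c * p' (scl X (of_real c) x) \<le> p' x"
      unfolding p'_def[of x] by (intro cINF_greatest) auto
    then show "p' (scl X (of_real c) x) \<le> c * p' x" using c by (simp add: field_simps)
  qed
  moreover have "p' x \<le> p x" if "x \<in> vecs X" for x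
    using le[OF that, of 0] by (simp add: g_def scl_simps[OF X])
  moreover have "p' (- y) \<le> - p y"
    using le[of "- y" 1] y mem sublinear_0[OF p] by (simp add: g_def scl_simps[OF X])
  ultimately show ?thesis using that by blast
qed

text \<open>The Hahn-Banach theorem, in the form that below every sublinear functional there is a linear
  one: a minimal sublinear functional exists by Zorn's lemma, and it is odd because it cannot be
  shrunk; odd sublinear functionals are linear.\<close>

lemma ex_linear_below_sublinear:
  assumes q: "sublinear q"
  obtains u where "\<And>x y. \<lbrakk>x \<in> vecs X; y \<in> vecs X\<rbrakk> \<Longrightarrow> u (x + y) = u x + u y"
    "\<And>x t. x \<in> vecs X \<Longrightarrow> u (scl X (of_real t) x) = t * u x"
    "\<And>x. x \<in> vecs X \<Longrightarrow> u x \<le> q x"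
proof -
  note mem = mem_rules[OF X]
  \<comment> \<open>The value 0 outside the space makes the pointwise order antisymmetric.\<close>
  define A where "A = {p. sublinear p \<and> (\<forall>x\<in>vecs X. p x \<le> q x) \<and> (\<forall>x. x \<notin> vecs X \<longrightarrow> p x = 0)}"
  define P where "P p p' \<longleftrightarrow> (\<forall>x. p' x \<le> p x)" for p p' :: "'a \<Rightarrow> real"
  define cut where "cut p x = (if x \<in> vecs X then p x else 0)" for p :: "'a \<Rightarrow> real" and x
  have cut_sub: "sublinear (cut p)" if "sublinear p" for p
    using that mem by (auto simp: sublinear_def cut_def)
  have "partial_order_on A (relation_of P A)"
    by (rule partial_order_on_relation_ofI) (auto simp: P_def fun_eq_iff intro: order_trans order_antisym)
  moreover have "\<exists>u\<in>A. \<forall>p\<in>C. P p u" if C: "C \<in> Chains (relation_of P A)" for C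
  proof (cases "C = {}")
    case True
    have "cut q \<in> A" using q cut_sub by (auto simp: A_def cut_def)
    with True show ?thesis by auto
  next
    case False
    have CA: "p \<in> A" if "p \<in> C" for p
      using C that by (auto simp: Chains_def relation_of_def)
    have CP: "P p p' \<or> P p' p" if "p \<in> C" "p' \<in> C" for p p'
      using C that by (auto simp: Chains_def relation_of_def)
    define u where "u = cut (\<lambda>x. INF p\<in>C. p x)"
    have bdd: "bdd_below ((\<lambda>p. p x) ` C)" if x: "x \<in> vecs X" for x
    proof (rule bdd_belowI2)
      fix p assume "p \<in> C"
      then have "sublinear p" "p (- x) \<le> q (- x)" using CA x mem by (auto simp: A_def)
      then show "- q (- x) \<le> p x" using sublinear_minus x by fastforce
    qed
    have le: "u x \<le> p x" if "p \<in> C" for x p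
      using CA[OF that] cINF_lower[OF bdd that] by (auto simp: u_def cut_def A_def)
    have ge: "c \<le> u x" if "\<And>p. p \<in> C \<Longrightarrow> c \<le> p x" "x \<in> vecs X" for c x
      using that False by (auto simp: u_def cut_def intro: cINF_greatest)
    have "sublinear u"
      unfolding sublinear_def
    proof (intro conjI ballI allI impI)
      fix x y assume x: "x \<in> vecs X" and y: "y \<in> vecs X"
      have "u (x + y) - p x \<le> p' y" if "p \<in> C" "p' \<in> C" for p p'
      proof -
        have "r (x + y) \<le> r x + r y" if "r \<in> C" for r
          using CA[OF that] x y by (auto simp: A_def sublinear_def)
        \<comment> \<open>Of two members of a chain, the smaller one serves both summands.\<close>
        then show ?thesis
          using CP[OF that] le[OF that(1), of "x + y"] le[OF that(2), of "x + y"] that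
          unfolding P_def by (smt (verit))
      qed
      then have "u (x + y) - p x \<le> u y" if "p \<in> C" for p
        using that y by (intro ge)
      then have "u (x + y) - u y \<le> u x"
        using x by (intro ge) (auto simp: algebra_simps)
      then show "u (x + y) \<le> u x + u y" by simp
    next
      fix x and t :: real assume x: "x \<in> vecs X" and t: "0 < t"
      have "inverse t * u (scl X (of_real t) x) \<le> p x" if "p \<in> C" for p
      proof -
        have "p (scl X (of_real t) x) \<le> t * p x"
          using CA[OF that] x t by (auto simp: A_def sublinear_def)
        then have "u (scl X (of_real t) x) \<le> t * p x" using le[OF that] order_trans by blast
        then show ?thesis using t by (simp add: field_simps)
      qed
      then have "inverse t * u (scl X (of_real t) x) \<le> u x" using x by (intro ge)
      then show "u (scl X (of_real t) x) \<le> t * u x" using t by (simp add: field_simps)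
    qed
    moreover have "u x \<le> q x" if "x \<in> vecs X" for x
    proof -
      obtain p where "p \<in> C" using False by blast
      then show ?thesis using le[of p x] CA[of p] that by (auto simp: A_def)
    qed
    ultimately have "u \<in> A" by (auto simp: A_def u_def cut_def)
    then show ?thesis using le by (auto simp: P_def)
  qed
  ultimately obtain u where u: "u \<in> A" and min: "\<And>p. p \<in> A \<Longrightarrow> P u p \<Longrightarrow> p = u"
    using predicate_Zorn by metis
  have sub: "sublinear u" using u by (simp add: A_def)
  have odd: "u (- y) = - u y" if y: "y \<in> vecs X" for y
  proof -
    obtain p where p: "sublinear p" "\<And>x. x \<in> vecs X \<Longrightarrow> p x \<le> u x" "p (- y) \<le> - u y"
      using sublinear_shrink[OF sub y] by blast
    have "cut p \<in> A" "P u (cut p)"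
      using u p cut_sub by (auto simp: A_def P_def cut_def intro: order_trans)
    then have "cut p = u" by (rule min)
    then have "u (- y) \<le> - u y" using p(3) y mem by (auto simp: cut_def)
    then show ?thesis using sublinear_minus[OF sub y] by simp
  qed
  have le: "u (x + y) \<le> u x + u y" if "x \<in> vecs X" "y \<in> vecs X" for x y
    using sub that by (auto simp: sublinear_def)
  show ?thesis
  proof
    show "u (x + y) = u x + u y" if "x \<in> vecs X" "y \<in> vecs X" for x y
      using le[OF that] le[of "x + y" "- y"] odd[of y] that mem by simp
    show "u (scl X (of_real t) x) = t * u x" if x: "x \<in> vecs X" for x t
    proof -
      consider "t = 0" | "t > 0" | "t < 0" by linarith
      then show ?thesis
      proof cases
        case 3
        then have "u (- scl X (of_real t) x) = - t * u x"
          using sublinear_scl[OF sub x, of "- t"] by (simp add: scl_simps[OF X])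
        then show ?thesis using odd[of "scl X (of_real t) x"] x mem by simp
      qed (simp_all add: sublinear_0[OF sub] sublinear_scl[OF sub x] scl_simps[OF X])
    qed
    show "u x \<le> q x" if "x \<in> vecs X" for x
      using u that by (simp add: A_def)
  qed
qed

text \<open>Shrinking the norm in the direction of \<open>-x\<close> before Hahn-Banach is applied forces the value
  at \<open>x\<close> up to the norm of \<open>x\<close>. Over the complex field the real functional \<open>u\<close> is the real part of
  the complex functional \<open>u x - i u (i x)\<close>.\<close>

theorem ex_support_functional:
  assumes x: "x \<in> vecs X"
  obtains f where "bounded_op X scalars f" "\<And>z. z \<in> vecs X \<Longrightarrow> norm (f z) \<le> nrm X z"
    "f x = of_real (nrm X x)"
proof -
  note mem = mem_rules[OF X] and scl = scl_simps[OF X]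
  have "sublinear (nrm X)" by (simp add: sublinear_def nrm_triangle nrm_scl X)
  then obtain q where q: "sublinear q" "\<And>z. z \<in> vecs X \<Longrightarrow> q z \<le> nrm X z" "q (- x) \<le> - nrm X x"
    using sublinear_shrink x by blast
  obtain u where add: "\<And>x y. \<lbrakk>x \<in> vecs X; y \<in> vecs X\<rbrakk> \<Longrightarrow> u (x + y) = u x + u y"
    and hom: "\<And>x t. x \<in> vecs X \<Longrightarrow> u (scl X (of_real t) x) = t * u x"
    and uq: "\<And>x. x \<in> vecs X \<Longrightarrow> u x \<le> q x"
    using ex_linear_below_sublinear[OF q(1)] by metis
  have le: "u z \<le> nrm X z" if "z \<in> vecs X" for z
    using uq[OF that] q(2)[OF that] by simp
  have "u (- x) \<le> - nrm X x" using uq[of "- x"] q(3) x mem by fastforce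
  then have ux: "u x = nrm X x" using hom[OF x, of "- 1"] le[OF x] by (simp add: scl)
  consider (real) "\<forall>z::'k. \<exists>a. z = a *\<^sub>R 1"
    | (complex) i :: 'k where "i * i = - 1" "\<forall>z. \<exists>a b. z = a *\<^sub>R 1 + b *\<^sub>R i"
        "\<forall>a b. norm (a *\<^sub>R 1 + b *\<^sub>R i) = sqrt (a\<^sup>2 + b\<^sup>2)"
    using real_or_complex[where 'a = 'k] by blast
  then show ?thesis
  proof cases
    case real
    define f where "f z = (if z \<in> vecs X then of_real (u z) else 0 :: 'k)" for z
    have b: "norm (f z) \<le> nrm X z" if z: "z \<in> vecs X" for z
      using le[OF z] le[of "- z"] hom[OF z, of "- 1"] z mem nrm_minus[OF X z]
      by (simp add: f_def scl)
    have "f (scl X c z) = c * f z" if z: "z \<in> vecs X" for c z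
    proof -
      obtain a where "c = of_real a" using real by (metis of_real_def)
      then show ?thesis using z mem hom by (simp add: f_def)
    qed
    then have "bounded_op X scalars f"
      using b mem add by (intro bounded_opI[where C = 1]) (auto simp: f_def)
    moreover have "f x = of_real (nrm X x)" using ux x by (simp add: f_def)
    ultimately show ?thesis using that b by blast
  next
    case complex
    define f where "f z = (if z \<in> vecs X then of_real (u z) - i * of_real (u (scl X i z)) else 0)" for z
    have fadd: "f (y + z) = f y + f z" if "y \<in> vecs X" "z \<in> vecs X" for y z
      using that mem by (simp add: f_def add scl algebra_simps)
    have freal: "f (scl X (of_real t) z) = of_real t * f z" if z: "z \<in> vecs X" for t z
    proof -
      have "scl X i (scl X (of_real t) z) = scl X (of_real t) (scl X i z)"
        by (simp add: scl mult.commute)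
      then show ?thesis using z mem by (simp add: f_def hom algebra_simps)
    qed
    have fi: "f (scl X i z) = i * f z" if z: "z \<in> vecs X" for z
    proof -
      have "u (scl X i (scl X i z)) = - u z"
        using hom[OF z, of "- 1"] complex(1) by (simp add: scl)
      moreover have "i * (i * of_real (u (scl X i z))) = - of_real (u (scl X i z))"
        using complex(1) by (simp flip: mult.assoc)
      ultimately show ?thesis using z mem by (simp add: f_def algebra_simps)
    qed
    have fscl: "f (scl X c z) = c * f z" if z: "z \<in> vecs X" for c z
    proof -
      obtain a b where c: "c = of_real a + of_real b * i"
        using complex(2) by (metis of_real_def scaleR_conv_of_real)
      have "f (scl X c z) = f (scl X (of_real a) z) + f (scl X (of_real b) (scl X i z))"
        using z mem by (simp add: c scl flip: fadd)
      also have "\<dots> = c * f z" using z mem by (simp add: freal fi c algebra_simps)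
      finally show ?thesis .
    qed
    have nf: "norm (f z - of_real r) = sqrt ((u z - r)\<^sup>2 + (u (scl X i z))\<^sup>2)" if "z \<in> vecs X" for z r
    proof -
      have "f z - of_real r = (u z - r) *\<^sub>R 1 + (- u (scl X i z)) *\<^sub>R i"
        using that by (simp add: f_def of_real_def algebra_simps)
      then show ?thesis using complex(3) by (metis power2_minus)
    qed
    have b: "norm (f z) \<le> nrm X z" if z: "z \<in> vecs X" for z
    proof -
      \<comment> \<open>Rotate \<open>z\<close> until \<open>f\<close> takes a nonnegative real value, which is then the value of \<open>u\<close>.\<close>
      obtain \<theta> where \<theta>: "norm \<theta> = 1" "\<theta> * f z = of_real (norm (f z))" by (rule ex_unit_rotation)
      have "norm (f (scl X \<theta> z) - of_real (norm (f z))) = 0" using fscl[OF z] \<theta> by simp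
      then have "(u (scl X \<theta> z) - norm (f z))\<^sup>2 + (u (scl X i (scl X \<theta> z)))\<^sup>2 = 0"
        using nf z mem by simp
      then have "norm (f z) = u (scl X \<theta> z)" by (simp add: sum_power2_eq_zero_iff)
      also have "\<dots> \<le> nrm X z" using le[of "scl X \<theta> z"] z mem \<theta> by (simp add: nrm_scl X)
      finally show ?thesis .
    qed
    have "bounded_op X scalars f"
      using b fadd fscl by (intro bounded_opI[where C = 1]) (auto simp: f_def)
    moreover have "f x = of_real (nrm X x)"
    proof -
      have "sqrt ((nrm X x)\<^sup>2 + (u (scl X i x))\<^sup>2) \<le> nrm X x"
        using nf[OF x, of 0] b[OF x] ux by simp
      then have "(nrm X x)\<^sup>2 + (u (scl X i x))\<^sup>2 \<le> (nrm X x)\<^sup>2"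
        using real_sqrt_le_iff real_sqrt_abs abs_of_nonneg nrm_nonneg[OF X x] by metis
      then show ?thesis using ux x by (simp add: f_def)
    qed
    ultimately show ?thesis using that b by blast
  qed
qed

end

lemma ex_unit_support_functional:
  fixes X :: "('k::real_or_complex, 'a::ab_group_add) nspace"
  assumes X: "normed_space X" and x: "x \<in> vecs X" "nrm X x = 1"
  obtains f where "bounded_op X scalars f" "nrm (dual X) f = 1" "f x = 1"
proof -
  obtain f where f: "bounded_op X scalars f" "\<And>z. z \<in> vecs X \<Longrightarrow> norm (f z) \<le> nrm X z" "f x = 1"
    using ex_support_functional[OF X x(1)] x(2) by (metis of_real_1)
  have "nrm (dual X) f \<le> 1" using f(2) by (intro functional_norm_le[OF X]) auto
  moreover have "1 \<le> nrm (dual X) f" using functional_bound[OF X f(1) x(1)] f(3) x(2) by simp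
  ultimately show ?thesis using that f by simp
qed

lemma ex_separating_functional:
  fixes X :: "('k::real_or_complex, 'a::ab_group_add) nspace"
  assumes X: "normed_space X" and x: "x \<in> vecs X" "x \<noteq> 0"
  obtains f where "bounded_op X scalars f" "f x \<noteq> 0"
  using ex_support_functional[OF X x(1)] nrm_eq_0[OF X x(1)] x(2) by (metis of_real_eq_0_iff)

lemma dual_nonzero:
  fixes X :: "('k::real_or_complex, 'a::ab_group_add) nspace"
  assumes "normed_space X" "vecs X \<noteq> {0}"
  shows "vecs (dual X) \<noteq> {0}"
proof -
  obtain x where x: "x \<in> vecs X" "nrm X x = 1" using ex_unit_vector[OF assms] .
  obtain f where f: "bounded_op X scalars f" "f x = 1"
    using ex_unit_support_functional[OF assms(1) x] .
  then show ?thesis by (metis dual_simps(1) singletonD zero_fun_apply zero_neq_one)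
qed


section \<open>Numerical radius\<close>

definition ident :: "('k, 'a::zero) nspace \<Rightarrow> 'a \<Rightarrow> 'a" where
  "ident X x = (if x \<in> vecs X then x else 0)"

context
  fixes X :: "('k::real_or_complex, 'a::ab_group_add) nspace"
  assumes X: "normed_space X"
begin

lemma norm_le_numerical_radius:
  assumes T: "bounded_op X X T" and x: "x \<in> vecs X" "nrm X x = 1"
    and f: "bounded_op X scalars f" "nrm (dual X) f = 1" "f x = 1"
  shows "norm (f (T x)) \<le> numerical_radius X T"
  unfolding numerical_radius_def
proof (rule cSup_upper)
  show "bdd_above {norm (f (T x)) |f x. x \<in> vecs X \<and> nrm X x = 1 \<and> f \<in> vecs (dual X)
      \<and> nrm (dual X) f = 1 \<and> f x = 1}"
  proof (rule bdd_aboveI, clarify)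
    fix f x assume "f \<in> vecs (dual X)" "x \<in> vecs X" "nrm X x = 1" "nrm (dual X) f = 1"
    then show "norm (f (T x)) \<le> nrm (bounded_ops X X) T"
      using functional_bound[OF X, of f "T x"] op_bound[OF X X T, of x] op_range[OF X X T, of x]
      by simp
  qed
qed (use assms in auto)

lemma numerical_radius_le:
  assumes nz: "vecs X \<noteq> {0}"
    and le: "\<And>f x. \<lbrakk>x \<in> vecs X; nrm X x = 1; bounded_op X scalars f; nrm (dual X) f = 1; f x = 1\<rbrakk>
      \<Longrightarrow> norm (f (T x)) \<le> C"
  shows "numerical_radius X T \<le> C"
  unfolding numerical_radius_def
proof (rule cSup_least)
  obtain x where x: "x \<in> vecs X" "nrm X x = 1" using ex_unit_vector[OF X nz] .
  obtain f where "bounded_op X scalars f" "nrm (dual X) f = 1" "f x = 1"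
    using ex_unit_support_functional[OF X x] .
  with x show "{norm (f (T x)) |f x. x \<in> vecs X \<and> nrm X x = 1 \<and> f \<in> vecs (dual X)
      \<and> nrm (dual X) f = 1 \<and> f x = 1} \<noteq> {}" by auto
qed (use le in auto)

lemma numerical_radius_nonneg:
  assumes "vecs X \<noteq> {0}" "bounded_op X X T"
  shows "0 \<le> numerical_radius X T"
proof -
  obtain x where x: "x \<in> vecs X" "nrm X x = 1" using ex_unit_vector[OF X assms(1)] .
  obtain f where "bounded_op X scalars f" "nrm (dual X) f = 1" "f x = 1"
    using ex_unit_support_functional[OF X x] .
  then show ?thesis
    using norm_le_numerical_radius[OF assms(2) x] by (meson norm_ge_zero order_trans)
qed

lemma numerical_index_le:
  assumes nz: "vecs X \<noteq> {0}" and T: "bounded_op X X T" "nrm (bounded_ops X X) T = 1"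
  shows "numerical_index X \<le> numerical_radius X T"
  unfolding numerical_index_def
proof (rule cInf_lower)
  show "bdd_below {numerical_radius X T |T. T \<in> vecs (bounded_ops X X) \<and> nrm (bounded_ops X X) T = 1}"
    using numerical_radius_nonneg[OF nz] by (intro bdd_belowI[of _ 0]) auto
qed (use T in auto)

lemma bounded_op_ident: "bounded_op X X (ident X)"
  by (rule bounded_opI[where C = 1]) (simp_all add: ident_def mem_rules[OF X])

lemma opnorm_ident:
  assumes "vecs X \<noteq> {0}"
  shows "nrm (bounded_ops X X) (ident X) = 1"
proof (rule order_antisym)
  show "nrm (bounded_ops X X) (ident X) \<le> 1"
    by (rule opnorm_le[OF X X]) (simp_all add: ident_def)
  obtain x where "x \<in> vecs X" "nrm X x = 1" using ex_unit_vector[OF X assms] .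
  then show "1 \<le> nrm (bounded_ops X X) (ident X)"
    using op_bound[OF X X bounded_op_ident, of x] by (simp add: ident_def)
qed

lemma le_numerical_index:
  assumes nz: "vecs X \<noteq> {0}"
    and le: "\<And>T. \<lbrakk>bounded_op X X T; nrm (bounded_ops X X) T = 1\<rbrakk> \<Longrightarrow> C \<le> numerical_radius X T"
  shows "C \<le> numerical_index X"
  unfolding numerical_index_def
  by (rule cInf_greatest) (use bounded_op_ident opnorm_ident[OF nz] le in auto)

lemma bounded_op_ident_plus:
  assumes S: "bounded_op X X S"
  shows "bounded_op X X (\<lambda>x. ident X x + scl X c (S x))"
proof -
  have "ident X + scl (bounded_ops X X) c S \<in> vecs (bounded_ops X X)"
    using S bounded_op_ident
    by (intro add_mem[OF normed_bounded_ops[OF X X]] scl_mem[OF normed_bounded_ops[OF X X]]) auto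
  then show ?thesis by (simp add: plus_fun_def)
qed

text \<open>Half of Lumer's formula, which recovers the numerical radius from norms: with
  \<open>\<alpha> = \<bar>c\<bar>\<close> the right-hand side is \<open>1 + \<alpha> v(S) + o(\<alpha>)\<close> as \<open>\<alpha> \<rightarrow> 0\<close>. A support functional at \<open>w = (I + c S) x\<close>, applied to
  \<open>(I - c S) w = x - c\<^sup>2 S\<^sup>2 x\<close>, gives the estimate.\<close>

lemma opnorm_ident_plus_le:
  assumes S: "bounded_op X X S" and c: "norm c * numerical_radius X S < 1"
  shows "nrm (bounded_ops X X) (\<lambda>x. ident X x + scl X c (S x))
    \<le> (1 + (norm c * nrm (bounded_ops X X) S)\<^sup>2) / (1 - norm c * numerical_radius X S)"
    (is "_ \<le> ?C")
proof (rule opnorm_le[OF X X])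
  let ?M = "nrm (bounded_ops X X) S" and ?v = "numerical_radius X S"
  note mem = mem_rules[OF X] op_range[OF X X S] and scl = scl_simps[OF X]
  show "0 \<le> ?C" using c by simp
  fix x assume x: "x \<in> vecs X"
  define w where "w = x + scl X c (S x)"
  have w: "w \<in> vecs X" using x mem by (simp add: w_def)
  have "(1 - norm c * ?v) * nrm X w \<le> (1 + (norm c * ?M)\<^sup>2) * nrm X x"
  proof (cases "w = 0")
    case True
    then show ?thesis using nrm_nonneg[OF X x] by (simp add: nrm_0[OF X])
  next
    case False
    define r where "r = nrm X w"
    have r: "r > 0" using False w nrm_nonneg[OF X w] nrm_eq_0[OF X w] by (simp add: r_def)
    define e where "e = scl X (of_real (inverse r)) w"
    have e: "e \<in> vecs X" "nrm X e = 1" "w = scl X (of_real r) e"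
      using r w mem by (auto simp: e_def nrm_scl[OF X] scl norm_inverse r_def)
    obtain f where f: "bounded_op X scalars f" "nrm (dual X) f = 1" "f e = 1"
      using ex_unit_support_functional[OF X e(1,2)] .
    note flin = bounded_opD(3,4)[OF f(1)] op_diff[OF X normed_scalars f(1)]
    have "S (scl X c (S x)) = scl X c (S (S x))" using bounded_opD(4)[OF S] mem by simp
    then have w2: "w - scl X c (S w) = x - scl X (c * c) (S (S x))"
      using bounded_opD(3)[OF S x, of "scl X c (S x)"] mem by (simp add: w_def scl)
    have "r * (1 - norm c * ?v) \<le> r * norm (f (e - scl X c (S e)))"
    proof -
      have "norm (f (S e)) \<le> ?v" by (rule norm_le_numerical_radius[OF S e(1,2) f])
      then have "norm (c * f (S e)) \<le> norm c * ?v" by (simp add: norm_mult mult_left_mono)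
      moreover have "norm (1 - c * f (S e)) \<ge> norm (1::'k) - norm (c * f (S e))"
        by (rule norm_triangle_ineq2)
      ultimately show ?thesis using r e mem f by (simp add: flin)
    qed
    also have "\<dots> = norm (f (scl X (of_real r) (e - scl X c (S e))))"
      using r e mem by (simp add: flin norm_mult)
    also have "scl X (of_real r) (e - scl X c (S e)) = w - scl X c (S w)"
      using bounded_opD(4)[OF S e(1)] by (simp add: e(3) scl mult.commute)
    also have "norm (f \<dots>) \<le> nrm X (x - scl X (c * c) (S (S x)))"
      using functional_bound[OF X f(1), of "w - scl X c (S w)"] f(2) x mem by (simp add: w2)
    also have "\<dots> \<le> nrm X x + norm (c * c) * nrm X (S (S x))"
      using nrm_triangle_diff[OF X x, of "scl X (c * c) (S (S x))"] mem by (simp add: nrm_scl[OF X])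
    also have "nrm X (S (S x)) \<le> ?M * (?M * nrm X x)"
      using op_bound[OF X X S, of "S x"] op_bound[OF X X S x] mem opnorm_nonneg[OF X X S]
      by (meson mult_left_mono order_trans)
    then have "nrm X x + norm (c * c) * nrm X (S (S x)) \<le> nrm X x + norm (c * c) * (?M * (?M * nrm X x))"
      by (simp add: mult_left_mono)
    also have "\<dots> = (1 + (norm c * ?M)\<^sup>2) * nrm X x"
      by (simp add: norm_mult power2_eq_square algebra_simps)
    finally show ?thesis by (simp add: r_def mult.commute)
  qed
  then show "nrm X (ident X x + scl X c (S x)) \<le> ?C * nrm X x"
    using c x by (simp add: w_def ident_def field_simps)
qed

end

text \<open>Numerical radii are determined by the norms of the operators \<open>I + c S\<close>, so a norm-preserving
  map between operator algebras that respects these combinations does not increase them.\<close>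

theorem numerical_index_transfer:
  fixes W :: "('k::real_or_complex, 'a::ab_group_add) nspace"
    and Z :: "('k, 'b::ab_group_add) nspace"
  assumes W: "normed_space W" and Z: "normed_space Z" and nz: "vecs W \<noteq> {0}"
    and J: "\<And>S. bounded_op W W S \<Longrightarrow> bounded_op Z Z (J S)"
    and norm_J: "\<And>S. bounded_op W W S \<Longrightarrow> nrm (bounded_ops Z Z) (J S) = nrm (bounded_ops W W) S"
    and affine: "\<And>S c z. \<lbrakk>bounded_op W W S; z \<in> vecs Z\<rbrakk>
      \<Longrightarrow> J (\<lambda>x. ident W x + scl W c (S x)) z = z + scl Z c (J S z)"
  shows "numerical_index Z \<le> numerical_index W"
proof (rule le_numerical_index[OF W nz])
  fix S assume S: "bounded_op W W S" "nrm (bounded_ops W W) S = 1"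
  let ?v = "numerical_radius W S"
  have v0: "0 \<le> ?v" by (rule numerical_radius_nonneg[OF W nz S(1)])
  have JS: "bounded_op Z Z (J S)" "nrm (bounded_ops Z Z) (J S) = 1" using J norm_J S by auto
  have nzZ: "vecs Z \<noteq> {0}"
  proof
    assume "vecs Z = {0}"
    then have "nrm (bounded_ops Z Z) (J S) \<le> 0"
      by (intro opnorm_le[OF Z Z]) (auto simp: op_0[OF Z Z JS(1)] nrm_0[OF Z])
    then show False using JS by simp
  qed
  have "numerical_radius Z (J S) \<le> ?v"
  proof (rule numerical_radius_le[OF Z nzZ])
    fix f z assume z: "z \<in> vecs Z" "nrm Z z = 1"
      and f: "bounded_op Z scalars f" "nrm (dual Z) f = 1" "f z = 1"
    define b where "b = norm (f (J S z))"
    obtain \<theta> where \<theta>: "norm \<theta> = 1" "\<theta> * f (J S z) = of_real b"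
      unfolding b_def by (rule ex_unit_rotation)
    \<comment> \<open>The functional \<open>f\<close> takes \<open>(I + c J S) z\<close> to \<open>1 + a b\<close> when \<open>c = a \<theta>\<close>.\<close>
    have *: "(1 + a * b) * (1 - a * ?v) \<le> 1 + a\<^sup>2" if a: "0 < a" "a * ?v < 1" for a
    proof -
      define c where "c = of_real a * \<theta>"
      have c: "norm c = a" using \<theta> a by (simp add: c_def norm_mult)
      let ?T = "\<lambda>x. ident W x + scl W c (S x)"
      have T: "bounded_op W W ?T" by (rule bounded_op_ident_plus[OF W S(1)])
      note mem = mem_rules[OF Z] op_range[OF Z Z JS(1)]
      have "f (J ?T z) = 1 + c * f (J S z)"
        using z mem f(3) bounded_opD(3,4)[OF f(1)] by (simp add: affine[OF S(1)])
      also have "\<dots> = of_real (1 + a * b)" by (simp add: c_def \<theta> mult.assoc)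
      finally have "1 + a * b = norm (f (J ?T z))"
        using a by (simp only: norm_of_real) (simp add: b_def)
      also have "\<dots> \<le> nrm Z (J ?T z)"
        using functional_bound[OF Z f(1), of "J ?T z"] f(2) op_range[OF Z Z J[OF T], of z] by simp
      also have "\<dots> \<le> nrm (bounded_ops W W) ?T"
        using op_bound_unit[OF Z Z J[OF T] z(1)] z(2) norm_J[OF T] by simp
      also have "\<dots> \<le> (1 + a\<^sup>2) / (1 - a * ?v)"
        using opnorm_ident_plus_le[OF W S(1), of c] a c S(2) by simp
      finally show ?thesis using a by (simp add: field_simps)
    qed
    show "b \<le> ?v"
    proof (rule ccontr)
      assume "\<not> b \<le> ?v"
      then have d: "b - ?v > 0" by simp
      \<comment> \<open>Dividing by \<open>a\<close> leaves \<open>b - ?v \<le> a (1 + b ?v)\<close>, which fails for small \<open>a\<close>.\<close>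
      define D where "D = 1 + b * ?v + (b - ?v) * ?v"
      define a where "a = (b - ?v) / (2 * D)"
      have b: "0 \<le> b" by (simp add: b_def)
      have D: "0 < D" using b v0 d unfolding D_def by (intro add_pos_nonneg) auto
      have a: "0 < a" using d D by (simp add: a_def)
      have "(b - ?v) * ?v < 2 * D"
        using D b v0 d unfolding D_def by (smt (verit) mult_nonneg_nonneg)
      then have "a * ?v < 1" using D by (simp add: a_def field_simps)
      from *[OF a this] have "a * (b - ?v) \<le> a * (a * (1 + b * ?v))"
        by (simp add: algebra_simps power2_eq_square)
      then have "b - ?v \<le> a * (1 + b * ?v)" using a by simp
      also have "\<dots> \<le> a * D" using a d v0 by (simp add: D_def)
      also have "\<dots> = (b - ?v) / 2" using D by (simp add: a_def)
      finally show False using d by simp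
    qed
  qed
  moreover have "numerical_index Z \<le> numerical_radius Z (J S)"
    by (rule numerical_index_le[OF Z nzZ JS])
  ultimately show "numerical_index Z \<le> ?v" by simp
qed


section \<open>Bilinear forms and the approximation property\<close>

definition bilinear_form ::
    "('k::real_or_complex, 'a::ab_group_add) nspace \<Rightarrow> ('k, 'b::ab_group_add) nspace \<Rightarrow>
     ('a \<Rightarrow> 'b \<Rightarrow> 'k) \<Rightarrow> real \<Rightarrow> bool" where
  "bilinear_form U V B C \<longleftrightarrow> 0 \<le> C \<and>
     (\<forall>u\<in>vecs U. \<forall>u'\<in>vecs U. \<forall>v\<in>vecs V. B (u + u') v = B u v + B u' v) \<and>
     (\<forall>u\<in>vecs U. \<forall>v\<in>vecs V. \<forall>v'\<in>vecs V. B u (v + v') = B u v + B u v') \<and>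
     (\<forall>c. \<forall>u\<in>vecs U. \<forall>v\<in>vecs V. B (scl U c u) v = c * B u v) \<and>
     (\<forall>c. \<forall>u\<in>vecs U. \<forall>v\<in>vecs V. B u (scl V c v) = c * B u v) \<and>
     (\<forall>u\<in>vecs U. \<forall>v\<in>vecs V. norm (B u v) \<le> C * (nrm U u * nrm V v))"

text \<open>Functions become operators by being cut off outside the space.\<close>

definition trunc :: "('k, 'a) nspace \<Rightarrow> ('a \<Rightarrow> 'b::zero) \<Rightarrow> 'a \<Rightarrow> 'b" where
  "trunc X h x = (if x \<in> vecs X then h x else 0)"

lemma bilinear_form_swap:
  "bilinear_form U V B C \<Longrightarrow> bilinear_form V U (\<lambda>v u. B u v) C"
  by (simp add: bilinear_form_def mult.commute)

lemma bilinear_formD: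
  assumes "bilinear_form U V B C"
  shows "0 \<le> C" "\<lbrakk>u \<in> vecs U; u' \<in> vecs U; v \<in> vecs V\<rbrakk> \<Longrightarrow> B (u + u') v = B u v + B u' v"
    "\<lbrakk>u \<in> vecs U; v \<in> vecs V; v' \<in> vecs V\<rbrakk> \<Longrightarrow> B u (v + v') = B u v + B u v'"
    "\<lbrakk>u \<in> vecs U; v \<in> vecs V\<rbrakk> \<Longrightarrow> B (scl U c u) v = c * B u v"
    "\<lbrakk>u \<in> vecs U; v \<in> vecs V\<rbrakk> \<Longrightarrow> B u (scl V c v) = c * B u v"
    "\<lbrakk>u \<in> vecs U; v \<in> vecs V\<rbrakk> \<Longrightarrow> norm (B u v) \<le> C * (nrm U u * nrm V v)"
  using assms unfolding bilinear_form_def by auto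

lemma bounded_op_bilinear_right:
  assumes V: "normed_space V" and B: "bilinear_form U V B C" and u: "u \<in> vecs U"
    and uC: "C * nrm U u \<le> D" "0 \<le> D"
  shows "bounded_op V scalars (trunc V (B u))" "nrm (dual V) (trunc V (B u)) \<le> D"
proof -
  have b: "norm (trunc V (B u) v) \<le> D * nrm V v" if v: "v \<in> vecs V" for v
    using bilinear_formD(6)[OF B u v] mult_right_mono[OF uC(1) nrm_nonneg[OF V v]] v
    by (simp add: trunc_def mult.assoc)
  show "bounded_op V scalars (trunc V (B u))"
    using b u by (intro bounded_opI[where C = D])
      (simp_all add: trunc_def mem_rules[OF V] bilinear_formD[OF B])
  show "nrm (dual V) (trunc V (B u)) \<le> D"
    using b uC(2) by (intro functional_norm_le[OF V])
qed

lemma bilinear_form_summable: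
  assumes B: "bilinear_form U V B C" and "\<And>n. u n \<in> vecs U" "\<And>n. v n \<in> vecs V"
    and "summable (\<lambda>n. nrm U (u n) * nrm V (v n))"
  shows "summable (\<lambda>n. norm (B (u n) (v n)))" "summable (\<lambda>n. B (u n) (v n))"
    "norm (\<Sum>n. B (u n) (v n)) \<le> C * (\<Sum>n. nrm U (u n) * nrm V (v n))"
proof -
  have s: "summable (\<lambda>n. C * (nrm U (u n) * nrm V (v n)))" using assms(4) by (rule summable_mult)
  show n: "summable (\<lambda>n. norm (B (u n) (v n)))"
    by (rule summable_comparison_test'[OF s]) (use assms bilinear_formD(6)[OF B] in simp)
  then show "summable (\<lambda>n. B (u n) (v n))" by (rule summable_norm_cancel)
  have "norm (\<Sum>n. B (u n) (v n)) \<le> (\<Sum>n. norm (B (u n) (v n)))" using n by (rule summable_norm)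
  also have "\<dots> \<le> (\<Sum>n. C * (nrm U (u n) * nrm V (v n)))"
    by (rule suminf_le[OF _ n s]) (use assms bilinear_formD(6)[OF B] in simp)
  also have "\<dots> = C * (\<Sum>n. nrm U (u n) * nrm V (v n))" using assms(4) by (rule suminf_mult)
  finally show "norm (\<Sum>n. B (u n) (v n)) \<le> \<dots>" .
qed

lemma bilinear_form_tensor:
  assumes U: "normed_space U" and V: "normed_space V"
    and G: "bounded_op U scalars G" and g: "bounded_op V scalars g"
  shows "bilinear_form U V (\<lambda>u v. G u * g v) (nrm (dual U) G * nrm (dual V) g)"
proof -
  have "norm (G u * g v) \<le> nrm (dual U) G * nrm (dual V) g * (nrm U u * nrm V v)"
    if "u \<in> vecs U" "v \<in> vecs V" for u v
  proof -
    have "norm (G u) * norm (g v) \<le> (nrm (dual U) G * nrm U u) * (nrm (dual V) g * nrm V v)"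
      using functional_bound[OF U G that(1)] functional_bound[OF V g that(2)]
      by (meson mult_mono norm_ge_zero order_trans)
    then show ?thesis by (simp add: norm_mult mult_ac)
  qed
  then show ?thesis
    using opnorm_nonneg[OF U normed_scalars G] opnorm_nonneg[OF V normed_scalars g]
    by (simp add: bilinear_form_def bounded_opD[OF G] bounded_opD[OF g] algebra_simps dual_def)
qed

text \<open>Vectors of a finite-dimensional subspace have bounded coordinates. To extend an operator
  \<open>P = \<Sum> g\<^sub>j \<otimes> e\<^sub>j\<close> that fixes the span of \<open>A\<close> by a further vector \<open>a\<close>, compose a functional that
  takes the value 1 at \<open>u = a - P a\<close> with \<open>I - P\<close>, and add its tensor product with \<open>u\<close>.\<close>

lemma ex_finite_dim_projection:
  fixes V :: "('k::real_or_complex, 'b::ab_group_add) nspace"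
  assumes V: "normed_space V" and A: "finite A" "A \<subseteq> vecs V"
  obtains m g e where "\<And>j. j < (m::nat) \<Longrightarrow> bounded_op V scalars (g j)" "\<And>j. j < m \<Longrightarrow> e j \<in> vecs V"
    "\<And>z. z \<in> module.span (scl V) A \<Longrightarrow> (\<Sum>j<m. scl V (g j z) (e j)) = z"
proof -
  note mem = mem_rules[OF V] and scl = scl_simps[OF V]
  have "\<exists>(m::nat) g e. (\<forall>j<m. bounded_op V scalars (g j) \<and> e j \<in> vecs V) \<and>
      (\<forall>a\<in>A. (\<Sum>j<m. scl V (g j a) (e j)) = a)"
    using A
  proof (induction A rule: finite_induct)
    case empty
    show ?case by (rule exI[of _ 0]) simp
  next
    case (insert a A)
    then have "A \<subseteq> vecs V" by simp
    from insert.IH[OF this] obtain m :: nat and g e where g: "\<And>j. j < m \<Longrightarrow> bounded_op V scalars (g j)"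
      and e: "\<And>j. j < m \<Longrightarrow> e j \<in> vecs V" and A: "\<And>a. a \<in> A \<Longrightarrow> (\<Sum>j<m. scl V (g j a) (e j)) = a"
      by blast
    define P where "P z = (\<Sum>j<m. scl V (g j z) (e j))" for z
    have P_mem: "P z \<in> vecs V" for z using e by (auto simp: P_def intro: mem)
    define u where "u = a - P a"
    have u: "u \<in> vecs V" using insert.prems P_mem mem by (simp add: u_def)
    show ?case
    proof (cases "u = 0")
      case True
      then have "P a = a" by (simp add: u_def)
      then show ?thesis using g e A unfolding P_def by blast
    next
      case False
      then obtain f where f: "bounded_op V scalars f" "f u \<noteq> 0"
        using ex_separating_functional[OF V u] by blast
      note flin = bounded_opD[OF f(1)] op_diff[OF V normed_scalars f(1)] op_sum[OF V normed_scalars f(1)]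
      define h where "h = scl (dual V) (inverse (f u)) (f - (\<Sum>j<m. scl (dual V) (f (e j)) (g j)))"
      have "h \<in> vecs (dual V)"
        unfolding h_def using f g by (intro mem_rules[OF normed_dual[OF V]]) auto
      then have h: "bounded_op V scalars h" by simp
      have hz: "h z = inverse (f u) * f (z - P z)" if "z \<in> vecs V" for z
      proof -
        have sum_apply: "(\<Sum>j\<in>J. F j) z = (\<Sum>j\<in>J. F j z)" for J and F :: "nat \<Rightarrow> 'b \<Rightarrow> 'k"
          by (induction J rule: infinite_finite_induct) auto
        have "f (P z) = (\<Sum>j<m. g j z * f (e j))"
          unfolding P_def using e by (subst flin(6)) (auto simp: flin intro: mem)
        then show ?thesis
          using that P_mem by (simp add: h_def flin sum_apply fun_diff_def mult.commute)
      qed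
      define g' e' where "g' = g(m := h)" and "e' = e(m := u)"
      have sum: "(\<Sum>j<Suc m. scl V (g' j z) (e' j)) = P z + scl V (h z) u" for z
        by (simp add: g'_def e'_def P_def)
      have "h a = 1" using hz[of a] insert.prems f by (simp add: u_def)
      then have "(\<Sum>j<Suc m. scl V (g' j a) (e' j)) = a" by (simp only: sum scl) (simp add: u_def)
      moreover have "(\<Sum>j<Suc m. scl V (g' j b) (e' j)) = b" if "b \<in> A" for b
      proof -
        have "P b = b" using A[OF that] by (simp add: P_def)
        moreover from this have "h b = 0"
          using hz[of b] insert.prems that op_0[OF V normed_scalars f(1)] by auto
        ultimately show ?thesis by (simp only: sum scl) simp
      qed
      moreover have "bounded_op V scalars (g' j) \<and> e' j \<in> vecs V" if "j < Suc m" for j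
        using that g e h u by (auto simp: g'_def e'_def less_Suc_eq)
      ultimately show ?thesis by blast
    qed
  qed
  then obtain m :: nat and g e where g: "\<And>j. j < m \<Longrightarrow> bounded_op V scalars (g j)"
    and e: "\<And>j. j < m \<Longrightarrow> e j \<in> vecs V" and fixed: "\<And>a. a \<in> A \<Longrightarrow> (\<Sum>j<m. scl V (g j a) (e j)) = a"
    by blast
  interpret vector_space "scl V" using V by (simp add: normed_space_def)
  define P where "P z = (\<Sum>j<m. scl V (g j z) (e j))" for z
  let ?F = "{z \<in> vecs V. P z = z}"
  have "P (x + y) = P x + P y" "P (scl V c x) = scl V c (P x)"
    if "x \<in> vecs V" "y \<in> vecs V" for x y c
    unfolding P_def scl_sum[OF V] sum.distrib[symmetric] using that
    by (auto intro!: sum.cong simp: bounded_opD[OF g] scl)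
  moreover have "P 0 = 0"
    unfolding P_def by (rule sum.neutral) (simp add: op_0[OF V normed_scalars g] scl)
  ultimately have "subspace ?F"
    unfolding subspace_def by (auto simp: mem)
  then have "span A \<subseteq> ?F" using fixed A by (intro span_minimal) (auto simp: P_def)
  then show ?thesis using that[of m g e] g e unfolding P_def by blast
qed

text \<open>The square roots of the tails can serve as divisors: \<open>(r - s) / \<surd>r \<le> 2 (\<surd>r - \<surd>s)\<close> for
  \<open>s \<le> r\<close> leads to a telescoping series.\<close>

lemma summable_rescale:
  fixes a :: "nat \<Rightarrow> real"
  assumes a: "summable a" "\<And>n. 0 \<le> a n"
  obtains c where "\<And>n. 0 < c n" "c \<longlonglongrightarrow> 0" "summable (\<lambda>n. a n / c n)"
proof -
  \<comment> \<open>The summand \<open>(1/2)\<^sup>n\<close> keeps the tails positive.\<close>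
  define b where "b n = a n + (1/2) ^ n" for n
  have sb: "summable b" unfolding b_def by (intro summable_add a summable_geometric) simp
  have b0: "0 < b n" for n using a(2)[of n] by (simp add: b_def add_nonneg_pos)
  define r where "r n = suminf b - (\<Sum>i<n. b i)" for n
  have r0: "0 < r n" for n using sum_less_suminf[OF sb, of n] b0 by (simp add: r_def)
  have "r \<longlonglongrightarrow> suminf b - suminf b" unfolding r_def
    by (intro tendsto_intros summable_LIMSEQ[OF sb])
  then have r: "(\<lambda>n. sqrt (r n)) \<longlonglongrightarrow> 0" using tendsto_real_sqrt by fastforce
  have rS: "r n = r (Suc n) + b n" for n by (simp add: r_def)
  have le: "norm (a n / sqrt (r n)) \<le> 2 * (sqrt (r n) - sqrt (r (Suc n)))" for n
  proof -
    have s: "sqrt (r (Suc n)) \<le> sqrt (r n)" using rS[of n] b0[of n] by simp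
    have "a n \<le> r n - r (Suc n)" using rS[of n] by (simp add: b_def)
    also have "\<dots> = (sqrt (r n) - sqrt (r (Suc n))) * (sqrt (r n) + sqrt (r (Suc n)))"
      using r0[of n] r0[of "Suc n"] by (simp add: algebra_simps)
    also have "\<dots> \<le> (sqrt (r n) - sqrt (r (Suc n))) * (2 * sqrt (r n))"
      using s by (intro mult_left_mono) auto
    finally show ?thesis using r0[of n] a(2)[of n] by (simp add: field_simps)
  qed
  have "summable (\<lambda>n. 2 * (sqrt (r n) - sqrt (r (Suc n))))"
    by (intro summable_mult telescope_summable'[OF r])
  then have "summable (\<lambda>n. a n / sqrt (r n))" by (rule summable_comparison_test') (use le in auto)
  then show ?thesis using that[of "\<lambda>n. sqrt (r n)"] r r0 by simp
qed

text \<open>If a tensor \<open>\<Sum> u\<^sub>n \<otimes> v\<^sub>n\<close> in the projective tensor product is annihilated by all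
  elementary functionals \<open>G \<otimes> g\<close>, then the approximation property of one factor makes it 0. After
  rescaling, the \<open>v\<^sub>n\<close> tend to 0 and the \<open>\<parallel>u\<^sub>n\<parallel>\<close> are summable, so that a finite rank operator
  \<open>R\<close> moves the compact set of all \<open>v\<^sub>n\<close> by at most \<open>\<epsilon>\<close>; and \<open>B(u, R v)\<close> is a finite sum of
  elementary functionals.\<close>

lemma approximation_property_separates:
  fixes U :: "('k::real_or_complex, 'a::ab_group_add) nspace"
    and V :: "('k, 'b::ab_group_add) nspace"
  assumes U: "normed_space U" and V: "normed_space V" and AP: "approximation_property V"
    and u: "\<And>n. u n \<in> vecs U" and v: "\<And>n. v n \<in> vecs V"
    and summable: "summable (\<lambda>n. nrm U (u n) * nrm V (v n))"
    and zero: "\<And>G g. \<lbrakk>bounded_op U scalars G; bounded_op V scalars g\<rbrakk> \<Longrightarrow> (\<Sum>n. G (u n) * g (v n)) = 0"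
    and B: "bilinear_form U V B C"
  shows "(\<Sum>n. B (u n) (v n)) = 0"
proof -
  obtain c where c: "\<And>n. 0 < c n" "c \<longlonglongrightarrow> 0" "summable (\<lambda>n. nrm U (u n) * nrm V (v n) / c n)"
    using summable_rescale[OF summable] nrm_nonneg[OF U u] nrm_nonneg[OF V v] by force
  define u' where "u' n = scl U (of_real (nrm V (v n) / c n)) (u n)" for n
  define v' where "v' n = scl V (of_real (c n / nrm V (v n))) (v n)" for n
  have u': "u' n \<in> vecs U" and v': "v' n \<in> vecs V" for n
    using u v by (auto simp: u'_def v'_def intro: mem_rules U V)
  have nu': "nrm U (u' n) = nrm U (u n) * nrm V (v n) / c n" for n
    using c(1)[of n] nrm_nonneg[OF V v, of n] by (simp add: u'_def nrm_scl[OF U u] norm_divide)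
  have nv': "nrm V (v' n) \<le> c n" for n
    using c(1)[of n] nrm_nonneg[OF V v, of n] by (simp add: v'_def nrm_scl[OF V v] norm_divide)
  have same: "D (u' n) (v' n) = D (u n) (v n)" if D: "bilinear_form U V D C'" for D C' n
  proof (cases "nrm V (v n) = 0")
    case True
    then have "norm (D (u n) (v n)) \<le> 0" using bilinear_formD(6)[OF D u v, of n n] by simp
    then show ?thesis
      using True u v by (simp add: u'_def v'_def bilinear_formD[OF D] mem_rules U V)
  next
    case False
    then show ?thesis
      using c(1)[of n] u v by (simp add: u'_def v'_def bilinear_formD[OF D] mem_rules[OF U] mem_rules[OF V])
  qed
  have su': "summable (\<lambda>n. nrm U (u' n))" using c(3) by (simp add: nu')
  have lim: "limitin (Metric_space.mtopology (vecs V) (ndist V)) v' 0 sequentially"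
    unfolding Metric_space.limit_metric_sequentially[OF Metric_space_ndist[OF V]]
  proof (intro conjI allI impI)
    fix e :: real assume "0 < e"
    then obtain N where "\<And>n. n \<ge> N \<Longrightarrow> norm (c n - 0) < e" using LIMSEQ_D[OF c(2)] by blast
    then have "nrm V (v' n) < e" if "n \<ge> N" for n
      using nv'[of n] that by (metis abs_ge_self diff_zero le_less_trans order_trans real_norm_def)
    then show "\<exists>N. \<forall>n\<ge>N. v' n \<in> vecs V \<and> ndist V (v' n) 0 < e"
      using v' by (auto simp: ndist_def zero_mem[OF V])
  qed (simp add: zero_mem[OF V])
  have K: "compactin (Metric_space.mtopology (vecs V) (ndist V)) (insert 0 (range v'))"
    by (rule compactin_sequence_with_limit[OF lim order_refl])
      (use v' in \<open>auto simp: Metric_space.topspace_mtopology[OF Metric_space_ndist[OF V]]\<close>)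
  let ?s = "\<Sum>n. B (u n) (v n)" and ?S = "\<Sum>n. nrm U (u' n)"
  have le: "norm ?s \<le> C * e * ?S" if e: "0 < e" for e
  proof -
    obtain R where R: "bounded_op V V R" "finite_rank V V R"
      and Re: "\<And>x. x \<in> insert 0 (range v') \<Longrightarrow> nrm V (R x - x) < e"
      using AP K e unfolding approximation_property_def by (metis bounded_ops_simps(1))
    obtain A where A: "finite A" "A \<subseteq> vecs V" "R ` vecs V \<subseteq> module.span (scl V) A"
      using R(2) unfolding finite_rank_def by blast
    obtain m g f where g: "\<And>j. j < (m::nat) \<Longrightarrow> bounded_op V scalars (g j)"
      and f: "\<And>j. j < m \<Longrightarrow> f j \<in> vecs V"
      and proj: "\<And>z. z \<in> module.span (scl V) A \<Longrightarrow> (\<Sum>j<m. scl V (g j z) (f j)) = z"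
      using ex_finite_dim_projection[OF V A(1,2)] by metis
    have Rv: "R (v' n) \<in> vecs V" for n by (rule op_range[OF V V R(1)])
    have s: "(\<lambda>n. B (u n) (v n)) sums ?s"
      using bilinear_form_summable(2)[OF B u v summable] by (rule summable_sums)
    have "(\<lambda>n. B (u' n) (R (v' n))) sums 0"
    proof -
      have "B (u' n) (R (v' n)) = (\<Sum>j<m. trunc U (\<lambda>u. B u (f j)) (u' n) * g j (R (v' n)))" for n
      proof -
        have b: "bounded_op V scalars (trunc V (B (u' n)))"
          by (rule bounded_op_bilinear_right[OF V B u' order_refl])
            (use bilinear_formD(1)[OF B] nrm_nonneg[OF U u'] in auto)
        have "R (v' n) = (\<Sum>j<m. scl V (g j (R (v' n))) (f j))"
          using proj[of "R (v' n)"] A(3) v'[of n] by auto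
        then have "trunc V (B (u' n)) (R (v' n)) = (\<Sum>j<m. trunc V (B (u' n)) (scl V (g j (R (v' n))) (f j)))"
          using op_sum[OF V normed_scalars b, of "{..<m}" "\<lambda>j. scl V (g j (R (v' n))) (f j)"]
            f mem_rules[OF V] by simp
        also have "\<dots> = (\<Sum>j<m. g j (R (v' n)) * trunc V (B (u' n)) (f j))"
          using f bounded_opD(4)[OF b] by (intro sum.cong) auto
        finally show ?thesis using Rv f u' by (simp add: trunc_def mult.commute)
      qed
      moreover have "(\<lambda>n. trunc U (\<lambda>u. B u (f j)) (u' n) * g j (R (v' n))) sums 0" if j: "j < m" for j
      proof -
        have G: "bounded_op U scalars (trunc U (\<lambda>u. B u (f j)))"
          by (rule bounded_op_bilinear_right[OF U bilinear_form_swap[OF B] f[OF j] order_refl])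
            (use bilinear_formD(1)[OF B] nrm_nonneg[OF V f[OF j]] in auto)
        have h: "bounded_op V scalars (\<lambda>x. g j (R x))"
          by (rule bounded_op_comp[OF V V normed_scalars R(1) g[OF j]])
        note Gh = bilinear_form_tensor[OF U V G h]
        show ?thesis
          using summable_sums[OF bilinear_form_summable(2)[OF Gh u v summable]]
          by (simp only: zero[OF G h] same[OF Gh])
      qed
      ultimately show ?thesis
        using sums_sum[of "{..<m}" "\<lambda>j n. trunc U (\<lambda>u. B u (f j)) (u' n) * g j (R (v' n))" "\<lambda>_. 0"]
        by simp
    qed
    moreover have "B (u n) (v n) - B (u' n) (R (v' n)) = B (u' n) (v' n - R (v' n))" for n
      using bilinear_formD(3)[OF B u', of "v' n - R (v' n)" "R (v' n)" n] v' Rv mem_rules[OF V]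
      by (simp add: same[OF B, symmetric])
    ultimately have d: "(\<lambda>n. B (u' n) (v' n - R (v' n))) sums ?s"
      using sums_diff[OF s] by fastforce
    have le: "norm (B (u' n) (v' n - R (v' n))) \<le> (C * e) * nrm U (u' n)" for n
    proof -
      have "nrm V (v' n - R (v' n)) \<le> e"
        using Re[of "v' n"] nrm_minus_commute[OF V v' Rv, of n n] by simp
      then have "C * (nrm U (u' n) * nrm V (v' n - R (v' n))) \<le> C * (nrm U (u' n) * e)"
        using bilinear_formD(1)[OF B] nrm_nonneg[OF U u'] by (intro mult_left_mono) auto
      then show ?thesis
        using bilinear_formD(6)[OF B u', of "v' n - R (v' n)" n] v' Rv mem_rules[OF V]
        by (simp add: mult_ac)
    qed
    have sR: "summable (\<lambda>n. (C * e) * nrm U (u' n))" using su' by (rule summable_mult)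
    have sL: "summable (\<lambda>n. norm (B (u' n) (v' n - R (v' n))))"
      by (rule summable_comparison_test'[OF sR]) (use le in simp)
    have "norm ?s \<le> (\<Sum>n. norm (B (u' n) (v' n - R (v' n))))"
      using summable_norm[OF sL] sums_unique[OF d] by simp
    also have "\<dots> \<le> (\<Sum>n. (C * e) * nrm U (u' n))" by (rule suminf_le[OF le sL sR])
    also have "\<dots> = C * e * ?S" using su' by (rule suminf_mult)
    finally show ?thesis .
  qed
  have "((\<lambda>e. C * e * ?S) \<longlongrightarrow> C * 0 * ?S) (at_right 0)" by (intro tendsto_intros)
  moreover have "eventually (\<lambda>e. norm ?s \<le> C * e * ?S) (at_right 0)"
    using eventually_at_right_less by (rule eventually_mono) (rule le)
  ultimately have "norm ?s \<le> C * 0 * ?S" by (rule tendsto_lowerbound) simp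
  then show ?thesis by simp
qed


section \<open>Nuclear operators\<close>

definition norm_limit :: "('k, 'b::ab_group_add) nspace \<Rightarrow> (nat \<Rightarrow> 'b) \<Rightarrow> 'b \<Rightarrow> bool" where
  "norm_limit Y s t \<longleftrightarrow> (\<lambda>n. nrm Y (t - s n)) \<longlonglongrightarrow> 0"

lemma norm_limit_compose:
  "\<lbrakk>norm_limit Y s t; filterlim r sequentially sequentially\<rbrakk> \<Longrightarrow> norm_limit Y (\<lambda>n. s (r n)) t"
  unfolding norm_limit_def by (rule filterlim_compose)

lemma norm_limitI:
  fixes Y :: "('k::real_or_complex, 'b::ab_group_add) nspace"
  assumes Y: "normed_space Y" and "e \<longlonglongrightarrow> 0" "t \<in> vecs Y" "\<And>n. s n \<in> vecs Y" "\<And>n. nrm Y (t - s n) \<le> e n"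
  shows "norm_limit Y s t"
  unfolding norm_limit_def
  by (rule tendsto_sandwich[OF _ _ tendsto_const assms(2)])
    (use assms(3-) nrm_nonneg[OF Y] diff_mem[OF Y] in auto)

context
  fixes Y :: "('k::real_or_complex, 'b::ab_group_add) nspace"
  assumes Y: "normed_space Y"
begin

lemma norm_limit_unique:
  assumes "norm_limit Y s t" "norm_limit Y s t'" "\<And>n. s n \<in> vecs Y" "t \<in> vecs Y" "t' \<in> vecs Y"
  shows "t = t'"
proof -
  have "nrm Y (t - t') \<le> nrm Y (t - s n) + nrm Y (t' - s n)" for n
    using nrm_triangle_diff[OF Y, of "t - s n" "t' - s n"] assms diff_mem[OF Y] by simp
  moreover have "(\<lambda>n. nrm Y (t - s n) + nrm Y (t' - s n)) \<longlonglongrightarrow> 0"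
    using tendsto_add[OF assms(1,2)[unfolded norm_limit_def]] by simp
  ultimately have "nrm Y (t - t') \<le> 0" by (intro LIMSEQ_le_const) auto
  then show ?thesis
    using nrm_nonneg[OF Y, of "t - t'"] nrm_eq_0[OF Y, of "t - t'"] diff_mem[OF Y] assms by simp
qed

lemma norm_limit_add:
  assumes "norm_limit Y s t" "norm_limit Y s' t'" "\<And>n. s n \<in> vecs Y" "t \<in> vecs Y"
    "\<And>n. s' n \<in> vecs Y" "t' \<in> vecs Y"
  shows "norm_limit Y (\<lambda>n. s n + s' n) (t + t')"
proof (rule norm_limitI[OF Y])
  show "(\<lambda>n. nrm Y (t - s n) + nrm Y (t' - s' n)) \<longlonglongrightarrow> 0"
    using tendsto_add[OF assms(1,2)[unfolded norm_limit_def]] by simp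
  show "nrm Y (t + t' - (s n + s' n)) \<le> nrm Y (t - s n) + nrm Y (t' - s' n)" for n
    using nrm_triangle[OF Y, of "t - s n" "t' - s' n"] assms diff_mem[OF Y] by (simp add: algebra_simps)
qed (use assms add_mem[OF Y] in auto)

lemma norm_limit_op:
  assumes Z: "normed_space Z" and S: "bounded_op Y Z S"
    and "norm_limit Y s t" "\<And>n. s n \<in> vecs Y" "t \<in> vecs Y"
  shows "norm_limit Z (\<lambda>n. S (s n)) (S t)"
proof -
  have "(\<lambda>n. nrm (bounded_ops Y Z) S * nrm Y (t - s n)) \<longlonglongrightarrow> 0"
    by (rule tendsto_mult_right_zero[OF assms(3)[unfolded norm_limit_def]])
  moreover have "nrm Z (S t - S (s n)) \<le> nrm (bounded_ops Y Z) S * nrm Y (t - s n)" for n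
    using op_bound[OF Y Z S diff_mem[OF Y assms(5,4)], of n] op_diff[OF Y Z S assms(5,4), of n]
    by simp
  ultimately show ?thesis by (intro norm_limitI[OF Z] op_range[OF Y Z S])
qed

lemma norm_limit_scl:
  assumes "norm_limit Y s t" "\<And>n. s n \<in> vecs Y" "t \<in> vecs Y"
  shows "norm_limit Y (\<lambda>n. scl Y c (s n)) (scl Y c t)"
proof (rule norm_limitI[OF Y])
  show "(\<lambda>n. norm c * nrm Y (t - s n)) \<longlonglongrightarrow> 0"
    by (rule tendsto_mult_right_zero[OF assms(1)[unfolded norm_limit_def]])
  show "nrm Y (scl Y c t - scl Y c (s n)) \<le> norm c * nrm Y (t - s n)" for n
    using nrm_scl[OF Y, of "t - s n" c] diff_mem[OF Y] assms by (simp add: scl_simps[OF Y])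
qed (use assms scl_mem[OF Y] in auto)

end

text \<open>Weaving two nuclear representations represents the sum of the operators; the partial sums
  of the woven sequence are sums of partial sums at half the index.\<close>

definition weave :: "(nat \<Rightarrow> 'c) \<Rightarrow> (nat \<Rightarrow> 'c) \<Rightarrow> nat \<Rightarrow> 'c" where
  "weave s t n = (if even n then s (n div 2) else t (n div 2))"

lemma sum_weave:
  fixes a b :: "nat \<Rightarrow> 'c::comm_monoid_add"
  shows "(\<Sum>i<n. weave a b i) = (\<Sum>i<(n + 1) div 2. a i) + (\<Sum>i<n div 2. b i)"
proof (induction n)
  case (Suc n)
  show ?case
  proof (cases "even n")
    case True
    then have "(Suc n + 1) div 2 = Suc (n div 2)" "Suc n div 2 = n div 2" "(n + 1) div 2 = n div 2"
      by auto
    then show ?thesis using True Suc by (simp add: weave_def ac_simps)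
  next
    case False
    then have "(Suc n + 1) div 2 = (n + 1) div 2" "Suc n div 2 = Suc (n div 2)"
      by (auto elim!: oddE)
    then show ?thesis using False Suc by (simp add: weave_def ac_simps)
  qed
qed simp

lemma filterlim_half: "filterlim (\<lambda>n::nat. n div 2) sequentially sequentially"
    "filterlim (\<lambda>n::nat. (n + 1) div 2) sequentially sequentially"
proof -
  have "eventually (\<lambda>n. Z \<le> n div 2 \<and> Z \<le> (n + 1) div 2) sequentially" for Z :: nat
    using eventually_ge_at_top[of "2 * Z"] by eventually_elim auto
  then show "filterlim (\<lambda>n::nat. n div 2) sequentially sequentially"
    "filterlim (\<lambda>n::nat. (n + 1) div 2) sequentially sequentially"
    unfolding filterlim_at_top by (simp_all add: eventually_conj_iff)
qed

lemma sums_weave: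
  fixes a b :: "nat \<Rightarrow> 'c::real_normed_vector"
  assumes "a sums s" "b sums t"
  shows "weave a b sums (s + t)"
  unfolding sums_def sum_weave
  by (intro tendsto_add filterlim_compose[OF assms(1)[unfolded sums_def] filterlim_half(2)]
      filterlim_compose[OF assms(2)[unfolded sums_def] filterlim_half(1)])

lemma weave_map2: "h (weave f g n) (weave y z n) = weave (\<lambda>i. h (f i) (y i)) (\<lambda>i. h (g i) (z i)) n"
  by (simp add: weave_def)

text \<open>The operator \<open>f \<otimes> y\<close> of rank one. It vanishes outside \<open>vecs X\<close> whenever \<open>f\<close> does.\<close>

definition tensor :: "('k, 'b) nspace \<Rightarrow> ('a \<Rightarrow> 'k) \<Rightarrow> 'b \<Rightarrow> 'a \<Rightarrow> 'b" where
  "tensor Y f y = (\<lambda>x. scl Y (f x) y)"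

lemma nuclear_ops_simps [simp]:
  "T \<in> vecs (nuclear_ops X Y) \<longleftrightarrow> bounded_op X Y T \<and> (\<exists>f y. nuclear_rep X Y T f y)"
  "scl (nuclear_ops X Y) = (\<lambda>c T x. scl Y c (T x))"
  by (simp_all add: nuclear_ops_def)

context
  fixes X :: "('k::real_or_complex, 'a::ab_group_add) nspace"
    and Y :: "('k, 'b::ab_group_add) nspace"
  assumes X: "normed_space X" and Y: "normed_space Y"
begin

abbreviation (input) "N \<equiv> nuclear_ops X Y"
abbreviation (input) wt :: "(nat \<Rightarrow> 'a \<Rightarrow> 'k) \<Rightarrow> (nat \<Rightarrow> 'b) \<Rightarrow> nat \<Rightarrow> real" where
  "wt f y n \<equiv> nrm (dual X) (f n) * nrm Y (y n)"
abbreviation (input) psum :: "(nat \<Rightarrow> 'a \<Rightarrow> 'k) \<Rightarrow> (nat \<Rightarrow> 'b) \<Rightarrow> 'a \<Rightarrow> nat \<Rightarrow> 'b" where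
  "psum f y x n \<equiv> \<Sum>i<n. scl Y (f i x) (y i)"

lemma nuclear_rep_iff:
  "nuclear_rep X Y T f y \<longleftrightarrow> (\<forall>n. bounded_op X scalars (f n)) \<and> (\<forall>n. y n \<in> vecs Y) \<and>
     summable (\<lambda>n. wt f y n) \<and> (\<forall>x\<in>vecs X. norm_limit Y (psum f y x) (T x))"
  by (simp add: nuclear_rep_def norm_limit_def)

lemma psum_mem: "(\<And>n. y n \<in> vecs Y) \<Longrightarrow> psum f y x n \<in> vecs Y"
  by (auto intro: mem_rules[OF Y])

lemma wt_nonneg: "\<lbrakk>\<And>n. bounded_op X scalars (f n); \<And>n. y n \<in> vecs Y\<rbrakk> \<Longrightarrow> 0 \<le> wt f y n"
  using nrm_nonneg[OF normed_dual[OF X]] nrm_nonneg[OF Y] by simp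

lemma psum_diff_bound:
  assumes f: "\<And>n. bounded_op X scalars (f n)" and y: "\<And>n. y n \<in> vecs Y" and x: "x \<in> vecs X" and "n \<le> m"
  shows "nrm Y (psum f y x m - psum f y x n) \<le> (\<Sum>i=n..<m. wt f y i) * nrm X x"
proof -
  have "psum f y x m - psum f y x n = (\<Sum>i=n..<m. scl Y (f i x) (y i))"
    using sum_diff_nat_ivl[of 0 n m] \<open>n \<le> m\<close> by (simp add: lessThan_atLeast0)
  also have "nrm Y \<dots> \<le> (\<Sum>i=n..<m. nrm Y (scl Y (f i x) (y i)))"
    using y by (intro nrm_sum_le[OF Y]) (auto intro: mem_rules[OF Y])
  also have "\<dots> \<le> (\<Sum>i=n..<m. wt f y i * nrm X x)"
  proof (rule sum_mono)
    fix i
    have "norm (f i x) * nrm Y (y i) \<le> (nrm (dual X) (f i) * nrm X x) * nrm Y (y i)"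
      using functional_bound[OF X f x] nrm_nonneg[OF Y y] by (intro mult_right_mono)
    then show "nrm Y (scl Y (f i x) (y i)) \<le> wt f y i * nrm X x"
      by (simp add: nrm_scl[OF Y y] mult_ac)
  qed
  finally show ?thesis by (simp add: sum_distrib_right)
qed

lemma nuclear_rep_bound:
  assumes rep: "nuclear_rep X Y T f y" and x: "x \<in> vecs X" and T: "T x \<in> vecs Y"
  shows "nrm Y (T x) \<le> (\<Sum>n. wt f y n) * nrm X x"
proof -
  have f: "\<And>n. bounded_op X scalars (f n)" and y: "\<And>n. y n \<in> vecs Y" and s: "summable (\<lambda>n. wt f y n)"
    and lim: "norm_limit Y (psum f y x) (T x)" using rep x by (auto simp: nuclear_rep_iff)
  note y' = psum_mem[where y = y, OF y]
  have "nrm Y (T x) \<le> nrm Y (T x - psum f y x m) + (\<Sum>n. wt f y n) * nrm X x" for m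
  proof -
    have "nrm Y (T x) \<le> nrm Y (T x - psum f y x m) + nrm Y (psum f y x m)"
      using nrm_triangle[OF Y, of "T x - psum f y x m" "psum f y x m"] T y' diff_mem[OF Y] by simp
    moreover have "nrm Y (psum f y x m) \<le> (\<Sum>i=0..<m. wt f y i) * nrm X x"
      using psum_diff_bound[OF f y x, of 0 m] by simp
    moreover have "(\<Sum>i=0..<m. wt f y i) * nrm X x \<le> (\<Sum>n. wt f y n) * nrm X x"
      using sum_le_suminf[OF s, of "{0..<m}"] wt_nonneg[where f = f and y = y, OF f y] nrm_nonneg[OF X x]
      by (intro mult_right_mono) auto
    ultimately show ?thesis by linarith
  qed
  moreover have "(\<lambda>m. nrm Y (T x - psum f y x m) + (\<Sum>n. wt f y n) * nrm X x) \<longlonglongrightarrow> 0 + (\<Sum>n. wt f y n) * nrm X x"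
    using lim unfolding norm_limit_def by (intro tendsto_intros)
  ultimately show ?thesis using LIMSEQ_le_const by fastforce
qed

lemma nuclear_norm_le:
  assumes "nuclear_rep X Y T f y"
  shows "nrm N T \<le> (\<Sum>n. wt f y n)"
proof -
  have "0 \<le> (\<Sum>n. wt f y n)" if "nuclear_rep X Y T f y" for f y
    using that wt_nonneg by (intro suminf_nonneg) (auto simp: nuclear_rep_iff)
  then show ?thesis
    unfolding nuclear_ops_def using assms
    by (auto intro!: cInf_lower bdd_belowI[of _ 0])
qed

lemma le_nuclear_norm:
  assumes "T \<in> vecs N" "\<And>f y. nuclear_rep X Y T f y \<Longrightarrow> C \<le> (\<Sum>n. wt f y n)"
  shows "C \<le> nrm N T"
proof -
  obtain f y where "nuclear_rep X Y T f y" using assms(1) by auto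
  then show ?thesis
    unfolding nuclear_ops_def using assms(2) by (auto intro!: cInf_greatest)
qed

lemma opnorm_le_nuclear_norm:
  assumes T: "T \<in> vecs N"
  shows "nrm (bounded_ops X Y) T \<le> nrm N T"
proof (rule le_nuclear_norm[OF T])
  fix f y assume rep: "nuclear_rep X Y T f y"
  then have "0 \<le> (\<Sum>n. wt f y n)"
    using wt_nonneg by (intro suminf_nonneg) (auto simp: nuclear_rep_iff)
  then show "nrm (bounded_ops X Y) T \<le> (\<Sum>n. wt f y n)"
    using nuclear_rep_bound[OF rep] T by (intro opnorm_le[OF X Y]) (auto simp: op_range[OF X Y])
qed

lemma nuclear_rep_add:
  assumes T: "nuclear_rep X Y T f y" "bounded_op X Y T" and T': "nuclear_rep X Y T' f' y'" "bounded_op X Y T'"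
  shows "nuclear_rep X Y (T + T') (weave f f') (weave y y')"
    "(\<Sum>n. wt (weave f f') (weave y y') n) = (\<Sum>n. wt f y n) + (\<Sum>n. wt f' y' n)"
proof -
  have w: "(\<lambda>n. wt (weave f f') (weave y y') n) sums ((\<Sum>n. wt f y n) + (\<Sum>n. wt f' y' n))"
    unfolding weave_map2[where h = "\<lambda>f y. nrm (dual X) f * nrm Y y"]
    using T(1) T'(1) by (intro sums_weave summable_sums) (auto simp: nuclear_rep_iff)
  have y: "\<And>n. y n \<in> vecs Y" "\<And>n. y' n \<in> vecs Y" using T T' by (auto simp: nuclear_rep_iff)
  have "norm_limit Y (psum (weave f f') (weave y y') x) ((T + T') x)" if x: "x \<in> vecs X" for x
  proof -
    have "norm_limit Y (\<lambda>n. psum f y x ((n + 1) div 2)) (T x)"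
      using T(1) x by (intro norm_limit_compose[OF _ filterlim_half(2)]) (simp add: nuclear_rep_iff)
    moreover have "norm_limit Y (\<lambda>n. psum f' y' x (n div 2)) (T' x)"
      using T'(1) x by (intro norm_limit_compose[OF _ filterlim_half(1)]) (simp add: nuclear_rep_iff)
    ultimately have "norm_limit Y (\<lambda>n. psum f y x ((n + 1) div 2) + psum f' y' x (n div 2)) (T x + T' x)"
      using T(2) T'(2) y psum_mem op_range[OF X Y] by (intro norm_limit_add[OF Y]) auto
    moreover have "psum (weave f f') (weave y y') x
        = (\<lambda>n. psum f y x ((n + 1) div 2) + psum f' y' x (n div 2))"
      unfolding weave_map2[where h = "\<lambda>f y. scl Y (f x) y"] sum_weave ..
    ultimately show ?thesis by (simp add: plus_fun_def)
  qed
  then show "nuclear_rep X Y (T + T') (weave f f') (weave y y')"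
    using T(1) T'(1) sums_summable[OF w] unfolding nuclear_rep_iff by (auto simp: weave_def)
  show "(\<Sum>n. wt (weave f f') (weave y y') n) = (\<Sum>n. wt f y n) + (\<Sum>n. wt f' y' n)"
    using w by (rule sums_unique[symmetric])
qed

lemma nuclear_rep_scl:
  assumes T: "nuclear_rep X Y T f y" "bounded_op X Y T"
  shows "nuclear_rep X Y (scl N c T) (\<lambda>n. scl (dual X) c (f n)) y"
    "(\<Sum>n. wt (\<lambda>n. scl (dual X) c (f n)) y n) = norm c * (\<Sum>n. wt f y n)"
proof -
  note D = normed_dual[OF X]
  have f: "\<And>n. f n \<in> vecs (dual X)" and y: "\<And>n. y n \<in> vecs Y" and s: "summable (\<lambda>n. wt f y n)"
    using T(1) by (auto simp: nuclear_rep_iff)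
  have w: "wt (\<lambda>n. scl (dual X) c (f n)) y n = norm c * wt f y n" for n
    using nrm_scl[OF D f] by simp
  have "norm_limit Y (psum (\<lambda>n. scl (dual X) c (f n)) y x) (scl N c T x)" if x: "x \<in> vecs X" for x
  proof -
    have "psum (\<lambda>n. scl (dual X) c (f n)) y x = (\<lambda>n. scl Y c (psum f y x n))"
      by (simp add: scl_sum[OF Y] scl_simps[OF Y])
    then show ?thesis using norm_limit_scl[OF Y, of "psum f y x" "T x" c] T x psum_mem[where y = y, OF y] op_range[OF X Y T(2)]
      by (simp add: nuclear_rep_iff)
  qed
  then show "nuclear_rep X Y (scl N c T) (\<lambda>n. scl (dual X) c (f n)) y"
    using y scl_mem[OF D f] summable_mult[OF s, of "norm c"] unfolding nuclear_rep_iff w by simp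
  show "(\<Sum>n. wt (\<lambda>n. scl (dual X) c (f n)) y n) = norm c * (\<Sum>n. wt f y n)"
    unfolding w using s by (rule suminf_mult)
qed

lemma bounded_op_tensor:
  assumes f: "bounded_op X scalars f" and y: "y \<in> vecs Y"
  shows "bounded_op X Y (tensor Y f y)"
proof (rule bounded_opI[where C = "nrm (dual X) f * nrm Y y"])
  show "nrm Y (tensor Y f y x) \<le> nrm (dual X) f * nrm Y y * nrm X x" if "x \<in> vecs X" for x
    using mult_right_mono[OF functional_bound[OF X f that] nrm_nonneg[OF Y y]]
    by (simp add: tensor_def nrm_scl[OF Y y] mult_ac)
qed (simp_all add: tensor_def bounded_opD[OF f] scl_simps[OF Y] scl_mem[OF Y y])

lemma nuclear_rep_tensor:
  assumes f: "bounded_op X scalars f" and y: "y \<in> vecs Y"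
  shows "nuclear_rep X Y (tensor Y f y) (\<lambda>n. if n = 0 then f else 0) (\<lambda>n. y)"
    "(\<Sum>n. wt (\<lambda>n. if n = 0 then f else 0) (\<lambda>n. y) n) = nrm (dual X) f * nrm Y y"
proof -
  note D = normed_dual[OF X]
  have wt: "wt (\<lambda>n. if n = 0 then f else 0) (\<lambda>n. y) = (\<lambda>n. if n = 0 then nrm (dual X) f * nrm Y y else 0)"
    by (auto simp: nrm_0[OF D])
  have w: "wt (\<lambda>n. if n = 0 then f else 0) (\<lambda>n. y) sums (nrm (dual X) f * nrm Y y)"
    unfolding wt using sums_single[of 0 "\<lambda>_. nrm (dual X) f * nrm Y y"] by simp
  have p: "psum (\<lambda>n. if n = 0 then f else 0) (\<lambda>n. y) x n = tensor Y f y x" if "n > 0" for n x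
  proof -
    have "psum (\<lambda>n. if n = 0 then f else 0) (\<lambda>n. y) x n = (\<Sum>i<n. if i = 0 then tensor Y f y x else 0)"
      by (intro sum.cong) (auto simp: tensor_def scl_simps[OF Y])
    then show ?thesis using that by simp
  qed
  have "norm_limit Y (psum (\<lambda>n. if n = 0 then f else 0) (\<lambda>n. y) x) (tensor Y f y x)" for x
    unfolding norm_limit_def
    by (rule tendsto_eventually) (use p in \<open>auto simp: eventually_sequentially nrm_0[OF Y] intro: exI[of _ 1]\<close>)
  then show "nuclear_rep X Y (tensor Y f y) (\<lambda>n. if n = 0 then f else 0) (\<lambda>n. y)"
    using f y zero_mem[OF D] sums_summable[OF w] unfolding nuclear_rep_iff by auto
  show "(\<Sum>n. wt (\<lambda>n. if n = 0 then f else 0) (\<lambda>n. y) n) = nrm (dual X) f * nrm Y y"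
    using w by (rule sums_unique[symmetric])
qed

lemma tensor_mem: "\<lbrakk>bounded_op X scalars f; y \<in> vecs Y\<rbrakk> \<Longrightarrow> tensor Y f y \<in> vecs N"
  using bounded_op_tensor nuclear_rep_tensor(1) by fastforce

lemma normed_nuclear_ops: "normed_space N"
proof -
  note L = normed_bounded_ops[OF X Y]
  have v: "vector_space (scl N)" using L by (simp add: normed_space_def)
  have add: "S + T \<in> vecs N" "nrm N (S + T) \<le> nrm N S + nrm N T" if S: "S \<in> vecs N" and T: "T \<in> vecs N" for S T
  proof -
    have b: "bounded_op X Y S" "bounded_op X Y T" using S T by auto
    have "bounded_op X Y (S + T)" using add_mem[OF L, of S T] b by simp
    then show "S + T \<in> vecs N" using nuclear_rep_add(1) S T by fastforce
    have "nrm N (S + T) - (\<Sum>n. wt f y n) \<le> (\<Sum>n. wt f' y' n)"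
      if "nuclear_rep X Y S f y" "nuclear_rep X Y T f' y'" for f y f' y'
      using nuclear_norm_le[OF nuclear_rep_add(1)[OF that(1) b(1) that(2) b(2)]]
        nuclear_rep_add(2)[OF that(1) b(1) that(2) b(2)] by simp
    then have "nrm N (S + T) - (\<Sum>n. wt f y n) \<le> nrm N T" if "nuclear_rep X Y S f y" for f y
      using that by (intro le_nuclear_norm[OF T])
    then have "nrm N (S + T) - nrm N T \<le> nrm N S"
      by (intro le_nuclear_norm[OF S]) (simp add: diff_le_eq add.commute)
    then show "nrm N (S + T) \<le> nrm N S + nrm N T" by simp
  qed
  have nonneg: "0 \<le> nrm N T" if "T \<in> vecs N" for T
    using opnorm_le_nuclear_norm[OF that] opnorm_nonneg[OF X Y, of T] that by simp
  have scl: "scl N c T \<in> vecs N" "nrm N (scl N c T) \<le> norm c * nrm N T" if T: "T \<in> vecs N" for c T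
  proof -
    have b: "bounded_op X Y T" using T by auto
    have "bounded_op X Y (scl N c T)" using scl_mem[OF L, of T c] b by simp
    then show mem: "scl N c T \<in> vecs N" using nuclear_rep_scl(1) T by fastforce
    have le: "nrm N (scl N c T) \<le> norm c * (\<Sum>n. wt f y n)" if "nuclear_rep X Y T f y" for f y
      using nuclear_norm_le[OF nuclear_rep_scl(1)[OF that b]] nuclear_rep_scl(2)[OF that b] by metis
    show "nrm N (scl N c T) \<le> norm c * nrm N T"
    proof (cases "c = 0")
      case True
      obtain f y where "nuclear_rep X Y T f y" using T by auto
      then show ?thesis using le True by fastforce
    next
      case False
      then have "nrm N (scl N c T) / norm c \<le> nrm N T"
        using le by (intro le_nuclear_norm[OF T]) (simp add: field_simps)
      then show ?thesis using False by (simp add: field_simps)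
    qed
  qed
  have scl_eq: "nrm N (scl N c T) = norm c * nrm N T" if T: "T \<in> vecs N" for c T
  proof (cases "c = 0")
    case True
    then show ?thesis using scl(2)[OF T, of 0] nonneg[OF scl(1)[OF T, of 0]] by simp
  next
    case False
    have "nrm N T = nrm N (scl N (inverse c) (scl N c T))"
      using False by (simp add: scl_simps[OF Y])
    also have "\<dots> \<le> inverse (norm c) * nrm N (scl N c T)"
      using scl(2)[OF scl(1)[OF T, of c], of "inverse c"] by (simp only: norm_inverse)
    finally show ?thesis using scl(2)[OF T, of c] False by (simp add: field_simps)
  qed
  have zero: "0 \<in> vecs N"
  proof -
    have "0 = tensor Y (0 :: 'a \<Rightarrow> 'k) 0" by (simp add: tensor_def fun_eq_iff scl_simps[OF Y])
    then show ?thesis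
      using tensor_mem[of 0 0] zero_mem[OF normed_dual[OF X]] zero_mem[OF Y] by simp
  qed
  have eq0: "nrm N T = 0 \<longleftrightarrow> T = 0" if T: "T \<in> vecs N" for T
  proof
    assume "nrm N T = 0"
    then have "nrm (bounded_ops X Y) T = 0"
      using opnorm_le_nuclear_norm[OF T] opnorm_nonneg[OF X Y, of T] T by simp
    then show "T = 0" using nrm_eq_0[OF L, of T] T by simp
  next
    assume "T = 0"
    then have "T = scl N 0 T" by (simp add: fun_eq_iff scl_simps[OF Y])
    then show "nrm N T = 0" using scl_eq[OF T, of 0] by simp
  qed
  interpret vector_space "scl N" by (rule v)
  have "subspace (vecs N)" unfolding subspace_def using zero add(1) scl(1) by blast
  then show ?thesis unfolding normed_space_def using v nonneg eq0 add(2) scl_eq by blast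
qed

text \<open>The operator norm, which is already multiplicative on tensors, bounds the nuclear norm
  from below.\<close>

lemma nuclear_norm_tensor:
  assumes f: "bounded_op X scalars f" and y: "y \<in> vecs Y"
  shows "nrm N (tensor Y f y) = nrm (dual X) f * nrm Y y"
proof (rule order_antisym)
  show "nrm N (tensor Y f y) \<le> nrm (dual X) f * nrm Y y"
    using nuclear_norm_le[OF nuclear_rep_tensor(1)[OF f y]] nuclear_rep_tensor(2)[OF f y] by simp
  let ?M = "nrm (bounded_ops X Y) (tensor Y f y)"
  have "nrm (dual X) f * nrm Y y \<le> ?M"
  proof (cases "y = 0")
    case True
    then show ?thesis using opnorm_nonneg[OF X Y bounded_op_tensor[OF f y]] by (simp add: nrm_0[OF Y])
  next
    case False
    then have pos: "0 < nrm Y y" using nrm_nonneg[OF Y y] nrm_eq_0[OF Y y] by simp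
    have "nrm (dual X) f \<le> ?M / nrm Y y"
    proof (rule functional_norm_le[OF X])
      show "norm (f x) \<le> ?M / nrm Y y * nrm X x" if "x \<in> vecs X" for x
        using op_bound[OF X Y bounded_op_tensor[OF f y] that] pos
        by (simp add: tensor_def nrm_scl[OF Y y] field_simps)
    qed (use pos opnorm_nonneg[OF X Y bounded_op_tensor[OF f y]] in simp)
    then show ?thesis using pos by (simp add: field_simps)
  qed
  then show "nrm (dual X) f * nrm Y y \<le> nrm N (tensor Y f y)"
    using opnorm_le_nuclear_norm[OF tensor_mem[OF f y]] by simp
qed

text \<open>The remainders of a nuclear representation are nuclear representations of the remaining
  operators, so the series converges in the nuclear norm.\<close>

lemma functional_nuclear_rep_sums:
  assumes phi: "bounded_op N scalars \<phi>" and T: "bounded_op X Y T" and rep: "nuclear_rep X Y T f y"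
  shows "(\<lambda>n. \<phi> (tensor Y (f n) (y n))) sums \<phi> T"
proof -
  note NN = normed_nuclear_ops
  have f: "\<And>n. bounded_op X scalars (f n)" and y: "\<And>n. y n \<in> vecs Y" and s: "summable (\<lambda>n. wt f y n)"
    using rep by (auto simp: nuclear_rep_iff)
  let ?P = "\<lambda>n. \<Sum>i<n. tensor Y (f i) (y i)"
  have t: "tensor Y (f i) (y i) \<in> vecs N" for i by (rule tensor_mem[OF f y])
  have P: "?P n \<in> vecs N" for n using t by (rule sum_mem[OF NN])
  have TN: "T \<in> vecs N" using T rep by auto
  have apply_P: "?P n x = psum f y x n" for n x
    by (induction n) (simp_all add: tensor_def)
  have tail: "nrm N (T - ?P n) \<le> (\<Sum>i. wt f y (i + n))" for n
  proof -
    have "norm_limit Y (psum (\<lambda>i. f (i + n)) (\<lambda>i. y (i + n)) x) ((T - ?P n) x)" if x: "x \<in> vecs X" for x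
    proof -
      have "(\<lambda>m. nrm Y (T x - psum f y x (m + n))) \<longlonglongrightarrow> 0"
        using rep x LIMSEQ_ignore_initial_segment unfolding nuclear_rep_iff norm_limit_def by blast
      moreover have "psum f y x (m + n) = psum f y x n + psum (\<lambda>i. f (i + n)) (\<lambda>i. y (i + n)) x m" for m
        by (induction m) (simp_all add: add.assoc add.commute)
      ultimately show ?thesis
        by (simp only: norm_limit_def apply_P fun_diff_def diff_diff_add)
    qed
    then have "nuclear_rep X Y (T - ?P n) (\<lambda>i. f (i + n)) (\<lambda>i. y (i + n))"
      using f y summable_ignore_initial_segment[OF s] unfolding nuclear_rep_iff by simp
    from nuclear_norm_le[OF this] show ?thesis .
  qed
  have lim: "norm_limit N ?P T"
  proof (rule norm_limitI[OF NN _ TN P tail])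
    have "(\<Sum>i. wt f y (i + n)) = (\<Sum>i. wt f y i) - (\<Sum>i<n. wt f y i)" for n
      by (rule suminf_minus_initial_segment[OF s])
    moreover have "(\<lambda>n. (\<Sum>i. wt f y i) - (\<Sum>i<n. wt f y i)) \<longlonglongrightarrow> (\<Sum>i. wt f y i) - (\<Sum>i. wt f y i)"
      by (intro tendsto_intros summable_LIMSEQ[OF s])
    ultimately show "(\<lambda>n. \<Sum>i. wt f y (i + n)) \<longlonglongrightarrow> 0" by simp
  qed
  have "norm_limit scalars (\<lambda>n. \<phi> (?P n)) (\<phi> T)"
    by (rule norm_limit_op[OF NN normed_scalars phi lim P TN])
  then have "(\<lambda>n. \<phi> T - \<phi> (?P n)) \<longlonglongrightarrow> 0" by (simp add: norm_limit_def tendsto_norm_zero_iff)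
  then have "(\<lambda>n. \<phi> (?P n)) \<longlonglongrightarrow> \<phi> T" using tendsto_diff[OF tendsto_const[of "\<phi> T"]] by fastforce
  moreover have "\<phi> (?P n) = (\<Sum>i<n. \<phi> (tensor Y (f i) (y i)))" for n
    using t by (rule op_sum[OF NN normed_scalars phi])
  ultimately show ?thesis by (simp add: sums_def)
qed

text \<open>The sum on the left depends only on \<open>T\<close>: the value at \<open>T\<close> of the bounded functional
  \<open>G \<otimes> g\<close> is \<open>G (T\<^sup>* g)\<close>, whose definition involves the operator alone.\<close>

lemma elementary_functional:
  assumes G: "bounded_op (dual X) scalars G" and g: "bounded_op Y scalars g"
    and T: "bounded_op X Y T" and rep: "nuclear_rep X Y T f y"
  shows "(\<lambda>n. G (f n) * g (y n)) sums G (\<lambda>x. g (T x))"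
proof -
  note D = normed_dual[OF X]
  define \<phi> where "\<phi> = trunc N (\<lambda>T. G (\<lambda>x. g (T x)))"
  have adj: "bounded_op X scalars (\<lambda>x. g (T x))" "nrm (dual X) (\<lambda>x. g (T x)) \<le> nrm (dual Y) g * nrm N T"
    if T: "T \<in> vecs N" for T
  proof -
    show "bounded_op X scalars (\<lambda>x. g (T x))"
      using T bounded_op_comp(1)[OF X Y normed_scalars _ g] by simp
    have "nrm (dual X) (\<lambda>x. g (T x)) \<le> nrm (dual Y) g * nrm (bounded_ops X Y) T"
      using T bounded_op_comp(2)[OF X Y normed_scalars _ g] by (simp add: dual_def)
    also have "\<dots> \<le> nrm (dual Y) g * nrm N T"
      using opnorm_le_nuclear_norm[OF T] opnorm_nonneg[OF Y normed_scalars g]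
      by (intro mult_left_mono) (simp_all add: dual_def)
    finally show "nrm (dual X) (\<lambda>x. g (T x)) \<le> nrm (dual Y) g * nrm N T" .
  qed
  have "bounded_op N scalars \<phi>"
  proof (rule bounded_opI[where C = "nrm (dual (dual X)) G * nrm (dual Y) g"])
    fix S T assume S: "S \<in> vecs N" and T: "T \<in> vecs N"
    have "(\<lambda>x. g ((S + T) x)) = (\<lambda>x. g (S x)) + (\<lambda>x. g (T x))"
      using S T by (auto simp: fun_eq_iff bounded_opD[OF g] op_range[OF X Y])
    then show "\<phi> (S + T) = \<phi> S + \<phi> T"
      using S T adj add_mem[OF normed_nuclear_ops S T] bounded_opD(3)[OF G]
      by (simp add: \<phi>_def trunc_def del: nuclear_ops_simps)
  next
    fix c T assume T: "T \<in> vecs N"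
    have "(\<lambda>x. g (scl N c T x)) = scl (dual X) c (\<lambda>x. g (T x))"
      using T by (auto simp: fun_eq_iff bounded_opD[OF g] op_range[OF X Y])
    then show "\<phi> (scl N c T) = scl scalars c (\<phi> T)"
      using T adj(1)[OF T] scl_mem[OF normed_nuclear_ops T, of c] bounded_opD(4)[OF G, of "\<lambda>x. g (T x)" c]
      by (simp add: \<phi>_def trunc_def del: nuclear_ops_simps(1))
  next
    fix T assume T: "T \<in> vecs N"
    have "norm (\<phi> T) \<le> nrm (dual (dual X)) G * nrm (dual X) (\<lambda>x. g (T x))"
      using functional_bound[OF D G] adj(1)[OF T] T by (simp add: \<phi>_def trunc_def)
    also have "\<dots> \<le> nrm (dual (dual X)) G * (nrm (dual Y) g * nrm N T)"
      using adj(2)[OF T] opnorm_nonneg[OF D normed_scalars G] by (intro mult_left_mono) (simp_all add: dual_def)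
    finally show "nrm scalars (\<phi> T) \<le> nrm (dual (dual X)) G * nrm (dual Y) g * nrm N T"
      by (simp add: mult.assoc)
  qed (auto simp: \<phi>_def trunc_def)
  from functional_nuclear_rep_sums[OF this T rep]
  have "(\<lambda>n. \<phi> (tensor Y (f n) (y n))) sums \<phi> T" .
  moreover have "\<phi> (tensor Y (f n) (y n)) = G (f n) * g (y n)" for n
  proof -
    have f: "bounded_op X scalars (f n)" and y: "y n \<in> vecs Y" using rep by (auto simp: nuclear_rep_iff)
    have "(\<lambda>x. g (tensor Y (f n) (y n) x)) = scl (dual X) (g (y n)) (f n)"
      using bounded_opD(4)[OF g y] by (simp add: tensor_def fun_eq_iff mult.commute)
    then show ?thesis
      using tensor_mem[OF f y] f bounded_opD(4)[OF G, of "f n" "g (y n)"]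
      by (simp add: \<phi>_def trunc_def mult.commute del: nuclear_ops_simps)
  qed
  moreover have "\<phi> T = G (\<lambda>x. g (T x))" using T rep by (auto simp: \<phi>_def trunc_def)
  ultimately show ?thesis by simp
qed

end


section \<open>Operators on the space of nuclear operators\<close>

context
  fixes X :: "('k::real_or_complex, 'a::ab_group_add) nspace"
    and Y :: "('k, 'b::ab_group_add) nspace"
  assumes X: "normed_space X" and Y: "normed_space Y"
begin

text \<open>The nuclear norm is an infimum over representations, so it is estimated by transforming
  representations term by term.\<close>

lemma nuclear_norm_mono:
  assumes T: "T \<in> vecs (nuclear_ops X Y)" and M: "0 \<le> M"
    and ex: "\<And>f y. nuclear_rep X Y T f y \<Longrightarrow> \<exists>f' y'. nuclear_rep X Y T' f' y' \<and>
      (\<forall>n. nrm (dual X) (f' n) * nrm Y (y' n) \<le> M * (nrm (dual X) (f n) * nrm Y (y n)))"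
  shows "nrm (nuclear_ops X Y) T' \<le> M * nrm (nuclear_ops X Y) T"
proof -
  have le: "nrm (nuclear_ops X Y) T' \<le> M * (\<Sum>n. nrm (dual X) (f n) * nrm Y (y n))"
    if rep: "nuclear_rep X Y T f y" for f y
  proof -
    obtain f' y' where rep': "nuclear_rep X Y T' f' y'"
      and w: "\<And>n. nrm (dual X) (f' n) * nrm Y (y' n) \<le> M * (nrm (dual X) (f n) * nrm Y (y n))"
      using ex[OF rep] by blast
    have s: "summable (\<lambda>n. nrm (dual X) (f n) * nrm Y (y n))"
      "summable (\<lambda>n. nrm (dual X) (f' n) * nrm Y (y' n))"
      using rep rep' by (auto simp: nuclear_rep_iff[OF X Y])
    have "nrm (nuclear_ops X Y) T' \<le> (\<Sum>n. nrm (dual X) (f' n) * nrm Y (y' n))"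
      by (rule nuclear_norm_le[OF X Y rep'])
    also have "\<dots> \<le> (\<Sum>n. M * (nrm (dual X) (f n) * nrm Y (y n)))"
      using w s by (intro suminf_le summable_mult)
    finally show ?thesis using suminf_mult[OF s(1), of M] by simp
  qed
  show ?thesis
  proof (cases "M = 0")
    case True
    obtain f y where "nuclear_rep X Y T f y" using T by auto
    then show ?thesis using le True by fastforce
  next
    case False
    then have "nrm (nuclear_ops X Y) T' / M \<le> nrm (nuclear_ops X Y) T"
      using le M by (intro le_nuclear_norm[OF X Y T]) (simp add: field_simps)
    then show ?thesis using False M by (simp add: field_simps)
  qed
qed

lemma nuclear_rep_comp:
  assumes S: "bounded_op Y Y S" and rep: "nuclear_rep X Y T f y" and T: "bounded_op X Y T"
  shows "nuclear_rep X Y (\<lambda>x. S (T x)) f (\<lambda>n. S (y n))"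
    "nrm (dual X) (f n) * nrm Y (S (y n)) \<le> nrm (bounded_ops Y Y) S * (nrm (dual X) (f n) * nrm Y (y n))"
proof -
  have f: "\<And>n. bounded_op X scalars (f n)" and y: "\<And>n. y n \<in> vecs Y"
    and s: "summable (\<lambda>n. nrm (dual X) (f n) * nrm Y (y n))"
    using rep by (auto simp: nuclear_rep_iff[OF X Y])
  have f0: "0 \<le> nrm (dual X) (f n)" for n using nrm_nonneg[OF normed_dual[OF X]] f by simp
  show w: "nrm (dual X) (f n) * nrm Y (S (y n)) \<le> nrm (bounded_ops Y Y) S * (nrm (dual X) (f n) * nrm Y (y n))" for n
    using mult_left_mono[OF op_bound[OF Y Y S y[of n]] f0[of n]] by (simp add: mult_ac)
  have "norm_limit Y (\<lambda>n. \<Sum>i<n. scl Y (f i x) (S (y i))) (S (T x))" if x: "x \<in> vecs X" for x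
  proof -
    have "S (\<Sum>i<n. scl Y (f i x) (y i)) = (\<Sum>i<n. scl Y (f i x) (S (y i)))" for n
      using op_sum[OF Y Y S, of "{..<n}" "\<lambda>i. scl Y (f i x) (y i)"] y scl_mem[OF Y]
      by (simp add: bounded_opD[OF S])
    moreover have "norm_limit Y (\<lambda>n. S (\<Sum>i<n. scl Y (f i x) (y i))) (S (T x))"
      using rep x op_range[OF X Y T] psum_mem[OF X Y, where y = y, OF y]
      by (intro norm_limit_op[OF Y Y S]) (auto simp: nuclear_rep_iff[OF X Y])
    ultimately show ?thesis by simp
  qed
  moreover have "summable (\<lambda>n. nrm (dual X) (f n) * nrm Y (S (y n)))"
    by (rule summable_comparison_test'[OF summable_mult[OF s, of "nrm (bounded_ops Y Y) S"]])
      (use w f0 nrm_nonneg[OF Y op_range[OF Y Y S]] in simp)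
  ultimately show "nuclear_rep X Y (\<lambda>x. S (T x)) f (\<lambda>n. S (y n))"
    using f op_range[OF Y Y S] by (simp add: nuclear_rep_iff[OF X Y])
qed

text \<open>The operators \<open>S\<close> on \<open>Y\<close> act by \<open>T \<mapsto> S T\<close>. The norm of the action is seen on tensors
  \<open>f \<otimes> y\<close> with a fixed unit functional \<open>f\<close>.\<close>

theorem numerical_index_nuclear_ops_le_codomain:
  assumes nzX: "vecs X \<noteq> {0}" and nzY: "vecs Y \<noteq> {0}"
  shows "numerical_index (nuclear_ops X Y) \<le> numerical_index Y"
proof -
  let ?N = "nuclear_ops X Y"
  note D = normed_dual[OF X] and N = normed_nuclear_ops[OF X Y]
  define J where "J S = trunc ?N (\<lambda>T x. S (T x))" for S :: "'b \<Rightarrow> 'b"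
  have mem: "(\<lambda>x. S (T x)) \<in> vecs ?N" if "bounded_op Y Y S" "T \<in> vecs ?N" for S T
    using nuclear_rep_comp(1)[OF that(1)] bounded_op_comp(1)[OF X Y Y _ that(1)] that(2) by fastforce
  have le: "nrm ?N (\<lambda>x. S (T x)) \<le> nrm (bounded_ops Y Y) S * nrm ?N T"
    if S: "bounded_op Y Y S" and T: "T \<in> vecs ?N" for S T
  proof (rule nuclear_norm_mono[OF T opnorm_nonneg[OF Y Y S]])
    have b: "bounded_op X Y T" using T by simp
    show "\<exists>f' y'. nuclear_rep X Y (\<lambda>x. S (T x)) f' y' \<and> (\<forall>n. nrm (dual X) (f' n) * nrm Y (y' n)
        \<le> nrm (bounded_ops Y Y) S * (nrm (dual X) (f n) * nrm Y (y n)))"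
      if rep: "nuclear_rep X Y T f y" for f y
      using nuclear_rep_comp[OF S rep b] by blast
  qed
  have J: "bounded_op ?N ?N (J S)" if S: "bounded_op Y Y S" for S
  proof (rule bounded_opI[where C = "nrm (bounded_ops Y Y) S"])
    fix T T' assume T: "T \<in> vecs ?N" and T': "T' \<in> vecs ?N"
    then have "bounded_op X Y T" "bounded_op X Y T'" by auto
    then have "(\<lambda>x. S ((T + T') x)) = (\<lambda>x. S (T x)) + (\<lambda>x. S (T' x))"
      by (simp add: fun_eq_iff bounded_opD[OF S] op_range[OF X Y])
    then show "J S (T + T') = J S T + J S T'"
      using T T' add_mem[OF N T T'] unfolding J_def trunc_def by simp
  next
    fix c T assume T: "T \<in> vecs ?N"
    then have "bounded_op X Y T" by auto
    then have "(\<lambda>x. S (scl ?N c T x)) = scl ?N c (\<lambda>x. S (T x))"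
      by (simp add: fun_eq_iff bounded_opD[OF S] op_range[OF X Y])
    then show "J S (scl ?N c T) = scl ?N c (J S T)"
      using T scl_mem[OF N T, of c] unfolding J_def trunc_def by (simp del: nuclear_ops_simps)
  qed (use mem[OF S] le[OF S] in \<open>simp_all add: J_def trunc_def del: nuclear_ops_simps\<close>)
  have "nrm (bounded_ops ?N ?N) (J S) = nrm (bounded_ops Y Y) S" if S: "bounded_op Y Y S" for S
  proof (rule order_antisym)
    show "nrm (bounded_ops ?N ?N) (J S) \<le> nrm (bounded_ops Y Y) S"
      using le[OF S] opnorm_nonneg[OF Y Y S] by (intro opnorm_le[OF N N]) (simp_all add: J_def trunc_def)
    obtain f where f: "f \<in> vecs (dual X)" "nrm (dual X) f = 1"
      using ex_unit_vector[OF D dual_nonzero[OF X nzX]] .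
    show "nrm (bounded_ops Y Y) S \<le> nrm (bounded_ops ?N ?N) (J S)"
    proof (rule opnorm_le[OF Y Y])
      fix y assume y: "y \<in> vecs Y"
      have b: "bounded_op X scalars f" using f by simp
      have t: "tensor Y f y \<in> vecs ?N" by (rule tensor_mem[OF X Y b y])
      have "J S (tensor Y f y) = tensor Y f (S y)"
        using t y by (simp add: J_def trunc_def tensor_def bounded_opD[OF S] del: nuclear_ops_simps)
      then show "nrm Y (S y) \<le> nrm (bounded_ops ?N ?N) (J S) * nrm Y y"
        using op_bound[OF N N J[OF S] t] f(2) nuclear_norm_tensor[OF X Y b] y op_range[OF Y Y S] by simp
    qed (rule opnorm_nonneg[OF N N J[OF S]])
  qed
  moreover have "J (\<lambda>x. ident Y x + scl Y c (S x)) T = T + scl ?N c (J S T)"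
    if "T \<in> vecs ?N" for S c T
    using that op_range[OF X Y, of T] by (auto simp: J_def trunc_def ident_def fun_eq_iff)
  ultimately show ?thesis using J by (intro numerical_index_transfer[OF Y N nzY, where J = J]) blast+
qed

end

lemma bounded_op_eval:
  fixes X :: "('k::real_or_complex, 'a::ab_group_add) nspace"
  assumes X: "normed_space X" and x: "x \<in> vecs X"
  shows "bounded_op (dual X) scalars (trunc (dual X) (\<lambda>f. f x))"
proof (rule bounded_opI[where C = "nrm X x"])
  note D = normed_dual[OF X]
  show "trunc (dual X) (\<lambda>f. f x) (f + f') = trunc (dual X) (\<lambda>f. f x) f + trunc (dual X) (\<lambda>f. f x) f'"
    if "f \<in> vecs (dual X)" "f' \<in> vecs (dual X)" for f f'
    using that add_mem[OF D that] by (simp add: trunc_def)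
  show "trunc (dual X) (\<lambda>f. f x) (scl (dual X) c f) = scl scalars c (trunc (dual X) (\<lambda>f. f x) f)"
    if "f \<in> vecs (dual X)" for c f
    using that scl_mem[OF D that, of c] by (simp add: trunc_def)
  show "nrm scalars (trunc (dual X) (\<lambda>f. f x) f) \<le> nrm X x * nrm (dual X) f"
    if "f \<in> vecs (dual X)" for f
    using that functional_bound[OF X _ x] by (simp add: trunc_def mult.commute)
qed (auto simp: trunc_def)

text \<open>The partial sums at each point are Cauchy sequences because the weights are summable.\<close>

lemma ex_nuclear_op:
  fixes X :: "('k::real_or_complex, 'a::ab_group_add) nspace"
    and Y :: "('k, 'b::ab_group_add) nspace"
  assumes X: "normed_space X" and Y: "banach_space Y"
    and f: "\<And>n. bounded_op X scalars (f n)" and y: "\<And>n. y n \<in> vecs Y"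
    and s: "summable (\<lambda>n. nrm (dual X) (f n) * nrm Y (y n))"
  obtains T where "bounded_op X Y T" "nuclear_rep X Y T f y"
proof -
  note NY = banach_imp_normed[OF Y]
  interpret Metric_space "vecs Y" "ndist Y" by (rule Metric_space_ndist[OF NY])
  let ?p = "\<lambda>x n. \<Sum>i<n. scl Y (f i x) (y i)"
  have p: "?p x n \<in> vecs Y" for x n by (rule psum_mem[OF X NY y])
  have "\<exists>t\<in>vecs Y. norm_limit Y (?p x) t" if x: "x \<in> vecs X" for x
  proof -
    have "MCauchy (?p x)"
      unfolding MCauchy_def
    proof (intro conjI allI impI)
      fix e :: real assume e: "0 < e"
      have x0: "0 \<le> nrm X x" by (rule nrm_nonneg[OF X x])
      then have "0 < e / (nrm X x + 1)" using e by simp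
      then obtain N where N: "\<And>m n. N \<le> m \<Longrightarrow> norm (\<Sum>i=m..<n. nrm (dual X) (f i) * nrm Y (y i)) < e / (nrm X x + 1)"
        using s unfolding summable_Cauchy by blast
      have le: "nrm Y (?p x n - ?p x m) < e" if "N \<le> m" "m \<le> n" for m n
      proof -
        have "nrm Y (?p x n - ?p x m) \<le> (\<Sum>i=m..<n. nrm (dual X) (f i) * nrm Y (y i)) * nrm X x"
          by (rule psum_diff_bound[OF X NY f y x that(2)])
        also have "\<dots> \<le> e / (nrm X x + 1) * nrm X x"
          using N[OF that(1), of n] x0 by (intro mult_right_mono) auto
        also have "\<dots> < e" using e x0 by (simp add: field_simps)
        finally show ?thesis .
      qed
      have "ndist Y (?p x m) (?p x n) < e" if "N \<le> m" "N \<le> n" for m n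
      proof (cases "m \<le> n")
        case True
        then show ?thesis using le[of m n] that p nrm_minus_commute[OF NY p p, of x m x n]
          by (simp add: ndist_def)
      next
        case False
        then show ?thesis using le[of n m] that p by (simp add: ndist_def)
      qed
      then show "\<exists>N. \<forall>n n'. N \<le> n \<longrightarrow> N \<le> n' \<longrightarrow> ndist Y (?p x n) (?p x n') < e" by blast
    qed (use p in auto)
    then obtain t where t: "limitin mtopology (?p x) t sequentially"
      using Y unfolding banach_space_def mcomplete_def by blast
    then have tY: "t \<in> vecs Y" by (simp add: limit_metric_sequentially)
    have "norm_limit Y (?p x) t"
      unfolding norm_limit_def
    proof (rule LIMSEQ_I)
      fix r :: real assume "0 < r"
      then obtain N where "\<And>n. n \<ge> N \<Longrightarrow> ndist Y (?p x n) t < r"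
        using t unfolding limit_metric_sequentially by blast
      then have "norm (nrm Y (t - ?p x n) - 0) < r" if "n \<ge> N" for n
        using that p tY nrm_minus_commute[OF NY tY p, of x n] nrm_nonneg[OF NY diff_mem[OF NY tY p], of x n]
        by (simp add: ndist_def)
      then show "\<exists>N. \<forall>n\<ge>N. norm (nrm Y (t - ?p x n) - 0) < r" by blast
    qed
    with tY show ?thesis by blast
  qed
  then obtain t where t: "\<And>x. x \<in> vecs X \<Longrightarrow> t x \<in> vecs Y" "\<And>x. x \<in> vecs X \<Longrightarrow> norm_limit Y (?p x) (t x)"
    by metis
  define T where "T = trunc X t"
  have TY: "T x \<in> vecs Y" for x using t(1) zero_mem[OF NY] by (simp add: T_def trunc_def)
  have lim: "norm_limit Y (?p x) (T x)" if "x \<in> vecs X" for x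
    using t(2) that by (simp add: T_def trunc_def)
  then have rep: "nuclear_rep X Y T f y" using f y s by (simp add: nuclear_rep_iff[OF X NY])
  have "bounded_op X Y T"
  proof (rule bounded_opI)
    show "T x = 0" if "x \<notin> vecs X" for x using that by (simp add: T_def trunc_def)
    show "nrm Y (T x) \<le> (\<Sum>n. nrm (dual X) (f n) * nrm Y (y n)) * nrm X x" if "x \<in> vecs X" for x
      by (rule nuclear_rep_bound[OF X NY rep that TY])
    show "T (x + x') = T x + T x'" if x: "x \<in> vecs X" "x' \<in> vecs X" for x x'
    proof -
      have "?p (x + x') = (\<lambda>n. ?p x n + ?p x' n)"
        using x by (simp add: bounded_opD(3)[OF f] scl_simps[OF NY] sum.distrib)
      then show ?thesis
        using lim[OF add_mem[OF X x]] norm_limit_add[OF NY lim[OF x(1)] lim[OF x(2)] p TY p TY]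
        by (intro norm_limit_unique[OF NY, of "?p (x + x')"] p TY add_mem[OF NY]) auto
    qed
    show "T (scl X c x) = scl Y c (T x)" if x: "x \<in> vecs X" for c x
    proof -
      have "?p (scl X c x) = (\<lambda>n. scl Y c (?p x n))"
        using x by (simp add: bounded_opD(4)[OF f] scl_simps[OF NY] scl_sum[OF NY])
      then show ?thesis
        using lim[OF scl_mem[OF X x, of c]] norm_limit_scl[OF NY lim[OF x] p TY, of c]
        by (intro norm_limit_unique[OF NY, of "?p (scl X c x)"] p TY scl_mem[OF NY]) auto
    qed
  qed (rule TY)
  with rep show ?thesis using that by blast
qed

context
  fixes X :: "('k::real_or_complex, 'a::ab_group_add) nspace"
    and Y :: "('k, 'b::ab_group_add) nspace"
  assumes X: "normed_space X" and Y: "banach_space Y"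
begin

text \<open>\<open>T'\<close> is the operator \<open>\<Sum> S x\<^sub>n\<^sup>* \<otimes> y\<^sub>n\<close> if \<open>T = \<Sum> x\<^sub>n\<^sup>* \<otimes> y\<^sub>n\<close>. The description by adjoints,
  \<open>T'\<^sup>* = S T\<^sup>*\<close>, does not mention the representation, whence uniqueness and linearity.\<close>

definition adjoint_comp :: "(('a \<Rightarrow> 'k) \<Rightarrow> ('a \<Rightarrow> 'k)) \<Rightarrow> ('a \<Rightarrow> 'b) \<Rightarrow> ('a \<Rightarrow> 'b) \<Rightarrow> bool" where
  "adjoint_comp S T T' \<longleftrightarrow> T' \<in> vecs (nuclear_ops X Y) \<and>
     (\<forall>g. bounded_op Y scalars g \<longrightarrow> (\<lambda>x. g (T' x)) = S (\<lambda>x. g (T x)))"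

lemma adjoint_comp_unique:
  assumes T1: "adjoint_comp S T T1" and T2: "adjoint_comp S T T2"
  shows "T1 = T2"
proof
  fix x
  note NY = banach_imp_normed[OF Y]
  have m: "T1 x \<in> vecs Y" "T2 x \<in> vecs Y"
    using T1 T2 op_range[OF X NY] unfolding adjoint_comp_def by auto
  have "g (T1 x - T2 x) = 0" if g: "bounded_op Y scalars g" for g
    using T1 T2 g op_diff[OF NY normed_scalars g m] unfolding adjoint_comp_def by (metis diff_self)
  then show "T1 x = T2 x"
    using ex_separating_functional[OF NY diff_mem[OF NY m]] by (metis eq_iff_diff_eq_0)
qed

text \<open>Both sides of \<open>g (T' x) = S (T\<^sup>* g) x\<close> are values of elementary functionals: of
  \<open>ev\<^sub>x \<otimes> g\<close> at \<open>T'\<close>, and of \<open>(ev\<^sub>x \<circ> S) \<otimes> g\<close> at \<open>T\<close>, with the same series.\<close>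

lemma ex_adjoint_comp:
  assumes S: "bounded_op (dual X) (dual X) S" and T: "bounded_op X Y T" and rep: "nuclear_rep X Y T f y"
  obtains T' where "adjoint_comp S T T'" "nuclear_rep X Y T' (\<lambda>n. S (f n)) y"
    "\<And>n. nrm (dual X) (S (f n)) * nrm Y (y n)
      \<le> nrm (bounded_ops (dual X) (dual X)) S * (nrm (dual X) (f n) * nrm Y (y n))"
proof -
  note NY = banach_imp_normed[OF Y] and D = normed_dual[OF X]
  have f: "\<And>n. bounded_op X scalars (f n)" and y: "\<And>n. y n \<in> vecs Y"
    and s: "summable (\<lambda>n. nrm (dual X) (f n) * nrm Y (y n))"
    using rep by (auto simp: nuclear_rep_iff[OF X NY])
  have Sm: "bounded_op X scalars (S h)" for h using op_range[OF D D S, of h] by simp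
  have w: "nrm (dual X) (S (f n)) * nrm Y (y n)
      \<le> nrm (bounded_ops (dual X) (dual X)) S * (nrm (dual X) (f n) * nrm Y (y n))" for n
    using mult_right_mono[OF op_bound[OF D D S, of "f n"] nrm_nonneg[OF NY y[of n]]] f
    by (simp add: mult.assoc)
  have "summable (\<lambda>n. nrm (dual X) (S (f n)) * nrm Y (y n))"
    by (rule summable_comparison_test'[OF summable_mult[OF s, of "nrm (bounded_ops (dual X) (dual X)) S"]])
      (use w nrm_nonneg[OF D] nrm_nonneg[OF NY] Sm y in simp)
  then obtain T' where T': "bounded_op X Y T'" "nuclear_rep X Y T' (\<lambda>n. S (f n)) y"
    using ex_nuclear_op[OF X Y, of "\<lambda>n. S (f n)" y] Sm y by blast
  have "g (T' x) = S (\<lambda>x. g (T x)) x" if g: "bounded_op Y scalars g" for g x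
  proof (cases "x \<in> vecs X")
    case False
    then show ?thesis
      using bounded_opD(2)[OF Sm False] bounded_opD(2)[OF T'(1) False] op_0[OF NY normed_scalars g] by simp
  next
    case True
    note ev = bounded_op_eval[OF X True]
    note ev' = bounded_op_comp(1)[OF D D normed_scalars S ev]
    have c: "bounded_op X scalars (\<lambda>x. g (T' x))"
      by (rule bounded_op_comp(1)[OF X NY normed_scalars T'(1) g])
    have "(\<lambda>n. S (f n) x * g (y n)) sums g (T' x)"
      using elementary_functional[OF X NY ev g T'] Sm c by (simp add: trunc_def)
    moreover have "(\<lambda>n. S (f n) x * g (y n)) sums S (\<lambda>x. g (T x)) x"
      using elementary_functional[OF X NY ev' g T rep] Sm by (simp add: trunc_def)
    ultimately show ?thesis by (rule sums_unique2)
  qed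
  then have "adjoint_comp S T T'" using T' unfolding adjoint_comp_def by auto
  then show ?thesis using that T'(2) w by blast
qed

text \<open>The operators \<open>S\<close> on \<open>X\<^sup>*\<close> act by \<open>\<Sum> x\<^sub>n\<^sup>* \<otimes> y\<^sub>n \<mapsto> \<Sum> S x\<^sub>n\<^sup>* \<otimes> y\<^sub>n\<close>. The norm of the action
  is seen on tensors \<open>f \<otimes> y\<close> with a fixed unit vector \<open>y\<close>.\<close>

theorem numerical_index_nuclear_ops_le_dual_domain:
  assumes nzX: "vecs X \<noteq> {0}" and nzY: "vecs Y \<noteq> {0}"
  shows "numerical_index (nuclear_ops X Y) \<le> numerical_index (dual X)"
proof -
  let ?N = "nuclear_ops X Y" and ?L = "bounded_ops (dual X) (dual X)"
  note NY = banach_imp_normed[OF Y] and D = normed_dual[OF X]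
  note N = normed_nuclear_ops[OF X NY]
  define J where "J S = trunc ?N (\<lambda>T. THE T'. adjoint_comp S T T')" for S
  have J_eqI: "J S T = T'" if "T \<in> vecs ?N" "adjoint_comp S T T'" for S T T'
    using that adjoint_comp_unique unfolding J_def trunc_def by (auto intro!: the_equality)
  have J_comp: "adjoint_comp S T (J S T)" if S: "bounded_op (dual X) (dual X) S" and T: "T \<in> vecs ?N" for S T
  proof -
    obtain f y where "nuclear_rep X Y T f y" "bounded_op X Y T" using T by auto
    then obtain T' where "adjoint_comp S T T'" using ex_adjoint_comp[OF S] by metis
    then show ?thesis using J_eqI[OF T] by simp
  qed
  have mem: "J S T \<in> vecs ?N" if "bounded_op (dual X) (dual X) S" "T \<in> vecs ?N" for S T
    using J_comp[OF that] unfolding adjoint_comp_def by blast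
  have JD: "g (J S T x) = S (\<lambda>x. g (T x)) x"
    if "bounded_op (dual X) (dual X) S" "T \<in> vecs ?N" "bounded_op Y scalars g" for S T g x
    using J_comp[OF that(1,2)] that(3) unfolding adjoint_comp_def by metis
  have le: "nrm ?N (J S T) \<le> nrm ?L S * nrm ?N T"
    if S: "bounded_op (dual X) (dual X) S" and T: "T \<in> vecs ?N" for S T
  proof (rule nuclear_norm_mono[OF X NY T opnorm_nonneg[OF D D S]])
    fix f y assume rep: "nuclear_rep X Y T f y"
    have b: "bounded_op X Y T" using T by simp
    obtain T' where T': "adjoint_comp S T T'" "nuclear_rep X Y T' (\<lambda>n. S (f n)) y"
      "\<And>n. nrm (dual X) (S (f n)) * nrm Y (y n) \<le> nrm ?L S * (nrm (dual X) (f n) * nrm Y (y n))"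
      using ex_adjoint_comp[OF S b rep] by metis
    then show "\<exists>f' y'. nuclear_rep X Y (J S T) f' y' \<and> (\<forall>n. nrm (dual X) (f' n) * nrm Y (y' n)
        \<le> nrm ?L S * (nrm (dual X) (f n) * nrm Y (y n)))"
      using J_eqI[OF T T'(1)] by blast
  qed
  have adj: "bounded_op X scalars (\<lambda>x. g (T x))" if "bounded_op Y scalars g" "T \<in> vecs ?N" for g T
    using that bounded_op_comp(1)[OF X NY normed_scalars] by simp
  have J: "bounded_op ?N ?N (J S)" if S: "bounded_op (dual X) (dual X) S" for S
  proof (rule bounded_opI[where C = "nrm ?L S"])
    fix T T' assume T: "T \<in> vecs ?N" and T': "T' \<in> vecs ?N"
    show "J S (T + T') = J S T + J S T'"
    proof (rule J_eqI[OF add_mem[OF N T T']])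
      show "adjoint_comp S (T + T') (J S T + J S T')"
        unfolding adjoint_comp_def
      proof (intro conjI allI impI add_mem[OF N] mem[OF S] T T')
        fix g assume g: "bounded_op Y scalars g"
        have "(\<lambda>x. g ((T + T') x)) = (\<lambda>x. g (T x)) + (\<lambda>x. g (T' x))"
          using T T' by (auto simp: fun_eq_iff bounded_opD[OF g] op_range[OF X NY])
        then have "S (\<lambda>x. g ((T + T') x)) = S (\<lambda>x. g (T x)) + S (\<lambda>x. g (T' x))"
          using bounded_opD(3)[OF S, of "\<lambda>x. g (T x)" "\<lambda>x. g (T' x)"] adj[OF g] T T' by simp
        moreover have "g ((J S T + J S T') x) = g (J S T x) + g (J S T' x)" for x
          using mem[OF S T] mem[OF S T'] by (auto simp: bounded_opD[OF g] op_range[OF X NY])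
        ultimately show "(\<lambda>x. g ((J S T + J S T') x)) = S (\<lambda>x. g ((T + T') x))"
          using JD[OF S T g] JD[OF S T' g] by (simp add: fun_eq_iff)
      qed
    qed
  next
    fix c T assume T: "T \<in> vecs ?N"
    show "J S (scl ?N c T) = scl ?N c (J S T)"
    proof (rule J_eqI[OF scl_mem[OF N T]])
      show "adjoint_comp S (scl ?N c T) (scl ?N c (J S T))"
        unfolding adjoint_comp_def
      proof (intro conjI allI impI scl_mem[OF N] mem[OF S] T)
        fix g assume g: "bounded_op Y scalars g"
        have "(\<lambda>x. g (scl ?N c T x)) = scl (dual X) c (\<lambda>x. g (T x))"
          using T by (auto simp: fun_eq_iff bounded_opD[OF g] op_range[OF X NY])
        then have "S (\<lambda>x. g (scl ?N c T x)) = scl (dual X) c (S (\<lambda>x. g (T x)))"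
          using bounded_opD(4)[OF S, of "\<lambda>x. g (T x)" c] adj[OF g T] by simp
        moreover have "g (scl ?N c (J S T) x) = c * g (J S T x)" for x
          using mem[OF S T] by (auto simp: bounded_opD[OF g] op_range[OF X NY])
        ultimately show "(\<lambda>x. g (scl ?N c (J S T) x)) = S (\<lambda>x. g (scl ?N c T x))"
          using JD[OF S T g] by (simp add: fun_eq_iff)
      qed
    qed
  qed (use mem[OF S] le[OF S] in \<open>simp_all add: J_def trunc_def del: nuclear_ops_simps\<close>)
  have "nrm (bounded_ops ?N ?N) (J S) = nrm ?L S" if S: "bounded_op (dual X) (dual X) S" for S
  proof (rule order_antisym)
    show "nrm (bounded_ops ?N ?N) (J S) \<le> nrm ?L S"
      using le[OF S] by (intro opnorm_le[OF N N] opnorm_nonneg[OF D D S])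
    obtain y where y: "y \<in> vecs Y" "nrm Y y = 1" using ex_unit_vector[OF NY nzY] .
    show "nrm ?L S \<le> nrm (bounded_ops ?N ?N) (J S)"
    proof (rule opnorm_le[OF D D])
      fix f assume "f \<in> vecs (dual X)"
      then have f: "bounded_op X scalars f" by simp
      have Sf: "bounded_op X scalars (S f)" using op_range[OF D D S, of f] by simp
      have t: "tensor Y f y \<in> vecs ?N" by (rule tensor_mem[OF X NY f y(1)])
      have "J S (tensor Y f y) = tensor Y (S f) y"
      proof (rule J_eqI[OF t])
        have "(\<lambda>x. g (tensor Y (S f) y x)) = S (\<lambda>x. g (tensor Y f y x))" if g: "bounded_op Y scalars g" for g
        proof -
          have e: "(\<lambda>x. g (tensor Y h y x)) = scl (dual X) (g y) h" for h
            using bounded_opD(4)[OF g y(1)] by (simp add: tensor_def fun_eq_iff mult.commute)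
          show ?thesis using bounded_opD(4)[OF S, of f "g y"] f by (simp only: e) simp
        qed
        then show "adjoint_comp S (tensor Y f y) (tensor Y (S f) y)"
          unfolding adjoint_comp_def using tensor_mem[OF X NY Sf y(1)] by blast
      qed
      then show "nrm (dual X) (S f) \<le> nrm (bounded_ops ?N ?N) (J S) * nrm (dual X) f"
        using op_bound[OF N N J[OF S] t] y nuclear_norm_tensor[OF X NY f y(1)]
          nuclear_norm_tensor[OF X NY Sf y(1)] by simp
    qed (rule opnorm_nonneg[OF N N J[OF S]])
  qed
  moreover have "J (\<lambda>f. ident (dual X) f + scl (dual X) c (S f)) T = T + scl ?N c (J S T)"
    if S: "bounded_op (dual X) (dual X) S" and T: "T \<in> vecs ?N" for S c T
  proof (rule J_eqI[OF T])
    have "g ((T + scl ?N c (J S T)) x) = g (T x) + c * S (\<lambda>x. g (T x)) x" if g: "bounded_op Y scalars g" for g x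
      using T mem[OF S T] JD[OF S T g, of x] scl_mem[OF NY]
      by (auto simp: bounded_opD[OF g] op_range[OF X NY])
    then show "adjoint_comp (\<lambda>f. ident (dual X) f + scl (dual X) c (S f)) T (T + scl ?N c (J S T))"
      unfolding adjoint_comp_def using add_mem[OF N T scl_mem[OF N mem[OF S T]]] adj T
      by (auto simp: fun_eq_iff ident_def simp del: nuclear_ops_simps)
  qed
  ultimately show ?thesis
    using J by (intro numerical_index_transfer[OF D N dual_nonzero[OF X nzX], where J = J]) blast+
qed

end


section \<open>Bilinear forms as functionals on nuclear operators\<close>

text \<open>The value \<open>\<Sum> B(f\<^sub>n, y\<^sub>n)\<close> shared by all nuclear representations of \<open>T\<close>, where such a value
  exists.\<close>

definition nuclear_sum ::
    "('k::real_or_complex, 'a::ab_group_add) nspace \<Rightarrow> ('k, 'b::ab_group_add) nspace \<Rightarrow>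
     (('a \<Rightarrow> 'k) \<Rightarrow> 'b \<Rightarrow> 'k) \<Rightarrow> ('a \<Rightarrow> 'b) \<Rightarrow> 'k" where
  "nuclear_sum X Y B T = (THE s. \<forall>f y. nuclear_rep X Y T f y \<longrightarrow> (\<lambda>n. B (f n) (y n)) sums s)"

context
  fixes X :: "('k::real_or_complex, 'a::ab_group_add) nspace"
    and Y :: "('k, 'b::ab_group_add) nspace"
  assumes X: "normed_space X" and Y: "normed_space Y"
    and AP: "approximation_property (dual X) \<or> approximation_property Y"
begin

text \<open>A representation of the operator 0 is annihilated by all \<open>G \<otimes> g\<close>. If \<open>X\<^sup>*\<close> rather than
  \<open>Y\<close> has the approximation property, the two factors exchange their roles.\<close>

lemma nuclear_rep_zero_sum:
  assumes rep: "nuclear_rep X Y 0 f y" and B: "bilinear_form (dual X) Y B C"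
  shows "(\<Sum>n. B (f n) (y n)) = 0"
proof -
  note D = normed_dual[OF X]
  have f: "\<And>n. f n \<in> vecs (dual X)" and y: "\<And>n. y n \<in> vecs Y"
    and s: "summable (\<lambda>n. nrm (dual X) (f n) * nrm Y (y n))"
    using rep by (auto simp: nuclear_rep_iff[OF X Y])
  have zero: "(\<Sum>n. G (f n) * g (y n)) = 0"
    if G: "bounded_op (dual X) scalars G" and g: "bounded_op Y scalars g" for G g
  proof -
    have "bounded_op X Y 0" using zero_mem[OF normed_bounded_ops[OF X Y]] by simp
    from sums_unique[OF elementary_functional[OF X Y G g this rep]]
    show ?thesis
      using op_0[OF D normed_scalars G] op_0[OF Y normed_scalars g] by (simp add: zero_fun_def)
  qed
  from AP show ?thesis
  proof
    assume "approximation_property Y"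
    then show ?thesis using zero by (intro approximation_property_separates[OF D Y _ f y s _ B])
  next
    assume AD: "approximation_property (dual X)"
    have s': "summable (\<lambda>n. nrm Y (y n) * nrm (dual X) (f n))" using s by (simp only: mult.commute)
    have "(\<Sum>n. g (y n) * G (f n)) = 0"
      if "bounded_op Y scalars g" "bounded_op (dual X) scalars G" for G g
      using zero[OF that(2,1)] by (simp only: mult.commute)
    then show ?thesis
      by (intro approximation_property_separates[OF Y D AD y f s' _ bilinear_form_swap[OF B]])
  qed
qed

lemma weave_form_sums:
  fixes B :: "('a \<Rightarrow> 'k) \<Rightarrow> 'b \<Rightarrow> 'k"
  assumes "(\<lambda>n. B (f n) (y n)) sums s" "(\<lambda>n. B (f' n) (y' n)) sums s'"
  shows "(\<lambda>n. B (weave f f' n) (weave y y' n)) sums (s + s')"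
  unfolding weave_map2[where h = B] by (rule sums_weave[OF assms])

lemma nuclear_form_summable:
  assumes "nuclear_rep X Y T f y" "bilinear_form (dual X) Y B C"
  shows "summable (\<lambda>n. B (f n) (y n))"
    "norm (\<Sum>n. B (f n) (y n)) \<le> C * (\<Sum>n. nrm (dual X) (f n) * nrm Y (y n))"
  using bilinear_form_summable(2,3)[OF assms(2), of f y] assms(1)
  by (auto simp: nuclear_rep_iff[OF X Y])

text \<open>Under the approximation property every bounded bilinear form induces a functional on the
  nuclear operators: two representations of \<open>T\<close> combine to one of \<open>T - T = 0\<close>.\<close>

lemma nuclear_sum_sums:
  assumes T: "bounded_op X Y T" and rep: "nuclear_rep X Y T f y" and B: "bilinear_form (dual X) Y B C"
  shows "(\<lambda>n. B (f n) (y n)) sums nuclear_sum X Y B T"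
proof -
  have eq: "(\<Sum>n. B (f n) (y n)) = (\<Sum>n. B (f' n) (y' n))" if rep': "nuclear_rep X Y T f' y'" for f' y'
  proof -
    let ?g = "\<lambda>n. scl (dual X) (- 1) (f' n)"
    have L: "normed_space (bounded_ops X Y)" by (rule normed_bounded_ops[OF X Y])
    have m: "bounded_op X Y (scl (nuclear_ops X Y) (- 1) T)"
      using scl_mem[OF L, of T "- 1"] T by simp
    have "T + scl (nuclear_ops X Y) (- 1) T = 0" by (simp add: fun_eq_iff scl_simps[OF Y])
    then have rep0: "nuclear_rep X Y 0 (weave f ?g) (weave y y')"
      using nuclear_rep_add(1)[OF X Y rep T nuclear_rep_scl(1)[OF X Y rep' T, of "- 1"] m] by simp
    have "(\<lambda>n. - B (f' n) (y' n)) sums - (\<Sum>n. B (f' n) (y' n))"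
      by (intro sums_minus summable_sums nuclear_form_summable(1)[OF rep' B])
    moreover have "B (?g n) (y' n) = - B (f' n) (y' n)" for n
      using bilinear_formD(4)[OF B, of "f' n" "y' n" "- 1"] rep' by (simp add: nuclear_rep_iff[OF X Y])
    ultimately have "(\<lambda>n. B (?g n) (y' n)) sums - (\<Sum>n. B (f' n) (y' n))" by (simp only:)
    then have "(\<lambda>n. B (weave f ?g n) (weave y y' n)) sums ((\<Sum>n. B (f n) (y n)) + - (\<Sum>n. B (f' n) (y' n)))"
      by (intro weave_form_sums summable_sums nuclear_form_summable(1)[OF rep B])
    then show ?thesis using nuclear_rep_zero_sum[OF rep0 B] sums_unique by fastforce
  qed
  have all: "(\<lambda>n. B (f' n) (y' n)) sums (\<Sum>n. B (f n) (y n))" if rep': "nuclear_rep X Y T f' y'" for f' y'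
    using summable_sums[OF nuclear_form_summable(1)[OF rep' B]] eq[OF rep'] by simp
  have "nuclear_sum X Y B T = (\<Sum>n. B (f n) (y n))"
    unfolding nuclear_sum_def
  proof (rule the_equality)
    show "s = (\<Sum>n. B (f n) (y n))" if "\<forall>f y. nuclear_rep X Y T f y \<longrightarrow> (\<lambda>n. B (f n) (y n)) sums s" for s
      using that rep sums_unique by blast
  qed (use all in blast)
  then show ?thesis using all[OF rep] by simp
qed

lemma nuclear_sum_tensor:
  assumes f: "bounded_op X scalars f" and y: "y \<in> vecs Y" and B: "bilinear_form (dual X) Y B C"
  shows "nuclear_sum X Y B (tensor Y f y) = B f y"
proof -
  have "B 0 y = 0" using bilinear_formD(4)[OF B, of f y 0] f y by (simp add: zero_fun_def)
  then have "(\<lambda>n::nat. B (if n = 0 then f else 0) y) = (\<lambda>n. if n = 0 then B f y else 0)" by auto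
  moreover have "(\<lambda>n. if n = 0 then B f y else 0) sums B f y"
    using sums_single[of 0 "\<lambda>_. B f y"] by simp
  ultimately have "(\<lambda>n. B (if n = 0 then f else 0) y) sums B f y" by (simp only:)
  from sums_unique2[OF nuclear_sum_sums[OF bounded_op_tensor[OF X Y f y] nuclear_rep_tensor(1)[OF X Y f y] B] this]
  show ?thesis .
qed

lemma bounded_op_nuclear_sum:
  assumes B: "bilinear_form (dual X) Y B C"
  shows "bounded_op (nuclear_ops X Y) scalars (trunc (nuclear_ops X Y) (nuclear_sum X Y B))"
    "nrm (dual (nuclear_ops X Y)) (trunc (nuclear_ops X Y) (nuclear_sum X Y B)) \<le> C"
proof -
  let ?N = "nuclear_ops X Y"
  note N = normed_nuclear_ops[OF X Y]
  have C: "0 \<le> C" by (rule bilinear_formD(1)[OF B])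
  have b: "norm (nuclear_sum X Y B T) \<le> C * nrm ?N T" if T: "T \<in> vecs ?N" for T
  proof -
    have le: "norm (nuclear_sum X Y B T) \<le> C * (\<Sum>n. nrm (dual X) (f n) * nrm Y (y n))"
      if rep: "nuclear_rep X Y T f y" for f y
      using nuclear_form_summable(2)[OF rep B] sums_unique[OF nuclear_sum_sums[OF _ rep B]] T by simp
    show ?thesis
    proof (cases "C = 0")
      case True
      then show ?thesis using le T by auto
    next
      case False
      then have "norm (nuclear_sum X Y B T) / C \<le> nrm ?N T"
        using le C by (intro le_nuclear_norm[OF X Y T]) (simp add: field_simps)
      then show ?thesis using False C by (simp add: field_simps)
    qed
  qed
  show "bounded_op ?N scalars (trunc ?N (nuclear_sum X Y B))"
  proof (rule bounded_opI[where C = C])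
    fix S T assume S: "S \<in> vecs ?N" and T: "T \<in> vecs ?N"
    then obtain f y f' y' where rep: "nuclear_rep X Y S f y" "nuclear_rep X Y T f' y'" by auto
    have ST: "bounded_op X Y S" "bounded_op X Y T" "bounded_op X Y (S + T)"
      using S T add_mem[OF N S T] by auto
    note w = weave_form_sums[where B = B, OF nuclear_sum_sums[OF ST(1) rep(1) B] nuclear_sum_sums[OF ST(2) rep(2) B]]
    have "nuclear_sum X Y B (S + T) = nuclear_sum X Y B S + nuclear_sum X Y B T"
      using sums_unique2[OF nuclear_sum_sums[OF ST(3) nuclear_rep_add(1)[OF X Y rep(1) ST(1) rep(2) ST(2)] B] w] .
    then show "trunc ?N (nuclear_sum X Y B) (S + T) = trunc ?N (nuclear_sum X Y B) S + trunc ?N (nuclear_sum X Y B) T"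
      using S T add_mem[OF N S T] unfolding trunc_def by simp
  next
    fix c T assume T: "T \<in> vecs ?N"
    then obtain f y where rep: "nuclear_rep X Y T f y" by auto
    have bT: "bounded_op X Y T" "bounded_op X Y (scl ?N c T)" using T scl_mem[OF N T, of c] by auto
    have "B (scl (dual X) c (f n)) (y n) = c * B (f n) (y n)" for n
      using bilinear_formD(4)[OF B, of "f n" "y n"] rep by (simp add: nuclear_rep_iff[OF X Y])
    then have "(\<lambda>n. c * B (f n) (y n)) sums nuclear_sum X Y B (scl ?N c T)"
      using nuclear_sum_sums[OF bT(2) nuclear_rep_scl(1)[OF X Y rep bT(1), of c] B] by (simp only:)
    from sums_unique2[OF this sums_mult[OF nuclear_sum_sums[OF bT(1) rep B]]]
    show "trunc ?N (nuclear_sum X Y B) (scl ?N c T) = scl scalars c (trunc ?N (nuclear_sum X Y B) T)"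
      using T scl_mem[OF N T, of c] unfolding trunc_def by simp
  qed (use b in \<open>simp_all add: trunc_def del: nuclear_ops_simps\<close>)
  show "nrm (dual ?N) (trunc ?N (nuclear_sum X Y B)) \<le> C"
    using b C by (intro functional_norm_le[OF N]) (simp_all add: trunc_def del: nuclear_ops_simps)
qed

lemma bilinear_form_of_functional:
  assumes phi: "bounded_op (nuclear_ops X Y) scalars \<phi>"
  shows "bilinear_form (dual X) Y (\<lambda>f y. \<phi> (tensor Y f y)) (nrm (dual (nuclear_ops X Y)) \<phi>)"
proof -
  let ?N = "nuclear_ops X Y"
  note N = normed_nuclear_ops[OF X Y] and D = normed_dual[OF X]
  note t = tensor_mem[OF X Y]
  have "tensor Y (f + f') y = tensor Y f y + tensor Y f' y" "tensor Y f (y + y') = tensor Y f y + tensor Y f y'"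
    "tensor Y (scl (dual X) c f) y = scl ?N c (tensor Y f y)" "tensor Y f (scl Y c y) = scl ?N c (tensor Y f y)"
    for f f' :: "'a \<Rightarrow> 'k" and y y' c
    by (simp_all add: tensor_def fun_eq_iff scl_simps[OF Y] mult.commute)
  moreover have "norm (\<phi> (tensor Y f y)) \<le> nrm (dual ?N) \<phi> * (nrm (dual X) f * nrm Y y)"
    if "f \<in> vecs (dual X)" "y \<in> vecs Y" for f y
    using functional_bound[OF N phi t] nuclear_norm_tensor[OF X Y] that by fastforce
  moreover have "0 \<le> nrm (dual ?N) \<phi>" using nrm_nonneg[OF normed_dual[OF N]] phi by simp
  ultimately show ?thesis
    unfolding bilinear_form_def using bounded_opD(3,4)[OF phi] t
    by (simp del: nuclear_ops_simps(2) dual_simps(2))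
qed

text \<open>The functionals on nuclear operators are thus the bounded bilinear forms on the pair of
  \<open>X\<^sup>*\<close> and \<open>Y\<close>, so any isometric action of \<open>L(W)\<close> on these forms bounds the numerical index
  from above by that of \<open>W\<close>. The last assumption says that the norm of \<open>S\<close> is detected on forms
  \<open>G \<otimes> g\<close>. Such a form comes with its action as the form of a functional on \<open>N(X,Y)\<close>, which agrees
  with the product \<open>G f * g y\<close> only for arguments in \<open>X\<^sup>*\<close> and \<open>Y\<close>, hence the existential
  quantifier.\<close>

lemma numerical_index_dual_nuclear_ops_le:
  fixes W :: "('k, 'w::ab_group_add) nspace"
    and act :: "('w \<Rightarrow> 'w) \<Rightarrow> (('a \<Rightarrow> 'k) \<Rightarrow> 'b \<Rightarrow> 'k) \<Rightarrow> ('a \<Rightarrow> 'k) \<Rightarrow> 'b \<Rightarrow> 'k"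
  assumes W: "normed_space W" "vecs W \<noteq> {0}"
    and form: "\<And>S B C. \<lbrakk>bounded_op W W S; bilinear_form (dual X) Y B C\<rbrakk>
      \<Longrightarrow> bilinear_form (dual X) Y (act S B) (nrm (bounded_ops W W) S * C)"
    and add: "\<And>S B B' C C' f y. \<lbrakk>bounded_op W W S; bilinear_form (dual X) Y B C; bilinear_form (dual X) Y B' C';
        bounded_op X scalars f; y \<in> vecs Y\<rbrakk> \<Longrightarrow> act S (\<lambda>f y. B f y + B' f y) f y = act S B f y + act S B' f y"
    and scl: "\<And>S B C c f y. \<lbrakk>bounded_op W W S; bilinear_form (dual X) Y B C; bounded_op X scalars f; y \<in> vecs Y\<rbrakk>
      \<Longrightarrow> act S (\<lambda>f y. c * B f y) f y = c * act S B f y"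
    and affine: "\<And>S B C c f y. \<lbrakk>bounded_op W W S; bilinear_form (dual X) Y B C; bounded_op X scalars f; y \<in> vecs Y\<rbrakk>
      \<Longrightarrow> act (\<lambda>x. ident W x + scl W c (S x)) B f y = B f y + c * act S B f y"
    and lower: "\<And>S M. \<lbrakk>bounded_op W W S; 0 \<le> M;
      \<And>G g f y. \<lbrakk>bounded_op (dual X) scalars G; bounded_op Y scalars g; bounded_op X scalars f; y \<in> vecs Y\<rbrakk>
        \<Longrightarrow> \<exists>B. (\<forall>f y. bounded_op X scalars f \<longrightarrow> y \<in> vecs Y \<longrightarrow> B f y = G f * g y) \<and>
          norm (act S B f y) \<le> M * (nrm (dual (dual X)) G * nrm (dual Y) g) * (nrm (dual X) f * nrm Y y)\<rbrakk>
      \<Longrightarrow> nrm (bounded_ops W W) S \<le> M"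
  shows "numerical_index (dual (nuclear_ops X Y)) \<le> numerical_index W"
proof -
  let ?N = "nuclear_ops X Y" and ?L = "bounded_ops W W"
  let ?E = "bounded_ops (dual ?N) (dual ?N)"
  note N = normed_nuclear_ops[OF X Y] and D = normed_dual[OF X]
  note DN = normed_dual[OF N]
  define bil where "bil \<phi> f y = \<phi> (tensor Y f y)" for \<phi> :: "('a \<Rightarrow> 'b) \<Rightarrow> 'k" and f y
  have bil: "bilinear_form (dual X) Y (bil \<phi>) (nrm (dual ?N) \<phi>)" if "bounded_op ?N scalars \<phi>" for \<phi>
    using bilinear_form_of_functional[OF that] unfolding bil_def .
  define J where "J S = trunc (dual ?N) (\<lambda>\<phi>. trunc ?N (nuclear_sum X Y (act S (bil \<phi>))))" for S
  note actbil = form[OF _ bil]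
  have JN: "bounded_op ?N scalars (J S \<phi>)" "nrm (dual ?N) (J S \<phi>) \<le> nrm ?L S * nrm (dual ?N) \<phi>"
    if "bounded_op W W S" "bounded_op ?N scalars \<phi>" for S \<phi>
    using bounded_op_nuclear_sum[OF actbil[OF that]] that by (simp_all add: J_def trunc_def)
  have J_sums: "(\<lambda>n. act S (bil \<phi>) (f n) (y n)) sums J S \<phi> T"
    if "bounded_op W W S" "bounded_op ?N scalars \<phi>" "bounded_op X Y T" "nuclear_rep X Y T f y" for S \<phi> T f y
  proof -
    have "T \<in> vecs ?N" using that by auto
    then have "J S \<phi> T = nuclear_sum X Y (act S (bil \<phi>)) T" using that by (simp add: J_def trunc_def)
    then show ?thesis using nuclear_sum_sums[OF that(3,4) actbil[OF that(1,2)]] by simp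
  qed
  have eqI: "\<phi> = \<psi>" if \<phi>: "bounded_op ?N scalars \<phi>" and \<psi>: "bounded_op ?N scalars \<psi>"
    and eq: "\<And>T f y. \<lbrakk>bounded_op X Y T; nuclear_rep X Y T f y; \<And>n. bounded_op X scalars (f n); \<And>n. y n \<in> vecs Y\<rbrakk>
      \<Longrightarrow> \<phi> T = \<psi> T" for \<phi> \<psi>
  proof
    fix T show "\<phi> T = \<psi> T"
    proof (cases "T \<in> vecs ?N")
      case True
      then obtain f y where "bounded_op X Y T" "nuclear_rep X Y T f y" by auto
      then show ?thesis using eq by (auto simp: nuclear_rep_iff[OF X Y])
    qed (use \<phi> \<psi> bounded_opD(2) in metis)
  qed
  have J: "bounded_op (dual ?N) (dual ?N) (J S)" if S: "bounded_op W W S" for S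
  proof (rule bounded_opI[where C = "nrm ?L S"])
    fix \<phi> \<psi> assume "\<phi> \<in> vecs (dual ?N)" "\<psi> \<in> vecs (dual ?N)"
    then have \<phi>: "bounded_op ?N scalars \<phi>" and \<psi>: "bounded_op ?N scalars \<psi>" by auto
    have s: "bounded_op ?N scalars (\<phi> + \<psi>)" using add_mem[OF DN, of \<phi> \<psi>] \<phi> \<psi> by simp
    have js: "bounded_op ?N scalars (J S \<phi> + J S \<psi>)"
      using add_mem[OF DN, of "J S \<phi>" "J S \<psi>"] JN(1)[OF S] \<phi> \<psi> by simp
    show "J S (\<phi> + \<psi>) = J S \<phi> + J S \<psi>"
    proof (rule eqI[OF JN(1)[OF S s] js])
      fix T f y assume T: "bounded_op X Y T" "nuclear_rep X Y T f y"
        and fy: "\<And>n. bounded_op X scalars (f n)" "\<And>n. y n \<in> vecs Y"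
      have "act S (bil (\<phi> + \<psi>)) (f n) (y n) = act S (bil \<phi>) (f n) (y n) + act S (bil \<psi>) (f n) (y n)" for n
        using add[OF S bil[OF \<phi>] bil[OF \<psi>] fy(1)[of n] fy(2)[of n]] by (simp add: bil_def[abs_def])
      then show "J S (\<phi> + \<psi>) T = (J S \<phi> + J S \<psi>) T"
        using sums_unique2[OF J_sums[OF S s T]] sums_add[OF J_sums[OF S \<phi> T] J_sums[OF S \<psi> T]] by simp
    qed
  next
    fix c \<phi> assume "\<phi> \<in> vecs (dual ?N)"
    then have \<phi>: "bounded_op ?N scalars \<phi>" by auto
    have s: "bounded_op ?N scalars (scl (dual ?N) c \<phi>)" using scl_mem[OF DN, of \<phi> c] \<phi> by simp
    have js: "bounded_op ?N scalars (scl (dual ?N) c (J S \<phi>))"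
      using scl_mem[OF DN, of "J S \<phi>" c] JN(1)[OF S \<phi>] by simp
    show "J S (scl (dual ?N) c \<phi>) = scl (dual ?N) c (J S \<phi>)"
    proof (rule eqI[OF JN(1)[OF S s] js])
      fix T f y assume T: "bounded_op X Y T" "nuclear_rep X Y T f y"
        and fy: "\<And>n. bounded_op X scalars (f n)" "\<And>n. y n \<in> vecs Y"
      have "act S (bil (scl (dual ?N) c \<phi>)) (f n) (y n) = c * act S (bil \<phi>) (f n) (y n)" for n
        using scl[OF S bil[OF \<phi>] fy(1)[of n] fy(2)[of n], of c] by (simp add: bil_def[abs_def])
      then show "J S (scl (dual ?N) c \<phi>) T = scl (dual ?N) c (J S \<phi>) T"
        using sums_unique2[OF J_sums[OF S s T]] sums_mult[OF J_sums[OF S \<phi> T], of c] by simp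
    qed
  qed (use JN S in \<open>auto simp: J_def trunc_def\<close>)
  have "nrm ?E (J S) = nrm ?L S" if S: "bounded_op W W S" for S
  proof (rule order_antisym)
    show "nrm ?E (J S) \<le> nrm ?L S"
      using JN(2)[OF S] by (intro opnorm_le[OF DN DN] opnorm_nonneg[OF W(1) W(1) S]) simp
    have M0: "0 \<le> nrm ?E (J S)" by (rule opnorm_nonneg[OF DN DN J[OF S]])
    show "nrm ?L S \<le> nrm ?E (J S)"
    proof (rule lower[OF S M0])
      fix G g f y
      assume G: "bounded_op (dual X) scalars G" and g: "bounded_op Y scalars g"
        and f: "bounded_op X scalars f" and y: "y \<in> vecs Y"
      define \<phi> where "\<phi> = trunc ?N (nuclear_sum X Y (\<lambda>f y. G f * g y))"
      note B = bilinear_form_tensor[OF D Y G g]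
      have \<phi>: "bounded_op ?N scalars \<phi>" "nrm (dual ?N) \<phi> \<le> nrm (dual (dual X)) G * nrm (dual Y) g"
        unfolding \<phi>_def using bounded_op_nuclear_sum[OF B] by auto
      have t: "tensor Y f y \<in> vecs ?N" by (rule tensor_mem[OF X Y f y])
      have "bil \<phi> f y = G f * g y" if "bounded_op X scalars f" "y \<in> vecs Y" for f y
        using tensor_mem[OF X Y that] nuclear_sum_tensor[OF that B]
        by (simp add: bil_def \<phi>_def trunc_def del: nuclear_ops_simps)
      moreover have "norm (act S (bil \<phi>) f y)
          \<le> nrm ?E (J S) * (nrm (dual (dual X)) G * nrm (dual Y) g) * (nrm (dual X) f * nrm Y y)"
      proof -
        have "act S (bil \<phi>) f y = J S \<phi> (tensor Y f y)"
          using t \<phi>(1) nuclear_sum_tensor[OF f y actbil[OF S \<phi>(1)]]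
          by (simp add: J_def trunc_def del: nuclear_ops_simps)
        also have "norm \<dots> \<le> nrm (dual ?N) (J S \<phi>) * (nrm (dual X) f * nrm Y y)"
          using functional_bound[OF N JN(1)[OF S \<phi>(1)] t] by (simp add: nuclear_norm_tensor[OF X Y f y])
        also have "\<dots> \<le> nrm ?E (J S) * (nrm (dual (dual X)) G * nrm (dual Y) g) * (nrm (dual X) f * nrm Y y)"
        proof (rule mult_right_mono)
          have "nrm (dual ?N) (J S \<phi>) \<le> nrm ?E (J S) * nrm (dual ?N) \<phi>"
            using op_bound[OF DN DN J[OF S]] \<phi>(1) by simp
          also have "\<dots> \<le> nrm ?E (J S) * (nrm (dual (dual X)) G * nrm (dual Y) g)"
            by (rule mult_left_mono[OF \<phi>(2) M0])
          finally show "nrm (dual ?N) (J S \<phi>) \<le> nrm ?E (J S) * (nrm (dual (dual X)) G * nrm (dual Y) g)" .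
          show "0 \<le> nrm (dual X) f * nrm Y y"
            using nrm_nonneg[OF D, of f] nrm_nonneg[OF Y y] f by simp
        qed
        finally show ?thesis .
      qed
      ultimately show "\<exists>B. (\<forall>f y. bounded_op X scalars f \<longrightarrow> y \<in> vecs Y \<longrightarrow> B f y = G f * g y) \<and>
          norm (act S B f y) \<le> nrm ?E (J S) * (nrm (dual (dual X)) G * nrm (dual Y) g) * (nrm (dual X) f * nrm Y y)"
        by blast
    qed
  qed
  moreover have "J (\<lambda>x. ident W x + scl W c (S x)) \<phi> = \<phi> + scl (dual ?N) c (J S \<phi>)"
    if S: "bounded_op W W S" and "\<phi> \<in> vecs (dual ?N)" for S c \<phi>
  proof -
    have \<phi>: "bounded_op ?N scalars \<phi>" using that by simp
    let ?S = "\<lambda>x. ident W x + scl W c (S x)"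
    have S': "bounded_op W W ?S" by (rule bounded_op_ident_plus[OF W(1) S])
    have "bounded_op ?N scalars (\<phi> + scl (dual ?N) c (J S \<phi>))"
      using add_mem[OF DN _ scl_mem[OF DN, of "J S \<phi>" c], of \<phi>] JN(1)[OF S \<phi>] \<phi> by simp
    then show ?thesis
    proof (rule eqI[OF JN(1)[OF S' \<phi>]])
      fix T f y assume T: "bounded_op X Y T" "nuclear_rep X Y T f y"
        and fy: "\<And>n. bounded_op X scalars (f n)" "\<And>n. y n \<in> vecs Y"
      have "act ?S (bil \<phi>) (f n) (y n) = \<phi> (tensor Y (f n) (y n)) + c * act S (bil \<phi>) (f n) (y n)" for n
        using affine[OF S bil[OF \<phi>] fy(1)[of n] fy(2)[of n], of c] by (simp add: bil_def)
      then have "(\<lambda>n. \<phi> (tensor Y (f n) (y n)) + c * act S (bil \<phi>) (f n) (y n)) sums J ?S \<phi> T"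
        using J_sums[OF S' \<phi> T] by simp
      then show "J ?S \<phi> T = (\<phi> + scl (dual ?N) c (J S \<phi>)) T"
        using sums_unique2 sums_add[OF functional_nuclear_rep_sums[OF X Y \<phi> T] sums_mult[OF J_sums[OF S \<phi> T], of c]]
        by fastforce
    qed
  qed
  ultimately show ?thesis
    using J by (intro numerical_index_transfer[OF W(1) DN W(2), where J = J]) blast+
qed

end

section \<open>Operators on the dual of a factor act on bilinear forms\<close>

text \<open>A bounded bilinear form on \<open>U\<close>, \<open>V\<close> is an operator from \<open>U\<close> to \<open>V\<^sup>*\<close> as well as an operator
  from \<open>V\<close> to \<open>U\<^sup>*\<close>; operators on \<open>V\<^sup>*\<close> and on \<open>U\<^sup>*\<close> act by composition.\<close>

definition act_right ::
    "('k::zero, 'b) nspace \<Rightarrow> (('b \<Rightarrow> 'k) \<Rightarrow> ('b \<Rightarrow> 'k)) \<Rightarrow> ('a \<Rightarrow> 'b \<Rightarrow> 'k) \<Rightarrow> 'a \<Rightarrow> 'b \<Rightarrow> 'k" where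
  "act_right V S B u v = S (trunc V (B u)) v"

definition act_left ::
    "('k::zero, 'a) nspace \<Rightarrow> (('a \<Rightarrow> 'k) \<Rightarrow> ('a \<Rightarrow> 'k)) \<Rightarrow> ('a \<Rightarrow> 'b \<Rightarrow> 'k) \<Rightarrow> 'a \<Rightarrow> 'b \<Rightarrow> 'k" where
  "act_left U S B u v = act_right U S (\<lambda>v u. B u v) v u"

lemma act_right_tensor:
  fixes V :: "('k::real_or_complex, 'b::ab_group_add) nspace"
  assumes S: "bounded_op (dual V) (dual V) S" and g: "bounded_op V scalars g"
    and B: "\<And>v. v \<in> vecs V \<Longrightarrow> B u v = c * g v"
  shows "act_right V S B u v = c * S g v"
proof -
  have "trunc V (B u) = scl (dual V) c g"
    using B bounded_opD(2)[OF g] by (auto simp: trunc_def fun_eq_iff)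
  then show ?thesis using bounded_opD(4)[OF S, of g c] g by (simp add: act_right_def)
qed

context
  fixes U :: "('k::real_or_complex, 'a::ab_group_add) nspace"
    and V :: "('k, 'b::ab_group_add) nspace"
  assumes U: "normed_space U" and V: "normed_space V"
begin

lemma section_functional:
  assumes B: "bilinear_form U V B C" and u: "u \<in> vecs U"
  shows "bounded_op V scalars (trunc V (B u))" "nrm (dual V) (trunc V (B u)) \<le> C * nrm U u"
  using bounded_op_bilinear_right[OF V B u order_refl] bilinear_formD(1)[OF B] nrm_nonneg[OF U u]
  by simp_all

lemma act_right_form:
  assumes S: "bounded_op (dual V) (dual V) S" and B: "bilinear_form U V B C"
  shows "bilinear_form U V (act_right V S B) (nrm (bounded_ops (dual V) (dual V)) S * C)"
proof -
  let ?M = "nrm (bounded_ops (dual V) (dual V)) S"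
  note D = normed_dual[OF V] and sec = section_functional[OF B]
  have M: "0 \<le> ?M" by (rule opnorm_nonneg[OF D D S])
  have Sm: "bounded_op V scalars (S g)" for g using op_range[OF D D S, of g] by simp
  have "trunc V (B (u + u')) = trunc V (B u) + trunc V (B u')" if "u \<in> vecs U" "u' \<in> vecs U" for u u'
    using that by (auto simp: trunc_def fun_eq_iff bilinear_formD[OF B])
  moreover have "trunc V (B (scl U c u)) = scl (dual V) c (trunc V (B u))" if "u \<in> vecs U" for c u
    using that by (auto simp: trunc_def fun_eq_iff bilinear_formD[OF B])
  moreover have "norm (act_right V S B u v) \<le> ?M * C * (nrm U u * nrm V v)"
    if u: "u \<in> vecs U" and v: "v \<in> vecs V" for u v
  proof -
    have "nrm (dual V) (S (trunc V (B u))) \<le> ?M * (C * nrm U u)"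
      using op_bound[OF D D S, of "trunc V (B u)"] sec[OF u] mult_left_mono[OF sec(2)[OF u] M] by simp
    then have "nrm (dual V) (S (trunc V (B u))) * nrm V v \<le> ?M * (C * nrm U u) * nrm V v"
      by (rule mult_right_mono[OF _ nrm_nonneg[OF V v]])
    then show ?thesis
      using functional_bound[OF V Sm v, of "trunc V (B u)"] by (simp add: act_right_def mult_ac)
  qed
  ultimately show ?thesis
    unfolding bilinear_form_def act_right_def
    using M bilinear_formD(1)[OF B] sec(1) bounded_opD(3,4)[OF S] bounded_opD(3,4)[OF Sm]
    by (simp add: mult.assoc)
qed

lemma act_right_linear:
  assumes S: "bounded_op (dual V) (dual V) S" and B: "bilinear_form U V B C" and u: "u \<in> vecs U"
  shows "bilinear_form U V B' C' \<Longrightarrow>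
      act_right V S (\<lambda>u v. B u v + B' u v) u v = act_right V S B u v + act_right V S B' u v"
    "act_right V S (\<lambda>u v. c * B u v) u v = c * act_right V S B u v"
    "v \<in> vecs V \<Longrightarrow> act_right V (\<lambda>g. ident (dual V) g + scl (dual V) c (S g)) B u v
      = B u v + c * act_right V S B u v"
proof -
  note sec = section_functional(1)[OF _ u]
  have "trunc V (\<lambda>v. B u v + B' u v) = trunc V (B u) + trunc V (B' u)"
    by (auto simp: trunc_def fun_eq_iff)
  then show "act_right V S (\<lambda>u v. B u v + B' u v) u v = act_right V S B u v + act_right V S B' u v"
    if "bilinear_form U V B' C'"
    using bounded_opD(3)[OF S, of "trunc V (B u)" "trunc V (B' u)"] sec[OF B] sec[OF that]
    by (simp add: act_right_def)
  have "trunc V (\<lambda>v. c * B u v) = scl (dual V) c (trunc V (B u))"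
    by (auto simp: trunc_def fun_eq_iff)
  then show "act_right V S (\<lambda>u v. c * B u v) u v = c * act_right V S B u v"
    using bounded_opD(4)[OF S, of "trunc V (B u)" c] sec[OF B] by (simp add: act_right_def)
  show "act_right V (\<lambda>g. ident (dual V) g + scl (dual V) c (S g)) B u v = B u v + c * act_right V S B u v"
    if "v \<in> vecs V"
    using sec[OF B] that by (simp add: act_right_def ident_def) (simp add: trunc_def)
qed

end

context
  fixes X :: "('k::real_or_complex, 'a::ab_group_add) nspace"
    and Y :: "('k, 'b::ab_group_add) nspace"
  assumes X: "normed_space X" and Y: "normed_space Y"
    and nzX: "vecs X \<noteq> {0}" and nzY: "vecs Y \<noteq> {0}"
    and AP: "approximation_property (dual X) \<or> approximation_property Y"
begin

text \<open>The norm of the action of \<open>S\<close> is seen on forms \<open>G \<otimes> g\<close>, which go to \<open>G \<otimes> S g\<close>, with a fixed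
  \<open>G\<close> that supports a unit vector \<open>f\<close> of \<open>X\<^sup>*\<close>.\<close>

theorem numerical_index_dual_nuclear_ops_le_dual_codomain:
  "numerical_index (dual (nuclear_ops X Y)) \<le> numerical_index (dual Y)"
proof (rule numerical_index_dual_nuclear_ops_le[OF X Y AP, where act = "act_right Y"])
  note D = normed_dual[OF X] and DY = normed_dual[OF Y]
  fix S and M :: real assume S: "bounded_op (dual Y) (dual Y) S" and M: "0 \<le> M"
    and bound: "\<And>G g f y. \<lbrakk>bounded_op (dual X) scalars G; bounded_op Y scalars g; bounded_op X scalars f; y \<in> vecs Y\<rbrakk>
      \<Longrightarrow> \<exists>B. (\<forall>f y. bounded_op X scalars f \<longrightarrow> y \<in> vecs Y \<longrightarrow> B f y = G f * g y) \<and>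
        norm (act_right Y S B f y) \<le> M * (nrm (dual (dual X)) G * nrm (dual Y) g) * (nrm (dual X) f * nrm Y y)"
  obtain f where f: "f \<in> vecs (dual X)" "nrm (dual X) f = 1"
    using ex_unit_vector[OF D dual_nonzero[OF X nzX]] .
  obtain G where G: "bounded_op (dual X) scalars G" "nrm (dual (dual X)) G = 1" "G f = 1"
    using ex_unit_support_functional[OF D f] .
  have b: "norm (S g y) \<le> M * nrm (dual Y) g * nrm Y y" if g: "bounded_op Y scalars g" and y: "y \<in> vecs Y" for g y
  proof -
    have f': "bounded_op X scalars f" using f by simp
    obtain B where B: "\<And>f y. \<lbrakk>bounded_op X scalars f; y \<in> vecs Y\<rbrakk> \<Longrightarrow> B f y = G f * g y"
      and n: "norm (act_right Y S B f y) \<le> M * (nrm (dual (dual X)) G * nrm (dual Y) g) * (nrm (dual X) f * nrm Y y)"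
      using bound[OF G(1) g f' y] by blast
    have "act_right Y S B f y = 1 * S g y"
      by (rule act_right_tensor[OF S g]) (simp add: B f' G(3))
    then show ?thesis using n f(2) G(2) by simp
  qed
  show "nrm (bounded_ops (dual Y) (dual Y)) S \<le> M"
  proof (rule opnorm_le[OF DY DY _ M])
    fix g assume "g \<in> vecs (dual Y)"
    then show "nrm (dual Y) (S g) \<le> M * nrm (dual Y) g"
      using b M nrm_nonneg[OF DY] by (intro functional_norm_le[OF Y]) auto
  qed
qed (use dual_nonzero[OF Y nzY] normed_dual[OF Y] act_right_form[OF normed_dual[OF X] Y]
    act_right_linear[OF normed_dual[OF X] Y] in auto)

text \<open>Here \<open>G \<otimes> g\<close> goes to \<open>S G \<otimes> g\<close>, and the fixed functional \<open>g\<close> supports a unit vector of \<open>Y\<close>.\<close>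

theorem numerical_index_dual_nuclear_ops_le_bidual_domain:
  "numerical_index (dual (nuclear_ops X Y)) \<le> numerical_index (dual (dual X))"
proof (rule numerical_index_dual_nuclear_ops_le[OF X Y AP, where act = "act_left (dual X)"])
  note D = normed_dual[OF X] and DD = normed_dual[OF normed_dual[OF X]]
  note swap = bilinear_form_swap
  show "normed_space (dual (dual X))" by (rule DD)
  show "vecs (dual (dual X)) \<noteq> {0}" by (intro dual_nonzero D X nzX)
  fix S assume S: "bounded_op (dual (dual X)) (dual (dual X)) S"
  show "bilinear_form (dual X) Y (act_left (dual X) S B) (nrm (bounded_ops (dual (dual X)) (dual (dual X))) S * C)"
    if "bilinear_form (dual X) Y B C" for B C
    unfolding act_left_def by (rule swap[OF act_right_form[OF Y D S swap[OF that]]])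
  show "act_left (dual X) S (\<lambda>f y. B f y + B' f y) f y = act_left (dual X) S B f y + act_left (dual X) S B' f y"
    if "bilinear_form (dual X) Y B C" "bilinear_form (dual X) Y B' C'" "y \<in> vecs Y" for B B' C C' f y
    unfolding act_left_def by (rule act_right_linear(1)[OF Y D S swap[OF that(1)] that(3) swap[OF that(2)]])
  show "act_left (dual X) S (\<lambda>f y. c * B f y) f y = c * act_left (dual X) S B f y"
    if "bilinear_form (dual X) Y B C" "y \<in> vecs Y" for B C c f y
    unfolding act_left_def by (rule act_right_linear(2)[OF Y D S swap[OF that(1)] that(2)])
  show "act_left (dual X) (\<lambda>x. ident (dual (dual X)) x + scl (dual (dual X)) c (S x)) B f y
      = B f y + c * act_left (dual X) S B f y"
    if "bilinear_form (dual X) Y B C" "bounded_op X scalars f" "y \<in> vecs Y" for B C c f y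
    unfolding act_left_def
    using act_right_linear(3)[OF Y D S swap[OF that(1)] that(3)] that(2) by simp
  fix M :: real assume M: "0 \<le> M"
    and bound: "\<And>G g f y. \<lbrakk>bounded_op (dual X) scalars G; bounded_op Y scalars g; bounded_op X scalars f; y \<in> vecs Y\<rbrakk>
      \<Longrightarrow> \<exists>B. (\<forall>f y. bounded_op X scalars f \<longrightarrow> y \<in> vecs Y \<longrightarrow> B f y = G f * g y) \<and>
        norm (act_left (dual X) S B f y) \<le> M * (nrm (dual (dual X)) G * nrm (dual Y) g) * (nrm (dual X) f * nrm Y y)"
  obtain y where y: "y \<in> vecs Y" "nrm Y y = 1" using ex_unit_vector[OF Y nzY] .
  obtain g where g: "bounded_op Y scalars g" "nrm (dual Y) g = 1" "g y = 1"
    using ex_unit_support_functional[OF Y y] .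
  have b: "norm (S G f) \<le> M * nrm (dual (dual X)) G * nrm (dual X) f"
    if G: "bounded_op (dual X) scalars G" and f: "bounded_op X scalars f" for G f
  proof -
    obtain B where B: "\<And>f y. \<lbrakk>bounded_op X scalars f; y \<in> vecs Y\<rbrakk> \<Longrightarrow> B f y = G f * g y"
      and n: "norm (act_left (dual X) S B f y) \<le> M * (nrm (dual (dual X)) G * nrm (dual Y) g) * (nrm (dual X) f * nrm Y y)"
      using bound[OF G g(1) f y(1)] by blast
    have "act_right (dual X) S (\<lambda>v u. B u v) y f = 1 * S G f"
      by (rule act_right_tensor[OF S G]) (simp add: B y(1) g(3))
    then show ?thesis using n y(2) g(2) by (simp add: act_left_def)
  qed
  show "nrm (bounded_ops (dual (dual X)) (dual (dual X))) S \<le> M"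
  proof (rule opnorm_le[OF DD DD _ M])
    fix G assume "G \<in> vecs (dual (dual X))"
    then show "nrm (dual (dual X)) (S G) \<le> M * nrm (dual (dual X)) G"
      using b M nrm_nonneg[OF DD] by (intro functional_norm_le[OF D]) auto
  qed
qed

end

theorem corollary3p7:
  fixes X :: "('k::real_or_complex, 'a::ab_group_add) nspace"
    and Y :: "('k, 'b::ab_group_add) nspace"
  assumes "banach_space X" and "vecs X \<noteq> {0}"
    and "banach_space Y" and "vecs Y \<noteq> {0}"
    and "approximation_property (dual X) \<or> approximation_property Y"
  shows "numerical_index (nuclear_ops X Y) \<le> min (numerical_index (dual X)) (numerical_index Y) \<and>
    numerical_index (dual (nuclear_ops X Y)) \<le>
      min (numerical_index (dual (dual X))) (numerical_index (dual Y))"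
proof -
  note X = banach_imp_normed[OF assms(1)] and Y = banach_imp_normed[OF assms(3)]
  show ?thesis
    using numerical_index_nuclear_ops_le_dual_domain[OF X assms(3,2,4)]
      numerical_index_nuclear_ops_le_codomain[OF X Y assms(2,4)]
      numerical_index_dual_nuclear_ops_le_bidual_domain[OF X Y assms(2,4,5)]
      numerical_index_dual_nuclear_ops_le_dual_codomain[OF X Y assms(2,4,5)]
    by simp
qed

end
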